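(* Let $p>3$ be a prime and let $D_n=\sum_{k=0}^n\binom nk^2\binom{2k}k\binom{2n-2k}{n-k}$ for $n\ge 0$ (the Domb numbers). Then $$\sum_{n=0}^{p-1}\frac{D_n}{16^n}\equiv \sum_{n=0}^{p-1}\frac{D_n}{4^n}\equiv \begin{cases}4x^2-2p\pmod{p^2}&\text{if }p\equiv 1\pmod 3\text{ and } p=x^2+3y^2 \text{ with } x,y\in\mathbb Z,\\ 0\pmod{p^2}&\text{if }p\equiv 2\pmod 3.\end{cases}$$
   Context: Congruences modulo powers of $p$ are taken in the ring $\mathbb Z_p$ of rational numbers whose denominators are not divisible by $p$. Every prime $p\equiv1\pmod 3$ can be written as $x^2+3y^2$ with integers $x,y$. *)

theory Defs
  imports Complex_Main "HOL-Number_Theory.Number_Theory"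
begin

definition domb :: "nat \<Rightarrow> nat" where
  "domb n = (\<Sum>k=0..n. (n choose k)\<^sup>2 * ((2 * k) choose k) * ((2 * n - 2 * k) choose (n - k)))"

text \<open>The ring of rational numbers whose denominators (in lowest terms, as given by
  \<^const>\<open>quotient_of\<close>) are not divisible by \<open>p\<close>.\<close>

definition p_integral :: "nat \<Rightarrow> rat set" where
  "p_integral p = {r. \<not> int p dvd snd (quotient_of r)}"

text \<open>Congruence modulo \<open>p ^ m\<close> in that ring: both sides belong to the ring, and their
  difference lies in the ideal generated by \<open>p ^ m\<close>.\<close>

definition p_cong :: "nat \<Rightarrow> nat \<Rightarrow> rat \<Rightarrow> rat \<Rightarrow> bool" where
  "p_cong p m a b \<longleftrightarrow>
     a \<in> p_integral p \<and> b \<in> p_integral p \<and> (\<exists>c\<in>p_integral p. a - b = of_nat p ^ m * c)"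

end

theory Submission
  imports Defs "HOL-Computational_Algebra.Formal_Power_Series"
begin

text \<open>
  The Domb numbers have the expansions \<open>D n = (\<Sum>k. C(2k,k)^2 C(3k,k) C(n+k,3k) 4^(n-2k))\<close> and
  \<open>D n = (\<Sum>k. (-1)^k C(2k,k)^2 C(3k,k) C(n+2k,3k) 16^(n-k))\<close>, because all three sequences satisfy
  the same three-term recurrence. Summing over \<open>n < p\<close> first (hockey stick) and using
  \<open>C(2k,k)^2 / 16^k \<equiv> (-1)^k C(m,k) C(m+k,k)\<close> with \<open>m = (p-1)/2\<close> turns both sums, modulo \<open>p^2\<close>, into
  \<open>\<Sum>k\<le>m. p (-1)^k C(m,k) C(m+k,k) / (3k+1)\<close>, which partial fractions evaluate as
  \<open>p (\<Prod>i=1..m. 3i-1) / (\<Prod>i\<le>m. 3i+1)\<close>. If \<open>p \<equiv> 2\<close> modulo 3 the numerator contains another factor \<open>p\<close>.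
  If \<open>p = 6r+1\<close>, the quotient is \<open>C(3r,r)^2 (1 - p h)\<close> modulo \<open>p^2\<close> for an explicit combination \<open>h\<close> of
  harmonic numbers. On the other hand the character sum \<open>S = (\<Sum>a. ((a^3+1)/p))\<close> can be expanded modulo
  \<open>p^2\<close> over the Teichmueller representatives \<open>a^p\<close>, which yields
  \<open>S \<equiv> - C(3r,r) (1 - p h / 2) + p e / 2\<close> with \<open>C(3r,r) e \<equiv> -2\<close> modulo \<open>p\<close>, so both sums are \<open>S^2 - 2p\<close>.
  Finally \<open>S^2 = 4 x^2\<close>: the twists of \<open>S\<close> by the three cubic classes have sum 0 and sum of squares \<open>6p\<close>,
  hence \<open>S^2 + 3 d^2 = 4 p\<close>, and \<open>S\<close> is even.
\<close>

section \<open>Two formulas for the Domb numbers\<close>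

text \<open>A factor p in front of a term lowers the precision needed for the rest to modulo p. This
  fails for at most one index: if p = 6r+1, the denominator 3k+1 equals p at k = 2r, and that
  summand must be known modulo p^2. For both expansions the binomial weight there is 1 modulo p^2,
  because the linear terms of C(p+j,j) and (-1)^j C(p-1,j) cancel; this is why the two sums agree.
  For the character sum the obstacle is that Euler's criterion and the power sums of residues hold
  only modulo p. Passing to p-th powers repairs both: modulo p^2, a^p depends only on the class of
  a, and for a prime to p it is a (p-1)-th root of unity. The price is that a^(3p) + 1 need not be
  such a representative; its defect, built from the quotients C(p,i)/p, produces both h and e.
  Squaring the expansion of S gives C(3r,r)^2 (1 - p h) - p C(3r,r) e, and the congruence for
  C(3r,r) e turns the last term into 2p. Only S^2 enters, so the sign of S never has to be
  determined.\<close>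

definition rfact :: "int \<Rightarrow> rat" where
  "rfact j = (if j < 0 then 0 else 1 / fact (nat j))"

text \<open>The convention 1/j! = 0 for negative j makes the shift valid for all integers, in
  particular at j = 0. Certificates can then be verified for every k without boundary cases.\<close>

lemma rfact_minus_one: "rfact (j - 1) = of_int j * rfact j"
proof (cases "j > 0")
  case True
  then obtain i where "j = int (Suc i)"
    by (metis gr0_implies_Suc zero_less_imp_eq_int)
  then have "nat j = Suc i" "nat (j - 1) = i" "j > 0" by auto
  then show ?thesis
    using \<open>j = int (Suc i)\<close> by (simp add: rfact_def del: of_nat_Suc)
qed (auto simp: rfact_def)

text \<open>This is C(2j,j) / j!^2, so that the Domb summand becomes n!^2 times a product of two
  values, at k and at n - k.\<close>

definition cfact :: "int \<Rightarrow> rat" where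
  "cfact j = (if j < 0 then 0 else fact (2 * nat j) / fact (nat j) ^ 4)"

lemma cfact_step: "of_int j ^ 3 * cfact j = 2 * (2 * of_int j - 1) * cfact (j - 1)"
proof (cases "j > 0")
  case True
  then obtain i where "j = int (Suc i)"
    by (metis gr0_implies_Suc zero_less_imp_eq_int)
  then have ij: "nat j = Suc i" "nat (j - 1) = i" "2 * Suc i = Suc (Suc (2 * i))" by auto
  then have "cfact j = (2*of_nat i+2)*(2*of_nat i+1)*fact (2*i)/((of_nat i+1)^4 * fact i ^4)"
    and "cfact (j - 1) = fact (2*i)/fact i^4" and "of_int j = (of_nat i + 1 :: rat)"
    using \<open>j = int (Suc i)\<close> unfolding cfact_def ij fact_Suc
    by (simp_all add: power_mult_distrib) (simp_all add: algebra_simps)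
  moreover have "(of_nat i + 1 :: rat) \<noteq> 0"
    by (metis of_nat_Suc of_nat_neq_0 add.commute)
  ultimately show ?thesis
    by (simp only:) (simp add: divide_simps, simp add: algebra_simps power_numeral_reduce)
qed (auto simp: cfact_def)

text \<open>One range \<open>{..<N}\<close> serves for all three sums: the summands vanish beyond
  their natural support, so the range need not depend on the index of the recurrence.\<close>

lemma creative_telescoping:
  fixes a b c :: rat
  assumes "\<And>k. a * F2 k - b * F1 k + c * F0 k = G (Suc k) - G k" and "G 0 = 0" and "G N = 0"
  shows "a * (\<Sum>k<N. F2 k) - b * (\<Sum>k<N. F1 k) + c * (\<Sum>k<N. F0 k) = 0"
proof -
  have "a * (\<Sum>k<N. F2 k) - b * (\<Sum>k<N. F1 k) + c * (\<Sum>k<N. F0 k) =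
      (\<Sum>k<N. a * F2 k - b * F1 k + c * F0 k)"
    by (simp add: sum_distrib_left sum.distrib sum_subtractf)
  also have "\<dots> = G N - G 0"
    using assms(1) by (simp add: sum_lessThan_telescope)
  finally show ?thesis
    using assms by simp
qed

text \<open>The classical Apery-like recurrence of the Domb numbers, n^3 D(n) = 2(2n-1)(5n^2-5n+2)
  D(n-1) - 64(n-1)^3 D(n-2), shifted by 2.\<close>

definition domb_recurrence :: "(nat \<Rightarrow> rat) \<Rightarrow> bool" where
  "domb_recurrence f \<longleftrightarrow> (\<forall>n.
     (of_nat n + 2) ^ 3 * f (n + 2)
     - 2 * (2 * of_nat n + 3) * (5 * (of_nat n + 1)\<^sup>2 + 5 * (of_nat n + 1) + 2) * f (n + 1)
     + 64 * (of_nat n + 1) ^ 3 * f n = 0)"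

lemma domb_recurrence_unique:
  assumes "domb_recurrence f" and "domb_recurrence g" and "f 0 = g 0" and "f 1 = g 1"
  shows "f n = g n"
proof (induction n rule: less_induct)
  case (less n)
  show ?case
  proof (cases "n < 2")
    case True
    then have "n = 0 \<or> n = 1" by auto
    then show ?thesis using assms by auto
  next
    case False
    then obtain i where i: "n = i + 2"
      by (metis add.commute le_Suc_ex not_less)
    have "f i = g i" "f (i + 1) = g (i + 1)"
      using less.IH i by auto
    moreover have "(of_nat i + 2 :: rat) ^ 3 \<noteq> 0"
      by (metis of_nat_0_eq_iff of_nat_add of_nat_numeral power_not_zero add_is_0 zero_neq_numeral)
    moreover have "(of_nat i + 2 :: rat) ^ 3 * f (i + 2) = (of_nat i + 2) ^ 3 * g (i + 2)"
      using spec[OF assms(1)[unfolded domb_recurrence_def], of i]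
        spec[OF assms(2)[unfolded domb_recurrence_def], of i] \<open>f i = g i\<close> \<open>f (i + 1) = g (i + 1)\<close>
      by (simp only:)
    ultimately show ?thesis
      using i by (metis mult_left_cancel)
  qed
qed

lemma domb_recurrence_domb: "domb_recurrence (\<lambda>n. of_nat (domb n))"
proof -
  define F where "F n k = fact n ^ 2 * cfact (int k) * cfact (int n - int k)" for n k :: nat
  have term_eq: "of_nat ((n choose k)\<^sup>2 * ((2 * k) choose k) * ((2 * n - 2 * k) choose (n - k))) = F n k"
    if "k \<le> n" for n k
  proof -
    obtain j where n: "n = k + j" using \<open>k \<le> n\<close> le_Suc_ex by blast
    have j: "2 * (k + j) - 2 * k = 2 * j" "k + j - k = j" "int (k + j) - int k = int j" by auto
    have "of_nat (k + j choose k) = (fact (k + j) / (fact k * fact j) :: rat)"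
      "of_nat (2 * k choose k) = (fact (2 * k) / (fact k * fact k) :: rat)"
      "of_nat (2 * j choose j) = (fact (2 * j) / (fact j * fact j) :: rat)"
      using binomial_fact[of k "k + j"] binomial_fact[of k "2 * k"] binomial_fact[of j "2 * j"] by simp_all
    then show ?thesis
      unfolding F_def n j cfact_def
      by (simp add: power2_eq_square power4_eq_xxxx)
  qed
  have sum_eq: "of_nat (domb n) = (\<Sum>k<n + 1 + i. F n k)" for n i
  proof -
    have "of_nat (domb n) = (\<Sum>k=0..n. F n k)"
      unfolding domb_def of_nat_sum using term_eq by (intro sum.cong) auto
    also have "\<dots> = (\<Sum>k<n + 1 + i. F n k)"
      by (intro sum.mono_neutral_left) (auto simp: F_def cfact_def)
    finally show ?thesis .
  qed
  \<comment> \<open>\<open>q\<close> and the two factors \<open>576 n + 768\<close>, \<open>2304 n + 3840\<close> below are certificates found by Zeilberger's algorithm.\<close>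
  define q :: "rat \<Rightarrow> rat \<Rightarrow> rat" where "q n k =
    -56 + 74*k - 30*k^2 + 4*k^3 + n*(-216 + 237*k - 78*k^2 + 8*k^3) + n^2*(-326+278*k-66*k^2+4*k^3)
    + n^3*(-240+141*k-18*k^2) + n^4*(-86+26*k) - 12*n^5" for n k
  \<comment> \<open>The denominator is the factor 2j - 1 of \<open>cfact_step\<close> at j = n + 2 -
    k. It is an odd integer, hence nonzero for every k.\<close>
  define G where "G n k = of_nat k ^ 3 * q (of_nat n) (of_nat k) / (2 * (of_nat n + 2 - of_nat k) - 1)
    * (fact n ^ 2 * cfact (int k) * cfact (int n + 2 - int k))" for n k :: nat
  show ?thesis
    unfolding domb_recurrence_def
  proof
    fix n :: nat
    have cert: "(of_nat n + 2) ^ 3 * F (n + 2) k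
     - 2 * (2 * of_nat n + 3) * (5 * (of_nat n + 1)\<^sup>2 + 5 * (of_nat n + 1) + 2) * F (n + 1) k
     + 64 * (of_nat n + 1) ^ 3 * F n k = G n (Suc k) - G n k" for k
    proof -
      define x y :: rat where "x = of_nat n" and "y = of_nat k"
      define d e :: rat where "d = 2 * (x + 2 - y) - 1" and "e = d - 2"
      have "odd (2 * (int n + 2 - int k) - 1)" "odd (2 * (int n + 2 - int k) - 3)" by auto
      then have "2 * (int n + 2 - int k) - 1 \<noteq> 0" "2 * (int n + 2 - int k) - 3 \<noteq> 0" by (metis even_zero)+
      then have "of_int (2 * (int n + 2 - int k) - 1) \<noteq> (0::rat)"
        "of_int (2 * (int n + 2 - int k) - 3) \<noteq> (0::rat)"
        by (simp_all only: of_int_eq_0_iff not_False_eq_True)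
      then have de: "d \<noteq> 0" "e \<noteq> 0"
        unfolding d_def e_def x_def y_def by (simp_all add: algebra_simps)
      define R where "R = cfact (int n + 2 - int k)"
      define R1 where "R1 = cfact (int n + 1 - int k)"
      define R0 where "R0 = cfact (int n - int k)"
      define A where "A = cfact (int k)"
      define A1 where "A1 = cfact (int k + 1)"
      define f :: rat where "f = fact n"
      have R1: "(x + 2 - y)^3 * R = 2 * d * R1"
        using cfact_step[of "int n + 2 - int k"]
        by (simp add: R_def R1_def d_def x_def y_def algebra_simps)
      have R0: "(x + 1 - y)^3 * R1 = 2 * e * R0"
        using cfact_step[of "int n + 1 - int k"]
        by (simp add: R0_def R1_def d_def e_def x_def y_def algebra_simps)
      have A1: "(y + 1)^3 * A1 = 2 * (2 * y + 1) * A"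
        using cfact_step[of "int k + 1"]
        by (simp add: A_def A1_def y_def algebra_simps)
      have f2: "fact (n + 2) = (x + 2) * (x + 1) * f" "fact (n + 1) = (x + 1) * f"
        by (simp_all add: x_def f_def algebra_simps)
      have i: "int (n + 2) - int k = int n + 2 - int k" "int (n + 1) - int k = int n + 1 - int k"
        "int n + 2 - (int k + 1) = int n + 1 - int k" "int (Suc k) = int k + 1"
        "(of_nat (Suc k) :: rat) = y + 1"
        by (auto simp: y_def)
      have e': "2 * (x + 2 - (y + 1)) - 1 = e"
        by (simp add: e_def d_def)
      \<comment> \<open>The coefficients and cubes are kept as variables, so that the common factor
        can be extracted without expanding them.\<close>
      have aux: "a3 * ((a*b*f)^2*A*R) - c1*c2*c3*((b*f)^2*A*(t*R/(2*d))) + 64*g*(f^2*A*(s*(t*R/(2*d))/(2*e)))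
          = f^2*A*R/(4*d*e) * (a3*a^2*b^2*4*d*e - c1*c2*c3*b^2*t*2*e + 64*g*s*t)"
        if "d \<noteq> 0" "e \<noteq> 0" for a3 a b f A R c1 c2 c3 t d g s e :: rat
        using that by (simp add: field_simps power2_eq_square)
      \<comment> \<open>All that is specific to the certificate \<open>q\<close> is contained in
        this polynomial identity.\<close>
      have poly: "(x+2)^3 * (x+2)^2 * (x+1)^2 * 4 * d * e
          - 2 * (2*x+3) * (5*(x+1)^2+5*(x+1)+2) * (x+1)^2 * (x+2-y)^3 * 2 * e
          + 64 * (x+1)^3 * (x+1-y)^3 * (x+2-y)^3
          = 4 * (2*y+1) * (x+2-y)^3 * q x (y+1) - 4 * e * y^3 * q x y"
        unfolding e_def d_def q_def
        by (simp add: algebra_simps power2_eq_square power3_eq_cube power_numeral_reduce)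
      have R1': "R1 = (x + 2 - y)^3 * R / (2 * d)" using R1 de by (simp add: field_simps)
      have R0': "R0 = (x + 1 - y)^3 * R1 / (2 * e)" using R0 de by (simp add: field_simps)
      have "(x + 2)^3 * (((x+2)*(x+1)*f)^2 * A * R) - 2 * (2*x+3)*(5*(x+1)^2+5*(x+1)+2) * (((x+1)*f)^2*A*R1)
         + 64 * (x+1)^3 * (f^2*A*R0) =
        q x (y + 1) / e * (f^2 * ((y+1)^3 * A1) * R1) - y^3 * q x y / d * (f^2 * A * R)"
        (is "?L = ?R")
      proof -
        have "?L = f^2 * A * R / (4 * d * e) * ((x+2)^3 * (x+2)^2 * (x+1)^2 * 4 * d * e
          - 2 * (2*x+3) * (5*(x+1)^2+5*(x+1)+2) * (x+1)^2 * (x+2-y)^3 * 2 * e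
          + 64 * (x+1)^3 * (x+1-y)^3 * (x+2-y)^3)"
          unfolding R0' R1' by (rule aux[OF de])
        also have "\<dots> = f^2 * A * R / (4 * d * e) *
            (4 * (2*y+1) * (x+2-y)^3 * q x (y+1) - 4 * e * y^3 * q x y)"
          unfolding poly ..
        also have "\<dots> = ?R"
          unfolding A1 R1' using de by (simp add: field_simps)
        finally show ?thesis .
      qed
      then show ?thesis
        unfolding F_def G_def f2 i x_def[symmetric] y_def[symmetric] R_def[symmetric] R1_def[symmetric]
          R0_def[symmetric] A_def[symmetric] A1_def[symmetric] f_def[symmetric] e' d_def[symmetric]
        by (simp add: mult_ac)
    qed
    have "G n 0 = 0" by (simp add: G_def)
    \<comment> \<open>Here \<open>cfact\<close> is evaluated at -1, where it is 0 by convention. The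
      bound n + 3 covers the supports of all three sums.\<close>
    moreover have "G n (n + 3) = 0" by (simp add: G_def cfact_def)
    ultimately show "(of_nat n + 2) ^ 3 * of_nat (domb (n + 2))
     - 2 * (2 * of_nat n + 3) * (5 * (of_nat n + 1)\<^sup>2 + 5 * (of_nat n + 1) + 2) * of_nat (domb (n + 1))
     + 64 * (of_nat n + 1) ^ 3 * of_nat (domb n) = (0 :: rat)"
      using creative_telescoping[of _ "F (n+2)" _ "F (n+1)" _ "F n" "G n" "n + 3", OF cert]
        sum_eq[of "n+2" 0] sum_eq[of "n+1" 1] sum_eq[of n 2]
      by (simp add: numeral_3_eq_3 numeral_2_eq_2)
  qed
qed


text \<open>The power 4^(n-2k) is written as a quotient because its exponent can be negative.
  Division by 4^n then leaves exactly the factor C(2k,k)^2 / 16^k, which \<open>dombB\<close> yields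
  as well after division by 16^n.\<close>

definition dombA :: "nat \<Rightarrow> nat \<Rightarrow> rat" where
  "dombA n k = of_nat ((2*k choose k)\<^sup>2 * (3*k choose k) * ((n+k) choose (3*k))) * 4^n / 16^k"

definition dombB :: "nat \<Rightarrow> nat \<Rightarrow> rat" where
  "dombB n k = (-1)^k * of_nat ((2*k choose k)\<^sup>2 * (3*k choose k) * ((n+2*k) choose (3*k))) * 16^n / 16^k"

text \<open>The factor (3k)! cancels, and the vanishing for 2k > n is absorbed by
  \<open>rfact\<close>, so the formula holds for every k.\<close>

lemma dombA_fact: "dombA n k = fact (2*k) * fact (n+k) / fact k ^ 5 * 4^n / 16^k * rfact (int n - 2 * int k)"
proof (cases "2*k \<le> n")
  case True
  have e: "rfact (int n - 2 * int k) = 1 / fact (n - 2*k)"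
    using True by (simp add: rfact_def nat_diff_distrib nat_mult_distrib)
  have "n + k - 3*k = n - 2*k" "3*k - k = 2*k" "3*k \<le> n+k"
    using True by auto
  then show ?thesis
    unfolding dombA_def e
    using binomial_fact[of k "2*k", where ?'a=rat] binomial_fact[of k "3*k", where ?'a=rat] binomial_fact[of "3*k" "n+k", where ?'a=rat]
    by (simp add: power2_eq_square power_numeral_reduce)
qed (simp add: dombA_def rfact_def binomial_eq_0)

lemma dombB_fact: "dombB n k = (-1)^k * fact (2*k) * fact (n+2*k) / fact k ^ 5 * 16^n / 16^k * rfact (int n - int k)"
proof (cases "k \<le> n")
  case True
  have e: "rfact (int n - int k) = 1 / fact (n - k)"
    using True by (simp add: rfact_def nat_diff_distrib)
  have "n + 2*k - 3*k = n - k" "3*k - k = 2*k" "3*k \<le> n+2*k"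
    using True by auto
  then show ?thesis
    unfolding dombB_def e
    using binomial_fact[of k "2*k", where ?'a=rat] binomial_fact[of k "3*k", where ?'a=rat] binomial_fact[of "3*k" "n+2*k", where ?'a=rat]
    by (simp add: power2_eq_square power_numeral_reduce mult_ac)
qed (simp add: dombB_def rfact_def binomial_eq_0)

lemma sum_dombA: "n < N \<Longrightarrow> (\<Sum>k<N. dombA n k) = (\<Sum>k=0..n. dombA n k)"
  by (intro sum.mono_neutral_right) (auto simp: dombA_fact rfact_def)

lemma sum_dombB: "n < N \<Longrightarrow> (\<Sum>k<N. dombB n k) = (\<Sum>k=0..n. dombB n k)"
  by (intro sum.mono_neutral_right) (auto simp: dombB_fact rfact_def)

text \<open>With \<open>R\<close> the reciprocal factorial of the largest argument n + 2 - 2k, all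
  summands and both certificate values are polynomial multiples of \<open>U * R\<close>. The factor
  k^4 in \<open>G\<close> is what clears the denominators created when k moves to k + 1 in (2k)! /
  k!^5.\<close>

lemma domb_recurrence_dombA: "domb_recurrence (\<lambda>n. \<Sum>k=0..n. dombA n k)"
  unfolding domb_recurrence_def
proof
  fix n :: nat
  define G where "G k = - (576 * of_nat n + 768) * of_nat k ^ 4 *
      (fact (2*k) * fact (n+k) / fact k ^ 5 * 4^n / 16^k * rfact (int n + 2 - 2 * int k))" for k
  have cert: "(of_nat n + 2) ^ 3 * dombA (n + 2) k
     - 2 * (2 * of_nat n + 3) * (5 * (of_nat n + 1)\<^sup>2 + 5 * (of_nat n + 1) + 2) * dombA (n + 1) k
     + 64 * (of_nat n + 1) ^ 3 * dombA n k = G (Suc k) - G k" for k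
  proof -
    define x y :: rat where "x = of_nat n" and "y = of_nat k"
    define U :: rat where "U = fact (2*k) * fact (n+k) / fact k ^ 5 * 4^n / 16^k"
    define R where "R = rfact (int n + 2 - 2 * int k)"
    have R1: "rfact (int n + 1 - 2 * int k) = (x + 2 - 2*y) * R"
      using rfact_minus_one[of "int n + 2 - 2 * int k"] by (simp add: R_def x_def y_def algebra_simps)
    have R0: "rfact (int n - 2 * int k) = (x + 1 - 2*y) * (x + 2 - 2*y) * R"
    proof -
      have "rfact (int n - 2 * int k) = (x + 1 - 2*y) * rfact (int n + 1 - 2 * int k)"
        using rfact_minus_one[of "int n + 1 - 2 * int k"] by (simp add: x_def y_def algebra_simps)
      then show ?thesis
        unfolding R1 by (simp only: mult.assoc)
    qed
    have F0: "dombA n k = U * ((x + 1 - 2*y) * (x + 2 - 2*y) * R)"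
      unfolding dombA_fact R0 U_def ..
    have F1: "dombA (n + 1) k = 4 * (x + y + 1) * U * ((x + 2 - 2*y) * R)"
    proof -
      have e: "int (n + 1) - 2 * int k = int n + 1 - 2 * int k"
        "fact (n + 1 + k) = (x + y + 1) * (fact (n + k) :: rat)" "(4::rat)^(n + 1) = 4 * 4^n"
        by (simp_all add: x_def y_def algebra_simps)
      show ?thesis
        unfolding dombA_fact U_def e R1 by simp
    qed
    have F2: "dombA (n + 2) k = 16 * (x + y + 1) * (x + y + 2) * U * R"
    proof -
      have e: "int (n + 2) - 2 * int k = int n + 2 - 2 * int k"
        "fact (n + 2 + k) = (x + y + 1) * (x + y + 2) * (fact (n + k) :: rat)" "(4::rat)^(n + 2) = 16 * 4^n"
        by (simp_all add: x_def y_def algebra_simps)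
      show ?thesis
        unfolding dombA_fact U_def e R_def by simp
    qed
    have y: "y + 1 \<noteq> 0" unfolding y_def by (metis of_nat_Suc of_nat_neq_0 add.commute)
    have gen: "z ^ 4 * ((2 * z) * w * v / z ^ 5) / 16 = w * v / 8" if "z \<noteq> 0" for z w v :: rat
      using that by (simp add: divide_simps power_numeral_reduce)
    have e: "fact (2 * Suc k) = (2*(y+1))*(2*y+1)*(fact (2*k)::rat)" "fact (n + Suc k) = (x+y+1)*(fact (n+k)::rat)"
       "fact (Suc k) = (y+1)*(fact k::rat)" "(16::rat)^Suc k = 16 * 16^k"
      by (simp_all add: x_def y_def algebra_simps)
    have "(y+1)^4 * (fact (2*Suc k) * fact (n+Suc k) / fact (Suc k) ^ 5 * 4^n / 16^Suc k) =
       (y+1)^4 * ((2*(y+1))*(2*y+1)*(x+y+1) / (y+1)^5) / 16 * U"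
      unfolding U_def e by (simp add: power_mult_distrib mult_ac)
    also have "(y+1)^4 * ((2*(y+1))*(2*y+1)*(x+y+1) / (y+1)^5) / 16 = (2*y+1)*(x+y+1)/8"
      by (rule gen[OF y])
    finally have U1: "(y+1)^4 * (fact (2*Suc k) * fact (n+Suc k) / fact (Suc k) ^ 5 * 4^n / 16^Suc k) =
       (2*y+1)*(x+y+1)/8 * U" .
    have "G (Suc k) = - (576 * x + 768) * ((y+1)^4 * (fact (2*Suc k) * fact (n+Suc k) / fact (Suc k) ^ 5 * 4^n / 16^Suc k))
       * rfact (int n - 2 * int k)"
      unfolding G_def x_def y_def by (simp add: algebra_simps)
    then have G1: "G (Suc k) = - (576 * x + 768) * ((2*y+1)*(x+y+1)/8 * U) * ((x + 1 - 2*y) * (x + 2 - 2*y) * R)"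
      unfolding U1 R0 .
    have G0: "G k = - (576 * x + 768) * y^4 * U * R"
      unfolding G_def U_def R_def x_def y_def by simp
    show ?thesis
      unfolding F0 F1 F2 G0 G1 x_def[symmetric]
      by (simp add: field_simps power2_eq_square power3_eq_cube power_numeral_reduce)
  qed
  have "G 0 = 0" by (simp add: G_def)
  moreover have "G (n + 3) = 0" by (simp add: G_def rfact_def)
  ultimately show "(of_nat n + 2) ^ 3 * (\<Sum>k=0..n+2. dombA (n+2) k)
     - 2 * (2 * of_nat n + 3) * (5 * (of_nat n + 1)\<^sup>2 + 5 * (of_nat n + 1) + 2) * (\<Sum>k=0..n+1. dombA (n+1) k)
     + 64 * (of_nat n + 1) ^ 3 * (\<Sum>k=0..n. dombA n k) = 0"
    using creative_telescoping[of _ "dombA (n+2)" _ "dombA (n+1)" _ "dombA n" G "n+3", OF cert]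
    by (simp add: sum_dombA)
qed

lemma domb_recurrence_dombB: "domb_recurrence (\<lambda>n. \<Sum>k=0..n. dombB n k)"
  unfolding domb_recurrence_def
proof
  fix n :: nat
  define G where "G k = - (2304 * of_nat n + 3840) * of_nat k ^ 4 *
      ((-1)^k * fact (2*k) * fact (n+2*k) / fact k ^ 5 * 16^n / 16^k * rfact (int n + 2 - int k))" for k
  have cert: "(of_nat n + 2) ^ 3 * dombB (n + 2) k
     - 2 * (2 * of_nat n + 3) * (5 * (of_nat n + 1)\<^sup>2 + 5 * (of_nat n + 1) + 2) * dombB (n + 1) k
     + 64 * (of_nat n + 1) ^ 3 * dombB n k = G (Suc k) - G k" for k
  proof -
    define x y :: rat where "x = of_nat n" and "y = of_nat k"
    define U :: rat where "U = (-1)^k * fact (2*k) * fact (n+2*k) / fact k ^ 5 * 16^n / 16^k"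
    define R where "R = rfact (int n + 2 - int k)"
    have R1: "rfact (int n + 1 - int k) = (x + 2 - y) * R"
      using rfact_minus_one[of "int n + 2 - int k"] by (simp add: R_def x_def y_def algebra_simps)
    have R0: "rfact (int n - int k) = (x + 1 - y) * (x + 2 - y) * R"
    proof -
      have "rfact (int n - int k) = (x + 1 - y) * rfact (int n + 1 - int k)"
        using rfact_minus_one[of "int n + 1 - int k"] by (simp add: x_def y_def algebra_simps)
      then show ?thesis
        unfolding R1 by (simp only: mult.assoc)
    qed
    have F0: "dombB n k = U * ((x + 1 - y) * (x + 2 - y) * R)"
      unfolding dombB_fact R0 U_def ..
    have F1: "dombB (n + 1) k = 16 * (x + 2*y + 1) * U * ((x + 2 - y) * R)"
    proof -
      have e: "int (n + 1) - int k = int n + 1 - int k"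
        "fact (n + 1 + 2 * k) = (x + 2 * y + 1) * (fact (n + 2 * k) :: rat)" "(16::rat)^(n + 1) = 16 * 16^n"
        by (simp_all add: x_def y_def algebra_simps)
      show ?thesis
        unfolding dombB_fact U_def e R1 by simp
    qed
    have F2: "dombB (n + 2) k = 256 * (x + 2*y + 1) * (x + 2*y + 2) * U * R"
    proof -
      have e: "int (n + 2) - int k = int n + 2 - int k"
        "fact (n + 2 + 2 * k) = (x + 2 * y + 1) * (x + 2 * y + 2) * (fact (n + 2 * k) :: rat)"
        "(16::rat)^(n + 2) = 256 * 16^n"
        by (simp_all add: x_def y_def algebra_simps)
      show ?thesis
        unfolding dombB_fact U_def e R_def by simp
    qed
    have y: "y + 1 \<noteq> 0" unfolding y_def by (metis of_nat_Suc of_nat_neq_0 add.commute)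
    have gen: "z ^ 4 * ((2 * z) * w * v / z ^ 5) / 16 = w * v / 8" if "z \<noteq> 0" for z w v :: rat
      using that by (simp add: divide_simps power_numeral_reduce)
    have e: "fact (2 * Suc k) = (2*(y+1))*(2*y+1)*(fact (2*k)::rat)"
       "fact (n + 2 * Suc k) = (x+2*y+1)*(x+2*y+2)*(fact (n+2*k)::rat)"
       "fact (Suc k) = (y+1)*(fact k::rat)" "(16::rat)^Suc k = 16 * 16^k" "(-1::rat)^Suc k = - ((-1)^k)"
      by (simp_all add: x_def y_def algebra_simps)
    have "(y+1)^4 * ((-1)^Suc k * fact (2*Suc k) * fact (n+2*Suc k) / fact (Suc k) ^ 5 * 16^n / 16^Suc k) =
       (y+1)^4 * ((2*(y+1))*(2*y+1)*((x+2*y+1)*(x+2*y+2)) / (y+1)^5) / 16 * (-U)"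
      unfolding U_def e by (simp add: power_mult_distrib mult_ac)
    also have "(y+1)^4 * ((2*(y+1))*(2*y+1)*((x+2*y+1)*(x+2*y+2)) / (y+1)^5) / 16 = (2*y+1)*((x+2*y+1)*(x+2*y+2))/8"
      by (rule gen[OF y])
    finally have U1: "(y+1)^4 * ((-1)^Suc k * fact (2*Suc k) * fact (n+2*Suc k) / fact (Suc k) ^ 5 * 16^n / 16^Suc k) =
       (2*y+1)*((x+2*y+1)*(x+2*y+2))/8 * (-U)" .
    have "int n + 2 - int (Suc k) = int n + 1 - int k" by simp
    then have "G (Suc k) = - (2304 * x + 3840) * ((y+1)^4 * ((-1)^Suc k * fact (2*Suc k) * fact (n+2*Suc k) / fact (Suc k) ^ 5 * 16^n / 16^Suc k))
       * rfact (int n + 1 - int k)"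
      unfolding G_def x_def y_def by (simp add: algebra_simps)
    then have G1: "G (Suc k) = - (2304 * x + 3840) * ((2*y+1)*((x+2*y+1)*(x+2*y+2))/8 * (-U)) * ((x + 2 - y) * R)"
      unfolding U1 R1 .
    have G0: "G k = - (2304 * x + 3840) * y^4 * U * R"
      unfolding G_def U_def R_def x_def y_def by simp
    show ?thesis
      unfolding F0 F1 F2 G0 G1 x_def[symmetric]
      by (simp add: field_simps power2_eq_square power3_eq_cube power_numeral_reduce)
  qed
  have "G 0 = 0" by (simp add: G_def)
  moreover have "G (n + 3) = 0" by (simp add: G_def rfact_def)
  ultimately show "(of_nat n + 2) ^ 3 * (\<Sum>k=0..n+2. dombB (n+2) k)
     - 2 * (2 * of_nat n + 3) * (5 * (of_nat n + 1)\<^sup>2 + 5 * (of_nat n + 1) + 2) * (\<Sum>k=0..n+1. dombB (n+1) k)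
     + 64 * (of_nat n + 1) ^ 3 * (\<Sum>k=0..n. dombB n k) = 0"
    using creative_telescoping[of _ "dombB (n+2)" _ "dombB (n+1)" _ "dombB n" G "n+3", OF cert]
    by (simp add: sum_dombB)
qed

lemma domb_eq_dombA: "of_nat (domb n) = (\<Sum>k=0..n. dombA n k)"
  by (rule domb_recurrence_unique[OF domb_recurrence_domb domb_recurrence_dombA])
    (simp_all add: domb_def dombA_def numeral_3_eq_3)

lemma domb_eq_dombB: "of_nat (domb n) = (\<Sum>k=0..n. dombB n k)"
  by (rule domb_recurrence_unique[OF domb_recurrence_domb domb_recurrence_dombB])
    (simp_all add: domb_def dombB_def numeral_3_eq_3)

section \<open>Congruences between p-integral rationals\<close>

locale prime_localization =
  fixes p :: nat
  assumes prime_p: "prime p"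
begin

abbreviation zp :: "rat set" where "zp \<equiv> p_integral p"

definition zunit :: "rat \<Rightarrow> bool" where
  "zunit x \<longleftrightarrow> x \<noteq> 0 \<and> x \<in> zp \<and> inverse x \<in> zp"

text \<open>Only the difference is constrained, so that reflexivity, sums and transitivity come
  without side conditions; \<open>cg_zp\<close> carries membership in \<open>zp\<close> from one
  side to the other.\<close>

definition cg :: "nat \<Rightarrow> rat \<Rightarrow> rat \<Rightarrow> bool" where
  "cg k a b \<longleftrightarrow> (\<exists>c\<in>zp. a - b = of_nat p ^ k * c)"

lemma prime_int_p: "prime (int p)"
  using prime_p by simp

text \<open>Admits fractions that are not in lowest terms, so the closure properties can be read off
  from the obvious common denominators.\<close>

lemma zp_iff: "r \<in> zp \<longleftrightarrow> (\<exists>a b. \<not> int p dvd b \<and> r = of_int a / of_int b)"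
proof
  assume r: "r \<in> zp"
  obtain a b where ab: "quotient_of r = (a, b)" by (cases "quotient_of r")
  then have "r = of_int a / of_int b" by (rule quotient_of_div)
  then show "\<exists>a b. \<not> int p dvd b \<and> r = of_int a / of_int b"
    using r ab unfolding p_integral_def by force
next
  assume "\<exists>a b. \<not> int p dvd b \<and> r = of_int a / of_int b"
  then obtain a b where b: "\<not> int p dvd b" and r: "r = of_int a / of_int b" by blast
  obtain c d where cd: "quotient_of r = (c, d)" by (cases "quotient_of r")
  have d: "d > 0" "coprime c d" "r = of_int c / of_int d"
    using quotient_of_denom_pos[OF cd] quotient_of_coprime[OF cd] quotient_of_div[OF cd] by auto
  have "b \<noteq> 0" using b by auto
  then have "of_int (a * d) = (of_int (c * b) :: rat)"
    using r d by (simp add: field_simps)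
  then have e: "a * d = c * b" by (simp only: of_int_eq_iff)
  have "\<not> int p dvd d"
  proof
    assume "int p dvd d"
    then have "int p dvd c * b" using e by (metis dvd_mult)
    then have "int p dvd c" using b prime_int_p by (simp add: prime_dvd_mult_iff)
    then show False using \<open>int p dvd d\<close> d(2) prime_int_p
      by (metis coprime_common_divisor not_prime_unit)
  qed
  then show "r \<in> zp" by (simp add: p_integral_def cd)
qed

lemma zp_of_int [simp, intro]: "of_int a \<in> zp"
proof -
  have "\<not> int p dvd 1" using prime_int_p not_prime_unit by blast
  then show ?thesis unfolding zp_iff by (intro exI[of _ a] exI[of _ 1]) simp
qed

lemma zp_of_nat [simp, intro]: "of_nat a \<in> zp"
  using zp_of_int[of "int a"] by simp

lemma zp_numeral [simp, intro]: "numeral a \<in> zp"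
  using zp_of_int[of "numeral a"] by simp

lemma zp_0 [simp, intro]: "0 \<in> zp" and zp_1 [simp, intro]: "1 \<in> zp"
  using zp_of_int[of 0] zp_of_int[of 1] by simp_all

lemma zp_add [simp, intro]: "x \<in> zp \<Longrightarrow> y \<in> zp \<Longrightarrow> x + y \<in> zp"
proof -
  assume "x \<in> zp" "y \<in> zp"
  then obtain a b c d where x: "\<not> int p dvd b" "x = of_int a / of_int b"
    and y: "\<not> int p dvd d" "y = of_int c / of_int d" unfolding zp_iff by blast
  have "b \<noteq> 0" "d \<noteq> 0" using x y by auto
  then have "x + y = of_int (a * d + c * b) / of_int (b * d)"
    using x y by (simp add: field_simps)
  moreover have "\<not> int p dvd b * d" using x y prime_int_p by (simp add: prime_dvd_mult_iff)
  ultimately show ?thesis unfolding zp_iff by blast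
qed

lemma zp_mult [simp, intro]: "x \<in> zp \<Longrightarrow> y \<in> zp \<Longrightarrow> x * y \<in> zp"
proof -
  assume "x \<in> zp" "y \<in> zp"
  then obtain a b c d where x: "\<not> int p dvd b" "x = of_int a / of_int b"
    and y: "\<not> int p dvd d" "y = of_int c / of_int d" unfolding zp_iff by blast
  have "x * y = of_int (a * c) / of_int (b * d)"
    using x y by simp
  moreover have "\<not> int p dvd b * d" using x y prime_int_p by (simp add: prime_dvd_mult_iff)
  ultimately show ?thesis unfolding zp_iff by blast
qed

lemma zp_minus [simp, intro]: "x \<in> zp \<Longrightarrow> - x \<in> zp"
  using zp_mult[OF zp_of_int[of "-1"]] by simp

lemma zp_diff [simp, intro]: "x \<in> zp \<Longrightarrow> y \<in> zp \<Longrightarrow> x - y \<in> zp"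
  using zp_add[of x "- y"] by simp

lemma zp_power [simp, intro]: "x \<in> zp \<Longrightarrow> x ^ n \<in> zp"
  by (induction n) auto

lemma zp_sum [simp, intro]: "(\<And>i. i \<in> I \<Longrightarrow> f i \<in> zp) \<Longrightarrow> sum f I \<in> zp"
  by (induction I rule: infinite_finite_induct) auto

lemma zp_prod [simp, intro]: "(\<And>i. i \<in> I \<Longrightarrow> f i \<in> zp) \<Longrightarrow> prod f I \<in> zp"
  by (induction I rule: infinite_finite_induct) auto

lemma zunit_of_int: "\<not> int p dvd b \<Longrightarrow> zunit (of_int b)"
proof -
  assume b: "\<not> int p dvd b"
  then have "b \<noteq> 0" by auto
  moreover have "inverse (of_int b) \<in> zp"
    unfolding zp_iff using b by (intro exI[of _ 1] exI[of _ b]) (simp add: field_simps)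
  ultimately show ?thesis unfolding zunit_def by auto
qed

lemma zunit_of_nat: "\<not> p dvd b \<Longrightarrow> zunit (of_nat b)"
  using zunit_of_int[of "int b"] by simp

lemma zunit_less: "0 < b \<Longrightarrow> b < p \<Longrightarrow> zunit (of_nat b)"
  by (intro zunit_of_nat) (auto dest: dvd_imp_le)

lemma zunitD: "zunit x \<Longrightarrow> x \<in> zp" "zunit x \<Longrightarrow> inverse x \<in> zp" "zunit x \<Longrightarrow> x \<noteq> 0"
  by (auto simp: zunit_def)

lemma zunit_1: "zunit 1"
  by (simp add: zunit_def)

lemma zunit_mult: "zunit x \<Longrightarrow> zunit y \<Longrightarrow> zunit (x * y)"
  by (auto simp: zunit_def inverse_mult_distrib)

lemma zunit_inverse: "zunit x \<Longrightarrow> zunit (inverse x)"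
  by (auto simp: zunit_def)

lemma zunit_divide: "zunit x \<Longrightarrow> zunit y \<Longrightarrow> zunit (x / y)"
  by (simp add: divide_inverse zunit_mult zunit_inverse)

lemma zunit_minus: "zunit x \<Longrightarrow> zunit (- x)"
  by (auto simp: zunit_def)

lemma zunit_power: "zunit x \<Longrightarrow> zunit (x ^ n)"
  by (induction n) (auto simp: zunit_1 zunit_mult)

lemma zunit_prod: "(\<And>i. i \<in> I \<Longrightarrow> zunit (f i)) \<Longrightarrow> zunit (prod f I)"
  by (induction I rule: infinite_finite_induct) (auto simp: zunit_1 zunit_mult)

lemma zunit_fact: "n < p \<Longrightarrow> zunit (fact n)"
  using zunit_of_nat[of "fact n"] prime_dvd_fact_iff[OF prime_p, of n] by simp

lemma zp_divide: "x \<in> zp \<Longrightarrow> zunit y \<Longrightarrow> x / y \<in> zp"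
  by (simp add: divide_inverse zunitD)

lemma cg_refl [simp, intro]: "cg k a a"
  unfolding cg_def by (intro bexI[of _ 0]) auto

lemma cg_sym: "cg k a b \<Longrightarrow> cg k b a"
  unfolding cg_def by (metis minus_diff_eq mult_minus_right zp_minus)

lemma cg_trans [trans]: "cg k a b \<Longrightarrow> cg k b c \<Longrightarrow> cg k a c"
proof -
  assume "cg k a b" "cg k b c"
  then obtain x y where "x \<in> zp" "y \<in> zp" "a - b = of_nat p ^ k * x" "b - c = of_nat p ^ k * y"
    unfolding cg_def by blast
  then show ?thesis
    unfolding cg_def by (intro bexI[of _ "x + y"]) (auto simp: algebra_simps)
qed

lemma cg_add: "cg k a b \<Longrightarrow> cg k c d \<Longrightarrow> cg k (a + c) (b + d)"
proof -
  assume "cg k a b" "cg k c d"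
  then obtain x y where "x \<in> zp" "y \<in> zp" "a - b = of_nat p ^ k * x" "c - d = of_nat p ^ k * y"
    unfolding cg_def by blast
  then show ?thesis
    unfolding cg_def by (intro bexI[of _ "x + y"]) (auto simp: algebra_simps)
qed

lemma cg_minus: "cg k a b \<Longrightarrow> cg k (- a) (- b)"
proof -
  assume "cg k a b"
  then obtain x where "x \<in> zp" "a - b = of_nat p ^ k * x"
    unfolding cg_def by blast
  then show ?thesis
    unfolding cg_def by (intro bexI[of _ "- x"]) (auto simp: algebra_simps)
qed

lemma cg_diff: "cg k a b \<Longrightarrow> cg k c d \<Longrightarrow> cg k (a - c) (b - d)"
  using cg_add[OF _ cg_minus, of k a b c d] by simp

lemma cg_mult_left: "cg k a b \<Longrightarrow> c \<in> zp \<Longrightarrow> cg k (c * a) (c * b)"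
proof -
  assume "cg k a b" and c: "c \<in> zp"
  then obtain x where "x \<in> zp" "a - b = of_nat p ^ k * x"
    unfolding cg_def by blast
  then show ?thesis
    using c unfolding cg_def right_diff_distrib[symmetric]
    by (intro bexI[of _ "c * x"]) (auto simp: mult_ac)
qed

lemma cg_mult_right: "cg k a b \<Longrightarrow> c \<in> zp \<Longrightarrow> cg k (a * c) (b * c)"
  using cg_mult_left by (simp add: mult.commute)

lemma cg_mult: "cg k a b \<Longrightarrow> cg k c d \<Longrightarrow> a \<in> zp \<Longrightarrow> d \<in> zp \<Longrightarrow> cg k (a * c) (b * d)"
  by (rule cg_trans[OF cg_mult_left cg_mult_right])

lemma cg_zp: "cg k a b \<Longrightarrow> b \<in> zp \<Longrightarrow> a \<in> zp"
proof -
  assume "cg k a b" and b: "b \<in> zp"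
  then obtain x where "x \<in> zp" "a - b = of_nat p ^ k * x"
    unfolding cg_def by blast
  then have "a = b + of_nat p ^ k * x" by simp
  then show ?thesis using b \<open>x \<in> zp\<close> by auto
qed

lemma cg_power: "cg k a b \<Longrightarrow> b \<in> zp \<Longrightarrow> cg k (a ^ n) (b ^ n)"
  by (induction n) (auto intro!: cg_mult intro: cg_zp)

lemma cg_sum: "(\<And>i. i \<in> I \<Longrightarrow> cg k (f i) (g i)) \<Longrightarrow> cg k (sum f I) (sum g I)"
  by (induction I rule: infinite_finite_induct) (auto intro: cg_add)

lemma cg_prod:
  "(\<And>i. i \<in> I \<Longrightarrow> cg k (f i) (g i)) \<Longrightarrow> (\<And>i. i \<in> I \<Longrightarrow> g i \<in> zp) \<Longrightarrow> cg k (prod f I) (prod g I)"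
  by (induction I rule: infinite_finite_induct) (auto intro!: cg_mult intro: cg_zp)

lemma cg_of_int: "[a = b] (mod int p ^ k) \<Longrightarrow> cg k (of_int a) (of_int b)"
proof -
  assume "[a = b] (mod int p ^ k)"
  then obtain c where "a - b = int p ^ k * c"
    by (auto simp: cong_iff_dvd_diff dvd_def)
  then have "of_int a - of_int b = of_nat p ^ k * (of_int c :: rat)"
    by (metis of_int_diff of_int_mult of_int_of_nat_eq of_int_power)
  then show ?thesis unfolding cg_def by blast
qed

text \<open>This gain of one power of p is why harmonic numbers and quotients C(p,i)/p are only ever
  computed modulo p.\<close>

lemma cg_p_mult: "cg 1 a b \<Longrightarrow> cg 2 (of_nat p * a) (of_nat p * b)"
  unfolding cg_def by (auto simp: right_diff_distrib[symmetric] power2_eq_square)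

lemma cg_p_0: "x \<in> zp \<Longrightarrow> cg 1 (of_nat p * x) 0"
  unfolding cg_def by auto

lemma cg_p2_0: "x \<in> zp \<Longrightarrow> cg 2 (of_nat p * of_nat p * x) 0"
  unfolding cg_def by (auto simp: power2_eq_square)

lemma cg_2_1: "cg 2 a b \<Longrightarrow> cg 1 a b"
  unfolding cg_def by (auto simp: power2_eq_square mult.assoc)

lemma cg_cancel: "zunit u \<Longrightarrow> cg k (u * a) (u * b) \<Longrightarrow> cg k a b"
  using cg_mult_left[of k "u * a" "u * b" "inverse u"] by (simp add: zunit_def mult.assoc[symmetric])

lemma cg_divide: "cg k a b \<Longrightarrow> zunit u \<Longrightarrow> cg k (a / u) (b / u)"
  by (simp add: divide_inverse cg_mult_right zunitD)

lemma cg_inverse: "cg k a b \<Longrightarrow> zunit a \<Longrightarrow> zunit b \<Longrightarrow> cg k (inverse a) (inverse b)"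
proof -
  assume ab: "cg k a b" "zunit a" "zunit b"
  have "a * b * inverse a = b" "a * b * inverse b = a"
    using ab by (simp_all add: zunit_def)
  then show ?thesis
    using cg_cancel[OF zunit_mult[OF ab(2,3)], of k "inverse a" "inverse b"] cg_sym[OF ab(1)]
    by (simp only:)
qed

text \<open>First-order expansion by the logarithmic derivative: every product of two perturbations
  carries p^2. The harmonic numbers in the evaluation of \<open>reduced_sum\<close> arise from
  here.\<close>

lemma cg_prod_perturb:
  assumes "finite I" "\<And>i. i \<in> I \<Longrightarrow> zunit (c i)" "\<And>i. i \<in> I \<Longrightarrow> d i \<in> zp"
  shows "cg 2 (\<Prod>i\<in>I. c i + of_nat p * d i) ((\<Prod>i\<in>I. c i) * (1 + of_nat p * (\<Sum>i\<in>I. d i / c i)))"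
  using assms
proof (induction I rule: finite_induct)
  case (insert i I)
  define C where "C = (\<Prod>i\<in>I. c i)"
  define sg where "sg = (\<Sum>i\<in>I. d i / c i)"
  define q :: rat where "q = of_nat p"
  have zp: "c i \<in> zp" "d i \<in> zp" "C \<in> zp" "sg \<in> zp" "q \<in> zp" "d i / c i \<in> zp" "c i \<noteq> 0"
    unfolding C_def sg_def q_def using insert.prems by (auto simp: zunitD zp_divide)
  have "cg 2 (\<Prod>j\<in>insert i I. c j + q * d j) ((c i + q * d i) * (C * (1 + q * sg)))"
    using insert zp by (auto simp: C_def sg_def q_def intro!: cg_mult_left)
  moreover have "cg 2 ((c i + q * d i) * (C * (1 + q * sg)) - (c i * C) * (1 + q * (d i / c i + sg))) 0"
  proof -
    have "(c i + q * d i) * (C * (1 + q * sg)) - (c i * C) * (1 + q * (d i / c i + sg)) = q * q * (d i * C * sg)"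
      using zp by (simp add: field_simps)
    then show ?thesis using zp cg_p2_0[of "d i * C * sg"] by (simp add: q_def)
  qed
  then have "cg 2 ((c i + q * d i) * (C * (1 + q * sg))) ((c i * C) * (1 + q * (d i / c i + sg)))"
    by (simp add: cg_def)
  ultimately show ?case
    using insert.hyps by (auto simp: C_def sg_def q_def intro: cg_trans)
qed simp

end

section \<open>Binomial identities\<close>

text \<open>By Pascal's rule the sum for N + 1 at x is the sum for N at x minus the sum for N at x +
  1, which is why x is generalised in the induction.\<close>

lemma alternating_binomial_partial_fraction:
  fixes x :: rat
  assumes "\<And>i. i \<le> N \<Longrightarrow> x + of_nat i \<noteq> 0"
  shows "(\<Sum>w\<le>N. (-1)^w * of_nat (N choose w) / (x + of_nat w)) = fact N / (\<Prod>w\<le>N. x + of_nat w)"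
  using assms
proof (induction N arbitrary: x)
  case (Suc N)
  have nz: "x + of_nat i \<noteq> 0" if "i \<le> Suc N" for i using Suc.prems that .
  have nz': "x + 1 + of_nat i \<noteq> 0" if "i \<le> N" for i using Suc.prems[of "Suc i"] that by (simp add: add_ac)
  define P where "P = (\<Prod>w\<le>N. x + of_nat w)"
  define P' where "P' = (\<Prod>w\<le>N. x + 1 + of_nat w)"
  have "(\<Sum>w\<le>Suc N. (-1)^w * of_nat (Suc N choose w) / (x + of_nat w)) =
    1 / x + (\<Sum>w\<le>N. (-1)^Suc w * of_nat (Suc N choose Suc w) / (x + of_nat (Suc w)))"
    by (subst sum.atMost_Suc_shift) simp
  also have "\<dots> = (1 / x + (\<Sum>w\<le>N. (-1)^Suc w * of_nat (N choose Suc w) / (x + of_nat (Suc w))))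
      - (\<Sum>w\<le>N. (-1)^w * of_nat (N choose w) / (x + 1 + of_nat w))"
    by (simp add: sum_negf[symmetric] sum.distrib[symmetric] add_divide_distrib distrib_left sum_subtractf[symmetric] add_ac)
       (simp add: sum.distrib[symmetric] diff_divide_distrib add_divide_distrib algebra_simps)
  also have "1 / x + (\<Sum>w\<le>N. (-1)^Suc w * of_nat (N choose Suc w) / (x + of_nat (Suc w))) =
      (\<Sum>w\<le>Suc N. (-1)^w * of_nat (N choose w) / (x + of_nat w))"
    by (subst sum.atMost_Suc_shift) simp
  also have "\<dots> = (\<Sum>w\<le>N. (-1)^w * of_nat (N choose w) / (x + of_nat w))"
    by (simp add: binomial_eq_0)
  also have "\<dots> = fact N / P"
    unfolding P_def by (rule Suc.IH) (simp add: nz)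
  also have "(\<Sum>w\<le>N. (-1)^w * of_nat (N choose w) / (x + 1 + of_nat w)) = fact N / P'"
    unfolding P'_def by (rule Suc.IH) (simp add: nz')
  also have "P' = P * (x + of_nat (Suc N)) / x"
  proof -
    have "x * P' = (\<Prod>w\<le>Suc N. x + of_nat w)"
      unfolding P'_def by (subst prod.atMost_Suc_shift) (simp add: add_ac)
    then show ?thesis unfolding P_def using nz[of 0] by (simp add: field_simps)
  qed
  also have "fact N / P - fact N / (P * (x + of_nat (Suc N)) / x) = fact (Suc N) / (P * (x + of_nat (Suc N)))"
  proof -
    have "P \<noteq> 0" unfolding P_def using nz by (auto simp: prod_zero_iff)
    moreover have "x \<noteq> 0" "x + of_nat (Suc N) \<noteq> 0" using nz[of 0] nz[of "Suc N"] by auto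
    ultimately show ?thesis by (simp add: divide_simps del: of_nat_Suc) (simp add: algebra_simps)
  qed
  finally show ?case unfolding P_def by simp
qed simp

text \<open>Since (-1)^k C(m+k,k) = C(-(m+1),k), Vandermonde's convolution evaluates the sum as
  C(0,m+1).\<close>

lemma alternating_binomial_square_sum:
  "(\<Sum>k\<le>Suc m. (-1)^k * of_nat (Suc m choose k) * of_nat (m + k choose k)) = (0::rat)"
proof -
  have "(\<Sum>k\<le>Suc m. (-1)^k * of_nat (Suc m choose k) * of_nat (m + k choose k)) =
    (\<Sum>k\<le>Suc m. (- of_nat (Suc m) gchoose k) * (of_nat (Suc m) gchoose (Suc m - k)) :: rat)"
  proof (intro sum.cong refl)
    fix k assume k: "k \<in> {..Suc m}"
    have "(- of_nat (Suc m) gchoose k :: rat) = (-1)^k * (of_nat (m + k) gchoose k)"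
      using gbinomial_negated_upper[of "- of_nat (Suc m) :: rat" k] by (simp add: add_ac)
    moreover have "Suc m choose k = Suc m choose (Suc m - k)"
      using k by (intro binomial_symmetric) simp
    ultimately show "(-1)^k * of_nat (Suc m choose k) * of_nat (m + k choose k) =
      (- of_nat (Suc m) gchoose k) * (of_nat (Suc m) gchoose (Suc m - k) :: rat)"
      by (simp only: binomial_gbinomial[symmetric]) (simp add: binomial_gbinomial mult_ac)
  qed
  also have "\<dots> = ((- of_nat (Suc m) + of_nat (Suc m)) gchoose Suc m)"
    by (simp only: atMost_atLeast0 gbinomial_Vandermonde)
  also have "\<dots> = 0" by simp
  finally show ?thesis .
qed

text \<open>The left side is the Legendre polynomial P_m(1-2x) with x^k replaced by 1/(a+k), for a >
  0 the integral of x^(a-1) P_m(1-2x) over [0,1]. The induction uses (M+a) f(m+1) = (M-a) f(m) with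
  M = m + 1: in this combination the denominators a + k cancel summand by summand, and what remains
  is the vanishing sum above.\<close>

lemma legendre_partial_fraction:
  fixes a :: rat
  assumes "\<And>i. i \<le> m \<Longrightarrow> a + of_nat i \<noteq> 0"
  shows "(\<Sum>k\<le>m. (-1)^k * of_nat (m choose k) * of_nat (m + k choose k) / (a + of_nat k)) =
    (\<Prod>i=1..m. of_nat i - a) / (\<Prod>i\<le>m. a + of_nat i)"
  using assms
proof (induction m)
  case (Suc m)
  define f where "f m = (\<Sum>k\<le>m. (-1)^k * of_nat (m choose k) * of_nat (m + k choose k) / (a + of_nat k))" for m
  define M :: rat where "M = of_nat (Suc m)"
  have M: "M > 0" by (simp add: M_def)
  have st: "(M + a) * ((-1)^k * of_nat (Suc m choose k) * of_nat (Suc m + k choose k) / (a + of_nat k))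
      - (M - a) * ((-1)^k * of_nat (m choose k) * of_nat (m + k choose k) / (a + of_nat k))
      = 2 * ((-1)^k * of_nat (Suc m choose k) * of_nat (m + k choose k))" if k: "k \<le> Suc m" for k
  proof -
    define y :: rat where "y = of_nat k"
    have "(Suc m - k) * (Suc m choose k) = Suc m * (m choose k)"
      using binomial_absorb_comp[of "Suc m" k] by simp
    then have "of_nat (Suc m - k) * of_nat (Suc m choose k) = M * (of_nat (m choose k) :: rat)"
      unfolding M_def of_nat_mult[symmetric] by simp
    then have 1: "of_nat (m choose k) = (M - y) * of_nat (Suc m choose k) / M"
      using k M by (simp add: of_nat_diff M_def y_def field_simps del: of_nat_Suc)
    have "Suc m * (Suc m + k choose k) = (Suc m + k) * (m + k choose k)"
      using binomial_absorb_comp[of "Suc m + k" k] by simp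
    then have "M * of_nat (Suc m + k choose k) = of_nat (Suc m + k) * (of_nat (m + k choose k) :: rat)"
      unfolding M_def of_nat_mult[symmetric] by simp
    also have "of_nat (Suc m + k) = M + y"
      by (simp add: M_def y_def)
    finally have 2: "of_nat (Suc m + k choose k) = (M + y) * of_nat (m + k choose k) / M"
      using M by (simp add: eq_divide_eq mult.commute)
    have ay: "a + y \<noteq> 0" using Suc.prems k by (simp add: y_def)
    have "(M + a) * (s * b * ((M + y) * c / M) / (a + y)) - (M - a) * (s * ((M - y) * b / M) * c / (a + y)) = 2 * (s * b * c)"
      for s b c :: rat
      using M ay by (simp add: divide_simps) (simp add: algebra_simps)
    then show ?thesis unfolding 1 2 y_def[symmetric] .
  qed
  have "f m = (\<Sum>k\<le>Suc m. (-1)^k * of_nat (m choose k) * of_nat (m + k choose k) / (a + of_nat k))"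
    by (simp add: f_def binomial_eq_0)
  then have "(M + a) * f (Suc m) - (M - a) * f m =
      (\<Sum>k\<le>Suc m. (M + a) * ((-1)^k * of_nat (Suc m choose k) * of_nat (Suc m + k choose k) / (a + of_nat k))
      - (M - a) * ((-1)^k * of_nat (m choose k) * of_nat (m + k choose k) / (a + of_nat k)))"
    by (simp only: f_def[of "Suc m"] sum_distrib_left sum_subtractf)
  also have "\<dots> = 2 * (\<Sum>k\<le>Suc m. (-1)^k * of_nat (Suc m choose k) * of_nat (m + k choose k))"
    unfolding sum_distrib_left by (intro sum.cong refl st) simp
  also have "\<dots> = 0"
    using alternating_binomial_square_sum by simp
  finally have "(M + a) * f (Suc m) = (M - a) * f m" by simp
  moreover have "M + a \<noteq> 0" using Suc.prems[of "Suc m"] by (simp add: M_def add.commute)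
  ultimately have "f (Suc m) = (M - a) * f m / (M + a)" by (simp add: field_simps)
  also have "f m = (\<Prod>i=1..m. of_nat i - a) / (\<Prod>i\<le>m. a + of_nat i)"
    unfolding f_def using Suc by simp
  finally show ?case
    unfolding f_def[symmetric] by (simp add: M_def mult_ac add_ac)
qed simp

text \<open>Both sides are the coefficient of x^n in (1+x)^N log(1+x), that is, the derivative of
  C(N,n) with respect to N. The proof uses Pascal's rule on both sides.\<close>

lemma alternating_binomial_harmonic:
  assumes "n \<le> N"
  shows "(\<Sum>e=1..n. (-1)^(e+1) * of_nat (N choose (n - e)) / of_nat e) =
    of_nat (N choose n) * ((\<Sum>i=1..N. 1 / of_nat i) - (\<Sum>i=1..N-n. 1 / of_nat i :: rat))"
  using assms
proof (induction N arbitrary: n)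
  case (Suc N)
  show ?case
  proof (cases n)
    case (Suc j)
    define H where "H k = (\<Sum>i=1..k. 1 / of_nat i :: rat)" for k :: nat
    define t where "t N n = (\<Sum>e=1..n. (-1)^(e+1) * of_nat (N choose (n - e)) / of_nat e :: rat)" for N n :: nat
    have H_Suc: "H (Suc k) = H k + 1 / of_nat (Suc k)" for k
      by (simp add: H_def)
    have "t (Suc N) (Suc j) = (\<Sum>e=1..j. (-1)^(e+1) * of_nat (Suc N choose (Suc j - e)) / of_nat e) + (-1)^j / of_nat (Suc j)"
      by (simp add: t_def)
    also have "(\<Sum>e=1..j. (-1)^(e+1) * of_nat (Suc N choose (Suc j - e)) / of_nat e) =
      (\<Sum>e=1..j. (-1)^(e+1) * of_nat (N choose (Suc j - e)) / of_nat e) +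
      (\<Sum>e=1..j. (-1)^(e+1) * of_nat (N choose (j - e)) / (of_nat e :: rat))"
      unfolding sum.distrib[symmetric]
      by (intro sum.cong) (auto simp: Suc_diff_le add_divide_distrib distrib_left diff_divide_distrib)
    finally have tS: "t (Suc N) (Suc j) = t N (Suc j) + t N j"
      by (simp add: t_def)
    have jN: "j \<le> N" using Suc.prems Suc by simp
    then have tj: "t N j = of_nat (N choose j) * (H N - H (N - j))"
      unfolding t_def H_def by (rule Suc.IH)
    show ?thesis
    \<comment> \<open>For n = N + 1 Pascal's rule refers to \<open>t N (Suc N)\<close>, outside the
      range of the induction hypothesis; the partial fraction at x = 1 supplies its value
      1/(N+1).\<close>
    proof (cases "j = N")
      case True
      have "t N (Suc N) = (\<Sum>e=1..Suc N. (-1)^(e+1) * of_nat (N choose (Suc N - e)) / of_nat e)"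
        by (simp add: t_def)
      also have "\<dots> = (\<Sum>w\<le>N. (-1)^w * of_nat (N choose w) / (1 + of_nat w))"
      proof -
        have "N choose (N - w) = N choose w" if "w \<le> N" for w
          using binomial_symmetric[OF that] by simp
        then show ?thesis
          unfolding One_nat_def sum.atLeast1_atMost_eq lessThan_Suc_atMost
          by (intro sum.cong) (auto simp: add_ac)
      qed
      also have "\<dots> = fact N / (\<Prod>w\<le>N. 1 + of_nat w)"
        by (rule alternating_binomial_partial_fraction) (metis of_nat_Suc of_nat_neq_0)
      also have "(\<Prod>w\<le>N. 1 + of_nat w :: rat) = fact (Suc N)"
        by (induction N) (simp_all add: algebra_simps)
      also have "fact N / fact (Suc N) = 1 / (of_nat (Suc N) :: rat)"
        by simp
      finally have "t (Suc N) (Suc j) = H (Suc N)"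
        using tS tj True by (simp add: H_Suc H_def)
      then show ?thesis
        unfolding Suc t_def[symmetric] H_def[symmetric] using True by (simp add: H_def)
    next
      case False
      then obtain i where N: "N = j + Suc i" using jN by (metis add_Suc_right le_neq_implies_less less_iff_Suc_add)
      then have ts: "t N (Suc j) = of_nat (N choose Suc j) * (H N - H (N - Suc j))"
        unfolding t_def H_def by (intro Suc.IH) simp
      have d: "N - j = Suc i" "N - Suc j = i" "Suc N - Suc j = Suc i" using N by auto
      have "Suc i * (Suc N choose Suc j) = Suc N * (N choose Suc j)"
        using binomial_absorb_comp[of "Suc N" "Suc j"] d by (simp del: binomial_Suc_Suc)
      then have "of_nat (Suc i) * of_nat (Suc N choose Suc j) = of_nat (Suc N) * (of_nat (N choose Suc j) :: rat)"
        by (simp only: of_nat_mult[symmetric])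
      then have c: "of_nat (N choose Suc j) / of_nat (Suc i) = of_nat (Suc N choose Suc j) / (of_nat (Suc N) :: rat)"
        by (simp add: divide_simps del: of_nat_Suc binomial_Suc_Suc) (simp only: mult.commute)
      have ch: "of_nat (Suc N choose Suc j) = of_nat (N choose j) + (of_nat (N choose Suc j) :: rat)" by simp
      have "t (Suc N) (Suc j) = of_nat (N choose Suc j) * (H N - (H (Suc i) - 1 / of_nat (Suc i))) + of_nat (N choose j) * (H N - H (Suc i))"
        unfolding tS ts tj d H_Suc by simp
      also have "\<dots> = (of_nat (N choose j) + of_nat (N choose Suc j)) * (H N - H (Suc i)) + of_nat (N choose Suc j) / of_nat (Suc i)"
        by (simp only: algebra_simps) (simp add: algebra_simps)
      also have "\<dots> = of_nat (Suc N choose Suc j) * (H (Suc N) - H (Suc i))"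
        unfolding c ch[symmetric] H_Suc by (simp add: algebra_simps del: of_nat_Suc binomial_Suc_Suc)
      finally show ?thesis
        unfolding Suc t_def[symmetric] H_def[symmetric] d .
    qed
  qed simp
qed simp

section \<open>Reduction of both sums to a Legendre-type sum\<close>

text \<open>Hockey stick with a shifted start: j \<le> r makes the missing terms below j
  zero.\<close>

lemma sum_binomial_upper:
  "j \<le> r \<Longrightarrow> (\<Sum>n<N. n + j choose r) = N + j choose Suc r"
  by (induction N) (auto simp: binomial_eq_0)

lemma prime_dvd_central_binomial:
  assumes "prime p" "k < p" "p \<le> 2 * k"
  shows "p dvd (2 * k choose k)"
proof -
  have "fact k * fact k * (2 * k choose k) = fact (2 * k)"
    using binomial_fact_lemma[of k "2 * k"] by simp
  moreover have "p dvd fact (2 * k)" "\<not> p dvd fact k"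
    using assms by (auto simp: prime_dvd_fact_iff)
  ultimately show ?thesis
    using assms(1) by (metis prime_dvd_mult_iff)
qed

lemma Suc_times_choose_Suc: "Suc k * (n choose Suc k) = (n - k) * (n choose k)"
proof (cases n)
  case (Suc j)
  then show ?thesis
    using binomial_absorb_comp[of n k] binomial_absorption[of k n] by simp
qed simp

text \<open>At n = p each factor is 1 + p/i, so that this product and the next one display their
  residues modulo powers of p.\<close>

lemma binomial_add_prod:
  "of_nat (n + k choose k) = (\<Prod>i=1..k. 1 + of_nat n / of_nat i :: rat)"
proof (induction k)
  case (Suc k)
  have "Suc k * (n + Suc k choose Suc k) = (n + Suc k) * (n + k choose k)"
    using Suc_times_binomial[of k "n + k"] by simp
  then have "of_nat (Suc k) * of_nat (n + Suc k choose Suc k) = of_nat (n + Suc k) * (of_nat (n + k choose k) :: rat)"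
    by (simp only: of_nat_mult[symmetric])
  then have "of_nat (n + Suc k choose Suc k) = of_nat (n + Suc k) / of_nat (Suc k) * (of_nat (n + k choose k) :: rat)"
    by (simp add: field_simps del: of_nat_Suc binomial_Suc_Suc)
  also have "of_nat (n + Suc k) / of_nat (Suc k) = (1 + of_nat n / of_nat (Suc k) :: rat)"
    by (simp add: add_divide_distrib del: of_nat_Suc) (simp add: divide_simps)
  finally show ?case
    using Suc by simp
qed simp

lemma binomial_pred_prod:
  assumes "k < n"
  shows "(-1) ^ k * of_nat (n - 1 choose k) = (\<Prod>i=1..k. 1 - of_nat n / of_nat i :: rat)"
  using assms
proof (induction k)
  case (Suc k)
  have "Suc k * (n - 1 choose Suc k) = (n - Suc k) * (n - 1 choose k)"
    using Suc_times_choose_Suc[of k "n - 1"] by simp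
  then have "of_nat (Suc k) * of_nat (n - 1 choose Suc k) = of_nat (n - Suc k) * (of_nat (n - 1 choose k) :: rat)"
    by (simp only: of_nat_mult[symmetric])
  then have "of_nat (n - 1 choose Suc k) = (of_nat n - of_nat (Suc k)) / of_nat (Suc k) * (of_nat (n - 1 choose k) :: rat)"
    using Suc.prems by (simp add: field_simps of_nat_diff del: of_nat_Suc)
  then have "(-1) ^ Suc k * of_nat (n - 1 choose Suc k) =
      - ((of_nat n - of_nat (Suc k)) / of_nat (Suc k)) * ((-1)^k * of_nat (n - 1 choose k) :: rat)"
    by (simp del: of_nat_Suc)
  also have "- ((of_nat n - of_nat (Suc k)) / of_nat (Suc k)) = (1 - of_nat n / of_nat (Suc k) :: rat)"
    by (simp add: diff_divide_distrib del: of_nat_Suc) 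
  finally show ?case
    using Suc by simp
qed simp

locale large_prime = prime_localization +
  assumes p_gt_3: "p > 3"
begin

definition m :: nat where "m = (p - 1) div 2"

lemma p_eq: "p = 2 * m + 1"
proof -
  have "odd p" using prime_p p_gt_3 prime_odd_nat by force
  then show ?thesis unfolding m_def by presburger
qed

text \<open>For k \<le> m the number 3k + 1 stays below 2p. Hence at most one denominator in
  \<open>reduced_sum\<close> fails to be a unit.\<close>

lemma dvd_3k_plus_1:
  assumes "k \<le> m" "p dvd 3 * k + 1"
  shows "3 * k + 1 = p"
proof -
  obtain c where c: "3 * k + 1 = p * c" using assms(2) by blast
  have "p * c < p * 2" using c assms(1) p_eq by linarith
  then have "c < 2" by simp
  moreover have "c \<noteq> 0" using c by (intro notI) simp
  ultimately show ?thesis using c by (cases c) auto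
qed

lemma zunit_2: "zunit 2" and zunit_3: "zunit 3" and zunit_4: "zunit 4" and zunit_16: "zunit 16"
proof -
  show 2: "zunit 2" using zunit_less[of 2] p_gt_3 by simp
  show "zunit 3" using zunit_less[of 3] p_gt_3 by simp
  show "zunit 4" using zunit_mult[OF 2 2] by simp
  then show "zunit 16" using zunit_mult[of 4 4] by simp
qed

lemma cg_divideI: "zunit b \<Longrightarrow> cg k a (b * c) \<Longrightarrow> cg k (a / b) c"
  by (rule cg_cancel[of b]) (simp_all add: zunit_def)

lemma cg_one_plus: "x \<in> zp \<Longrightarrow> cg 1 (1 + of_nat p * x) 1"
  using cg_add[OF cg_refl cg_p_0] by force

lemma binomial_p_add:
  assumes "k < p"
  shows "cg 1 (of_nat (p + k choose k)) 1"
proof -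
  have "cg 1 (\<Prod>i=1..k. 1 + of_nat p / of_nat i) (\<Prod>i=1..k. 1 :: rat)"
  proof (intro cg_prod)
    fix i assume "i \<in> {1..k}"
    then have "inverse (of_nat i) \<in> zp" using assms zunit_less[of i] zunitD by auto
    then show "cg 1 (1 + of_nat p / of_nat i) 1"
      using cg_one_plus by (simp add: divide_inverse)
  qed simp
  then show ?thesis by (simp add: binomial_add_prod)
qed

lemma binomial_p_pred:
  assumes "k < p"
  shows "cg 1 ((-1)^k * of_nat (p - 1 choose k)) 1"
proof -
  have "cg 1 (\<Prod>i=1..k. 1 - of_nat p / of_nat i) (\<Prod>i=1..k. 1 :: rat)"
  proof (intro cg_prod)
    fix i assume "i \<in> {1..k}"
    then have "- inverse (of_nat i) \<in> zp" using assms zunit_less[of i] zunitD by auto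
    then show "cg 1 (1 - of_nat p / of_nat i) 1"
      using cg_one_plus by (force simp add: divide_inverse)
  qed simp
  then show ?thesis unfolding binomial_pred_prod[OF assms] by simp
qed

text \<open>The linear terms cancel in (1 + p/i)(1 - p/i). This is the extra precision required at
  the index with 3k + 1 = p.\<close>

lemma binomial_p_add_pred:
  assumes "k < p"
  shows "cg 2 (of_nat (p + k choose k) * ((-1)^k * of_nat (p - 1 choose k))) 1"
proof -
  have "cg 2 (\<Prod>i=1..k. (1 + of_nat p / of_nat i) * (1 - of_nat p / of_nat i)) (\<Prod>i=1..k. 1 :: rat)"
  proof (intro cg_prod)
    fix i assume "i \<in> {1..k}"
    then have *: "inverse (of_nat i) \<in> zp" using assms zunit_less[of i] zunitD by auto
    have "cg 2 (1 + of_nat p * of_nat p * (- (inverse (of_nat i) * inverse (of_nat i)))) (1 + 0)"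
      using * by (intro cg_add cg_p2_0) auto
    then show "cg 2 ((1 + of_nat p / of_nat i) * (1 - of_nat p / of_nat i)) 1"
      by (simp add: divide_inverse algebra_simps)
  qed simp
  then show ?thesis
    unfolding binomial_pred_prod[OF assms] binomial_add_prod by (simp add: prod.distrib)
qed

definition legendre_term :: "nat \<Rightarrow> rat" where
  "legendre_term k = (-1)^k * of_nat (m choose k) * of_nat (m + k choose k)"

lemma legendre_term_zp [simp]: "legendre_term k \<in> zp"
  by (simp add: legendre_term_def)

text \<open>The ratio of consecutive terms is (2k+1)^2 / (4(k+1)^2) on the left. On the right it is
  -(m-k)(m+k+1) / (k+1)^2, which equals ((2k+1)^2 - p^2) / (4(k+1)^2) because 2m + 1 = p.\<close>

lemma central_binomial_square_cong:
  "k \<le> m \<Longrightarrow> cg 2 ((of_nat (2 * k choose k))\<^sup>2 / 16 ^ k) (legendre_term k)"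
proof (induction k)
  case 0
  then show ?case by (simp add: legendre_term_def)
next
  case (Suc k)
  define x y :: rat where "x = of_nat m" and "y = of_nat k"
  have u: "zunit (of_nat (Suc k))"
    using Suc.prems p_eq by (intro zunit_less) auto
  have Sk: "of_nat (Suc k) = y + 1" by (simp add: y_def)
  have y1: "y + 1 \<noteq> 0" using zunitD(3)[OF u] Sk by simp
  have "Suc k * (2 * Suc k choose Suc k) = 2 * (2 * k + 1) * (2 * k choose k)"
  proof -
    have "Suc k * (2 * Suc k choose Suc k) = (2 * k + 2) * (2 * k + 1 choose k)"
      using Suc_times_binomial[of k "2 * k + 1"] by simp
    moreover have "Suc k * (2 * k + 1 choose k) = (2 * k + 1) * (2 * k choose k)"
      using binomial_absorb_comp[of "2 * k + 1" k] by simp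
    ultimately have "Suc k * (Suc k * (2 * Suc k choose Suc k)) = Suc k * (2 * (2 * k + 1) * (2 * k choose k))"
      by (simp del: binomial_Suc_Suc mult_Suc mult_Suc_right) (simp add: algebra_simps)
    then show ?thesis by (simp only: mult_left_cancel[of "Suc k"])
  qed
  then have "of_nat (Suc k) * of_nat (2 * Suc k choose Suc k) = of_nat (2 * (2 * k + 1)) * (of_nat (2 * k choose k) :: rat)"
    by (simp only: of_nat_mult[symmetric])
  then have c1: "of_nat (2 * Suc k choose Suc k) = 2 * (2 * y + 1) * of_nat (2 * k choose k) / (y + 1)"
    unfolding Sk using y1 by (simp add: y_def field_simps del: binomial_Suc_Suc mult_Suc mult_Suc_right)
  have "Suc k * (m choose Suc k) = (m - k) * (m choose k)"
    by (rule Suc_times_choose_Suc)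
  then have "of_nat (Suc k) * of_nat (m choose Suc k) = of_nat (m - k) * (of_nat (m choose k) :: rat)"
    by (simp only: of_nat_mult[symmetric])
  then have c2: "of_nat (m choose Suc k) = (x - y) * of_nat (m choose k) / (y + 1)"
    unfolding Sk using y1 Suc.prems by (simp add: x_def y_def of_nat_diff field_simps)
  have "Suc k * (m + Suc k choose Suc k) = (m + Suc k) * (m + k choose k)"
    using Suc_times_binomial[of k "m + k"] by simp
  then have "of_nat (Suc k) * of_nat (m + Suc k choose Suc k) = of_nat (m + Suc k) * (of_nat (m + k choose k) :: rat)"
    by (simp only: of_nat_mult[symmetric])
  also have "of_nat (m + Suc k) = x + y + 1" by (simp add: x_def y_def)
  finally have c3: "of_nat (m + Suc k choose Suc k) = (x + y + 1) * of_nat (m + k choose k) / (y + 1)"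
    unfolding Sk using y1 by (simp add: eq_divide_eq mult.commute)
  have px: "of_nat p = 2 * x + 1"
    using arg_cong[OF p_eq, of "of_nat :: nat \<Rightarrow> rat"] unfolding x_def
    by (simp only: of_nat_add of_nat_mult of_nat_1 of_nat_numeral)
  define U where "U = inverse (4 * ((y + 1) * (y + 1)))"
  have U: "U \<in> zp"
    using u zunit_4 unfolding Sk U_def by (intro zunitD zunit_mult)
  have "(of_nat (2 * Suc k choose Suc k))\<^sup>2 / 16 ^ Suc k = (2*y+1)^2 * U * ((of_nat (2 * k choose k))\<^sup>2 / 16 ^ k)"
  proof -
    have "(2 * w * c / z)\<^sup>2 / (16 * s) = w\<^sup>2 * inverse (4 * (z * z)) * (c\<^sup>2 / s)" if "z \<noteq> 0" for w c z s :: rat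
      using that by (simp add: divide_simps power2_eq_square)
    from this[OF y1] show ?thesis
      unfolding c1 U_def power_Suc .
  qed
  also have "cg 2 \<dots> ((2*y+1)^2 * U * legendre_term k)"
    using Suc U by (intro cg_mult_left zp_mult zp_power) (auto simp: y_def)
  also have "cg 2 \<dots> ((2*y+1)^2 * U * legendre_term k - of_nat p * of_nat p * (U * legendre_term k))"
    using cg_diff[OF cg_refl cg_p2_0[of "U * legendre_term k"], THEN cg_sym] U by simp
  also have "(2*y+1)^2 * U * legendre_term k - of_nat p * of_nat p * (U * legendre_term k) = legendre_term (Suc k)"
  proof -
    have "(2*y+1)\<^sup>2 * inverse (4 * (z * z)) * (s * b * c) - (2*x+1) * (2*x+1) * (inverse (4 * (z * z)) * (s * b * c))
      = (-1) * s * ((x - y) * b / z) * ((x + y + 1) * c / z)" if "z \<noteq> 0" for z s b c :: rat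
      using that by (simp add: divide_simps) (simp add: algebra_simps power2_eq_square)
    from this[OF y1] show ?thesis
      unfolding legendre_term_def c2 c3 U_def px power_Suc .
  qed
  finally show ?case .
qed

text \<open>Every summand is a multiple of p except possibly one: at 3k + 1 = p the prefactor
  cancels the denominator.\<close>

definition reduced_sum :: rat where
  "reduced_sum = (\<Sum>k\<le>m. of_nat p * legendre_term k / of_nat (3 * k + 1))"

text \<open>\<open>W\<close> is the weight by which a Domb term differs from its Legendre
  counterpart. The prefactor p lets a congruence modulo p suffice, unless 3k + 1 = p consumes that
  prefactor.\<close>

lemma domb_term_cong:
  assumes k: "k \<le> m" and W: "W \<in> zp" "cg 1 W 1" "3 * k + 1 = p \<Longrightarrow> cg 2 W 1"
  shows "cg 2 ((of_nat (2 * k choose k))\<^sup>2 / 16 ^ k * (of_nat p * W / of_nat (3 * k + 1)))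
    (of_nat p * legendre_term k / of_nat (3 * k + 1))"
proof -
  define R :: rat where "R = (of_nat (2 * k choose k))\<^sup>2 / 16 ^ k"
  have R: "cg 2 R (legendre_term k)"
    unfolding R_def by (rule central_binomial_square_cong[OF k])
  then have Rz: "R \<in> zp" using cg_zp by simp
  show ?thesis
  proof (cases "3 * k + 1 = p")
    case True
    have "cg 2 (R * W) (legendre_term k * 1)"
      using R W(3)[OF True] Rz by (intro cg_mult) auto
    moreover have "of_nat (3 * k + 1) = (of_nat p :: rat)" "(of_nat p :: rat) \<noteq> 0"
      using True p_gt_3 by auto
    ultimately show ?thesis unfolding R_def[symmetric] by simp
  next
    case False
    have "\<not> p dvd 3 * k + 1"
      using dvd_3k_plus_1[OF k] False by blast
    then have u: "zunit (of_nat (3 * k + 1))" by (rule zunit_of_nat)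
    have "cg 1 (R * W / of_nat (3 * k + 1)) (legendre_term k * 1 / of_nat (3 * k + 1))"
      using cg_2_1[OF R] W(2) Rz u by (intro cg_divide cg_mult) auto
    from cg_p_mult[OF this] show ?thesis
      unfolding R_def[symmetric] by (simp add: mult_ac)
  qed
qed

lemma sum_domb_4:
  "(\<Sum>n=0..p-1. of_nat (domb n) / 4 ^ n) =
   (\<Sum>k<p. (of_nat (2 * k choose k))\<^sup>2 / 16 ^ k * of_nat ((3 * k choose k) * (p + k choose (3 * k + 1))) :: rat)"
proof -
  have "(\<Sum>n=0..p-1. of_nat (domb n) / 4 ^ n) = (\<Sum>n<p. \<Sum>k<p. dombA n k / 4 ^ n)"
    unfolding domb_eq_dombA sum_divide_distrib[symmetric]
    using p_gt_3 by (intro sum.cong) (auto simp: sum_dombA)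
  also have "\<dots> = (\<Sum>k<p. \<Sum>n<p. dombA n k / 4 ^ n)"
    by (rule sum.swap)
  also have "\<dots> = (\<Sum>k<p. (of_nat (2 * k choose k))\<^sup>2 / 16 ^ k * (of_nat (3 * k choose k) * of_nat (\<Sum>n<p. n + k choose (3 * k))))"
    unfolding of_nat_sum sum_distrib_left dombA_def
    by (intro sum.cong) auto
  finally show ?thesis by (simp add: sum_binomial_upper)
qed

lemma sum_domb_16:
  "(\<Sum>n=0..p-1. of_nat (domb n) / 16 ^ n) =
   (\<Sum>k<p. (of_nat (2 * k choose k))\<^sup>2 / 16 ^ k * ((-1) ^ k * of_nat ((3 * k choose k) * (p + 2 * k choose (3 * k + 1)))) :: rat)"
proof -
  have "(\<Sum>n=0..p-1. of_nat (domb n) / 16 ^ n) = (\<Sum>n<p. \<Sum>k<p. dombB n k / 16 ^ n)"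
    unfolding domb_eq_dombB sum_divide_distrib[symmetric]
    using p_gt_3 by (intro sum.cong) (auto simp: sum_dombB)
  also have "\<dots> = (\<Sum>k<p. \<Sum>n<p. dombB n k / 16 ^ n)"
    by (rule sum.swap)
  also have "\<dots> = (\<Sum>k<p. (of_nat (2 * k choose k))\<^sup>2 / 16 ^ k * ((-1) ^ k * (of_nat (3 * k choose k) * of_nat (\<Sum>n<p. n + 2 * k choose (3 * k)))))"
    unfolding of_nat_sum sum_distrib_left dombB_def
    by (intro sum.cong) auto
  finally show ?thesis by (simp add: sum_binomial_upper)
qed

lemma of_nat_fact_p: "fact p = of_nat p * (fact (p - 1) :: rat)"
  using fact_reduce[of p, where ?'a=rat] p_gt_3 by simp

lemma sum_domb_4_cong: "cg 2 (\<Sum>n=0..p-1. of_nat (domb n) / 4 ^ n) reduced_sum"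
proof -
  have "(\<Sum>n=0..p-1. of_nat (domb n) / 4 ^ n) =
   (\<Sum>k\<le>m. (of_nat (2 * k choose k))\<^sup>2 / 16 ^ k * of_nat ((3 * k choose k) * (p + k choose (3 * k + 1))) :: rat)"
    unfolding sum_domb_4 using p_eq
    \<comment> \<open>For k > m one has 3k + 1 > p + k, so the second binomial coefficient is
      zero.\<close>
    by (intro sum.mono_neutral_right) (auto simp: binomial_eq_0)
  also have "cg 2 \<dots> reduced_sum"
    unfolding reduced_sum_def
  proof (intro cg_sum)
    fix k assume "k \<in> {..m}"
    then have k: "k \<le> m" "2 * k < p" "k < p" using p_eq by auto
    \<comment> \<open>Cancelling factorials gives C(3k,k) C(p+k,3k+1) = p/(3k+1) times this
      product.\<close>
    define W :: rat where "W = of_nat (p + k choose k) * of_nat (p - 1 choose (2 * k))"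
    have e: "3 * k - k = 2 * k" "p + k - (3 * k + 1) = p - 1 - 2 * k" "p + k - k = p" "3 * k + 1 \<le> p + k" "2 * k \<le> p - 1"
      using k by auto
    have b: "of_nat (3 * k choose k) = (fact (3 * k) / (fact k * fact (2 * k)) :: rat)"
      "of_nat (p + k choose (3 * k + 1)) = (fact (p + k) / (of_nat (3 * k + 1) * fact (3 * k) * fact (p - 1 - 2 * k)) :: rat)"
      "of_nat (p + k choose (k)) = (fact (p + k) / (fact (k) * (of_nat p * fact (p - 1))) :: rat)"
      "of_nat (p - 1 choose (2 * k)) = (fact (p - 1) / (fact (2 * k) * fact (p - 1 - 2 * k)) :: rat)"
      using binomial_fact[of k "3 * k", where ?'a=rat, unfolded e(1)] binomial_fact[OF e(4), where ?'a=rat, unfolded e(2)]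
        binomial_fact[of "k" "p + k", where ?'a=rat, unfolded e(3) of_nat_fact_p] binomial_fact[OF e(5), where ?'a=rat]
        fact_Suc[of "3 * k", where ?'a=rat]
      by (simp_all del: of_nat_Suc fact_Suc)
    have nz: "of_nat p \<noteq> (0 :: rat)" "of_nat (3 * k + 1) \<noteq> (0 :: rat)"
      using p_gt_3 by (simp_all del: of_nat_Suc of_nat_add)
    have "of_nat ((3 * k choose k) * (p + k choose (3 * k + 1))) = of_nat p * W / of_nat (3 * k + 1)"
      unfolding W_def of_nat_mult b using nz by simp
    moreover have "cg 1 W (1 * 1)"
      unfolding W_def using binomial_p_add[OF k(3)] binomial_p_pred[OF k(2)] by (intro cg_mult) auto
    \<comment> \<open>In this case p - 1 = 3k, so C(p-1,2k) = C(p-1,k). Since p - 1 is even, so is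
      k, which removes the sign in \<open>binomial_p_add_pred\<close>.\<close>
    moreover have "cg 2 W 1" if "3 * k + 1 = p"
    proof -
      have "even (3 * k)" using that p_eq by presburger
      then have "even k" by simp
      moreover have "p - 1 choose (2 * k) = p - 1 choose k"
      proof -
        have "p - 1 - k = 2 * k" "k \<le> p - 1" using that by auto
        then show ?thesis using binomial_symmetric[of k "p - 1"] by simp
      qed
      ultimately show ?thesis
        using binomial_p_add_pred[OF k(3)] by (simp add: W_def)
    qed
    ultimately show "cg 2 ((of_nat (2 * k choose k))\<^sup>2 / 16 ^ k * of_nat ((3 * k choose k) * (p + k choose (3 * k + 1))))
      (of_nat p * legendre_term k / of_nat (3 * k + 1))"
      using domb_term_cong[OF k(1), of W] by (simp add: W_def)
  qed
  finally show ?thesis .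
qed

lemma sum_domb_16_cong: "cg 2 (\<Sum>n=0..p-1. of_nat (domb n) / 16 ^ n) reduced_sum"
proof -
  define f :: "nat \<Rightarrow> rat" where "f k = (of_nat (2 * k choose k))\<^sup>2 / 16 ^ k *
    ((-1) ^ k * of_nat ((3 * k choose k) * (p + 2 * k choose (3 * k + 1))))" for k
  \<comment> \<open>Unlike in the sum with 4^n, the last binomial coefficient does not vanish for m
    < k < p. Here p divides C(2k,k), and its square supplies p^2.\<close>
  have "cg 2 (\<Sum>k\<in>{m<..<p}. f k) (\<Sum>k\<in>{m<..<p}. 0)"
  proof (intro cg_sum)
    fix k assume "k \<in> {m<..<p}"
    then have "p dvd (2 * k choose k)"
      using p_eq by (intro prime_dvd_central_binomial prime_p) auto
    then obtain c where c: "2 * k choose k = p * c" by blast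
    have "of_nat c ^ 2 * ((-1) ^ k * of_nat ((3 * k choose k) * (p + 2 * k choose (3 * k + 1)))) / 16 ^ k \<in> zp"
      by (intro zp_divide zunit_power zunit_16) auto
    from cg_p2_0[OF this] show "cg 2 (f k) 0"
      unfolding f_def c by (simp add: power2_eq_square mult_ac)
  qed
  moreover have "cg 2 (\<Sum>k\<le>m. f k) reduced_sum"
    unfolding reduced_sum_def f_def
  proof (intro cg_sum)
    fix k assume "k \<in> {..m}"
    then have k: "k \<le> m" "2 * k < p" "k < p" using p_eq by auto
    \<comment> \<open>The roles of k and 2k are exchanged: C(3k,k) C(p+2k,3k+1) is p/(3k+1) times
      C(p+2k,2k) C(p-1,k), and the sign (-1)^k of the expansion is the one wanted for
      C(p-1,k).\<close>
    define W :: rat where "W = of_nat (p + 2 * k choose (2 * k)) * ((-1) ^ k * of_nat (p - 1 choose k))"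
    have e: "3 * k - k = 2 * k" "p + 2 * k - (3 * k + 1) = p - 1 - k" "p + 2 * k - 2 * k = p" "3 * k + 1 \<le> p + 2 * k" "k \<le> p - 1"
      using k by auto
    have b: "of_nat (3 * k choose k) = (fact (3 * k) / (fact k * fact (2 * k)) :: rat)"
      "of_nat (p + 2 * k choose (3 * k + 1)) = (fact (p + 2 * k) / (of_nat (3 * k + 1) * fact (3 * k) * fact (p - 1 - k)) :: rat)"
      "of_nat (p + 2 * k choose (2 * k)) = (fact (p + 2 * k) / (fact (2 * k) * (of_nat p * fact (p - 1))) :: rat)"
      "of_nat (p - 1 choose (k)) = (fact (p - 1) / (fact (k) * fact (p - 1 - k)) :: rat)"
      using binomial_fact[of k "3 * k", where ?'a=rat, unfolded e(1)] binomial_fact[OF e(4), where ?'a=rat, unfolded e(2)]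
        binomial_fact[of "2 * k" "p + 2 * k", where ?'a=rat, unfolded e(3) of_nat_fact_p] binomial_fact[OF e(5), where ?'a=rat]
        fact_Suc[of "3 * k", where ?'a=rat]
      by (simp_all del: of_nat_Suc fact_Suc)
    have nz: "of_nat p \<noteq> (0 :: rat)" "of_nat (3 * k + 1) \<noteq> (0 :: rat)"
      using p_gt_3 by (simp_all del: of_nat_Suc of_nat_add)
    have "(-1) ^ k * of_nat ((3 * k choose k) * (p + 2 * k choose (3 * k + 1))) = of_nat p * W / of_nat (3 * k + 1)"
      unfolding W_def of_nat_mult b using nz by (simp add: mult_ac)
    moreover have "cg 1 W (1 * 1)"
      unfolding W_def using binomial_p_add[OF k(2)] binomial_p_pred[OF k(3)] by (intro cg_mult) auto
    moreover have "cg 2 W 1" if "3 * k + 1 = p"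
    proof -
      have "even (3 * k)" using that p_eq by presburger
      then have "even k" by simp
      moreover have "p - 1 choose (2 * k) = p - 1 choose k"
      proof -
        have "p - 1 - k = 2 * k" "k \<le> p - 1" using that by auto
        then show ?thesis using binomial_symmetric[of k "p - 1"] by simp
      qed
      ultimately show ?thesis
        using binomial_p_add_pred[OF k(2)] by (simp add: W_def)
    qed
    ultimately show "cg 2 ((of_nat (2 * k choose k))\<^sup>2 / 16 ^ k * ((-1) ^ k * of_nat ((3 * k choose k) * (p + 2 * k choose (3 * k + 1)))))
      (of_nat p * legendre_term k / of_nat (3 * k + 1))"
      using domb_term_cong[OF k(1), of W] by (simp add: W_def)
  qed
  moreover have "(\<Sum>n=0..p-1. of_nat (domb n) / 16 ^ n) = (\<Sum>k\<le>m. f k) + (\<Sum>k\<in>{m<..<p}. f k)"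
  proof -
    have "{..<p} = {..m} \<union> {m<..<p}" "{..m} \<inter> {m<..<p} = {}" using p_eq by auto
    then show ?thesis
      unfolding sum_domb_16 f_def[symmetric] by (simp add: sum.union_disjoint)
  qed
  ultimately show ?thesis
    using cg_add[of 2 "\<Sum>k\<le>m. f k" reduced_sum "\<Sum>k\<in>{m<..<p}. f k" 0] by simp
qed

lemma reduced_sum_eq: "reduced_sum = of_nat p / 3 * ((\<Prod>i=1..m. of_nat i - 1 / 3) / (\<Prod>i\<le>m. 1 / 3 + of_nat i))"
proof -
  have "1 / 3 + of_nat i \<noteq> (0 :: rat)" for i
    using of_nat_0_le_iff[of i, where ?'a=rat] by linarith
  note legendre_partial_fraction[OF this, of m, symmetric]
  moreover have "reduced_sum = of_nat p / 3 * (\<Sum>k\<le>m. (-1)^k * of_nat (m choose k) * of_nat (m + k choose k) / (1 / 3 + of_nat k))"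
    unfolding reduced_sum_def sum_distrib_left
  proof (intro sum.cong refl)
    fix k
    have "of_nat (3 * k + 1) = 3 * (1 / 3 + of_nat k :: rat)" by simp
    then show "of_nat p * legendre_term k / of_nat (3 * k + 1) =
      of_nat p / 3 * ((-1)^k * of_nat (m choose k) * of_nat (m + k choose k) / (1 / 3 + of_nat k))"
      unfolding legendre_term_def by (simp add: mult.assoc)
  qed
  ultimately show ?thesis by simp
qed

lemma reduced_sum_cong_0:
  assumes "[p = 2] (mod 3)"
  shows "cg 2 reduced_sum 0"
proof -
  have p3: "p mod 3 = 2" using assms by (simp add: cong_def)
  \<comment> \<open>The factor of the numerator at i = j is i - 1/3 = p/3. The denominators stay
    units, since 3i + 1 = p would force p to be 1 modulo 3.\<close>
  define j where "j = (p + 1) div 3"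
  have j: "3 * j = p + 1" unfolding j_def using p3 by presburger
  then have jm: "j \<in> {1..m}" using p_eq p_gt_3 by auto
  define N where "N = (\<Prod>i\<in>{1..m} - {j}. of_nat i - 1 / 3 :: rat)"
  define D where "D = (\<Prod>i\<le>m. 1 / 3 + of_nat i :: rat)"
  have "of_nat j = (of_nat p + 1) / (3 :: rat)"
    using j by (metis nonzero_mult_div_cancel_left of_nat_1 of_nat_add of_nat_mult of_nat_numeral zero_neq_numeral)
  then have "of_nat j - 1 / 3 = of_nat p / (3 :: rat)" by (simp add: field_simps)
  then have PN: "(\<Prod>i=1..m. of_nat i - 1 / 3) = of_nat p / 3 * N"
    unfolding N_def by (subst prod.remove[OF _ jm]) auto
  have "reduced_sum = of_nat p * of_nat p * (N / (3 * 3 * D))"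
    unfolding reduced_sum_eq D_def[symmetric] PN by simp
  moreover have "zunit D"
    unfolding D_def
  proof (intro zunit_prod)
    fix i assume "i \<in> {..m}"
    then have i: "i \<le> m" by simp
    have "\<not> p dvd 3 * i + 1"
    proof
      assume "p dvd 3 * i + 1"
      then have "3 * i + 1 = p" by (rule dvd_3k_plus_1[OF i])
      then show False using p3 by presburger
    qed
    then have "zunit (of_nat (3 * i + 1) / 3)" by (intro zunit_divide zunit_of_nat zunit_3)
    then show "zunit (1 / 3 + of_nat i)" by (simp add: add_divide_distrib)
  qed
  moreover have "N \<in> zp"
    unfolding N_def using zp_divide[OF zp_1 zunit_3] by auto
  ultimately show ?thesis
    using cg_p2_0[OF zp_divide[OF _ zunit_mult[OF zunit_mult[OF zunit_3 zunit_3]]], of N D] by simp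
qed

end

section \<open>Evaluation for primes congruent to 1 modulo 6\<close>

abbreviation harmonic :: "nat \<Rightarrow> rat" where
  "harmonic k \<equiv> (\<Sum>i=1..k. 1 / of_nat i)"

context large_prime
begin

abbreviation q :: rat where "q \<equiv> of_nat p"

lemma harmonic_zp: "k < p \<Longrightarrow> harmonic k \<in> zp"
  by (intro zp_sum zp_divide zunit_less) auto

lemma inverse_reflect:
  assumes "0 < i" "i < p"
  shows "cg 1 (1 / of_nat (p - i)) (- (1 / of_nat i))"
proof -
  have "cg 1 (- of_nat i + q * 1) (- of_nat i + 0)"
    by (intro cg_add cg_p_0) auto
  then have "cg 1 (of_nat (p - i)) (- of_nat i)"
    using assms by (simp add: of_nat_diff)
  then have "cg 1 (inverse (of_nat (p - i))) (inverse (- of_nat i))"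
    using assms by (intro cg_inverse zunit_minus zunit_less) auto
  then show ?thesis
    by (simp add: divide_inverse)
qed

lemma harmonic_pred_p: "cg 1 (harmonic (p - 1)) 0"
proof -
  have "harmonic (p - 1) = (\<Sum>i=1..p-1. 1 / of_nat (p - i))"
    by (subst sum.atLeastAtMost_rev) (use p_gt_3 in simp)
  also have "cg 1 \<dots> (\<Sum>i=1..p-1. - (1 / of_nat i))"
    by (intro cg_sum inverse_reflect) auto
  finally have "cg 1 (harmonic (p - 1)) (- harmonic (p - 1))"
    by (simp add: sum_negf)
  from cg_add[OF this cg_refl, of "harmonic (p - 1)"] have "cg 1 (2 * harmonic (p - 1)) (2 * 0)"
    by simp
  then show ?thesis
    by (rule cg_cancel[OF zunit_2])
qed

text \<open>Since 1/(p-i) is -1/i modulo p, taking the top k terms away from the full sum, which is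
  0, leaves the first k reciprocals.\<close>

lemma harmonic_reflect: "k < p \<Longrightarrow> cg 1 (harmonic (p - 1 - k)) (harmonic k)"
proof (induction k)
  case 0
  then show ?case using harmonic_pred_p by simp
next
  case (Suc k)
  define j where "j = p - 1 - Suc k"
  have j: "p - 1 - k = Suc j" "p - Suc k = Suc j" using Suc.prems by (auto simp: j_def)
  have "cg 1 (harmonic (Suc j) - 1 / of_nat (p - Suc k)) (harmonic k - (- (1 / of_nat (Suc k))))"
    using Suc j by (intro cg_diff inverse_reflect) auto
  then show ?case
    unfolding j j_def[symmetric] by simp
qed

lemma cg_one_plus_mult:
  assumes "a \<in> zp" "b \<in> zp"
  shows "cg 2 ((1 + q * a) * (1 + q * b)) (1 + q * (a + b))"
proof -
  have "cg 2 ((1 + q * (a + b)) + q * q * (a * b)) ((1 + q * (a + b)) + 0)"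
    using assms by (intro cg_add cg_p2_0) auto
  then show ?thesis by (simp add: algebra_simps)
qed

lemma binomial_p_pred_2:
  assumes "k < p"
  shows "cg 2 ((-1)^k * of_nat (p - 1 choose k)) (1 - q * harmonic k)"
proof -
  have "cg 2 (\<Prod>i=1..k. 1 + q * (- (1 / of_nat i))) ((\<Prod>i=1..k. 1) * (1 + q * (\<Sum>i=1..k. - (1 / of_nat i) / 1)))"
    using assms by (intro cg_prod_perturb zp_minus zp_divide zunit_1 zunit_less) auto
  then show ?thesis
    unfolding binomial_pred_prod[OF assms] by (simp add: sum_negf)
qed

lemma cg_mult_zp: "cg k a b \<Longrightarrow> cg k c d \<Longrightarrow> b \<in> zp \<Longrightarrow> d \<in> zp \<Longrightarrow> cg k (a * c) (b * d)"
  by (intro cg_mult cg_zp[of k a b])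

end

locale prime_1_mod_6 = large_prime +
  fixes r :: nat
  assumes p_6r: "p = 6 * r + 1"
begin

lemma r_pos: "r > 0"
  using p_6r p_gt_3 by auto

lemma m_3r: "m = 3 * r"
  using p_6r p_eq by simp

definition B :: rat where "B = of_nat (3 * r choose r)"

text \<open>The relative deviation of \<open>reduced_sum\<close> from B^2 is -p h modulo p^2. The
  same combination reappears in \<open>quotient_sum_cong\<close>, where 1/3 and 2/3 are the weights
  of the two outer binomial sums.\<close>

definition h :: rat where "h = harmonic (3 * r) - harmonic r / 3 - 2 * harmonic (2 * r) / 3"

text \<open>Centring at 2r is dictated by i + 1/3 = (i - 2r) + p/3; the omitted index i = 2r is the
  factor p/3.\<close>

lemma reindex_around_2r:
  fixes f :: "int \<Rightarrow> rat"
  shows "(\<Sum>i\<in>{..3*r} - {2*r}. f (int i - int (2*r))) = (\<Sum>e=1..2*r. f (- int e)) + (\<Sum>e=1..r. f (int e))"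
    and "(\<Prod>i\<in>{..3*r} - {2*r}. f (int i - int (2*r))) = (\<Prod>e=1..2*r. f (- int e)) * (\<Prod>e=1..r. f (int e))"
proof -
  have s: "{..3*r} - {2*r} = {..<2*r} \<union> {2*r<..3*r}" "{..<2*r} \<inter> {2*r<..3*r} = {}" by auto
  have b1: "bij_betw (\<lambda>e. 2*r - e) {1..2*r} {..<2*r}"
    by (rule bij_betwI[of _ _ _ "\<lambda>i. 2*r - i"]) auto
  have b2: "bij_betw (\<lambda>e. 2*r + e) {1..r} {2*r<..3*r}"
    by (rule bij_betwI[of _ _ _ "\<lambda>i. i - 2*r"]) auto
  show "(\<Sum>i\<in>{..3*r} - {2*r}. f (int i - int (2*r))) = (\<Sum>e=1..2*r. f (- int e)) + (\<Sum>e=1..r. f (int e))"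
    unfolding s(1) using s(2)
    by (simp add: sum.union_disjoint sum.reindex_bij_betw[OF b1, symmetric] sum.reindex_bij_betw[OF b2, symmetric] of_nat_diff)
  show "(\<Prod>i\<in>{..3*r} - {2*r}. f (int i - int (2*r))) = (\<Prod>e=1..2*r. f (- int e)) * (\<Prod>e=1..r. f (int e))"
    unfolding s(1) using s(2)
    by (simp add: prod.union_disjoint prod.reindex_bij_betw[OF b1, symmetric] prod.reindex_bij_betw[OF b2, symmetric] of_nat_diff)
qed

lemma reduced_sum_cong: "cg 2 reduced_sum (B\<^sup>2 * (1 - q * h))"
proof -
  have q0: "q \<noteq> 0" using p_gt_3 by simp
  \<comment> \<open>Modulo p the fraction 1/3 is the integer -2r, so both products become products
    of integers perturbed by multiples of p.\<close>
  have third: "1 / 3 = q / 3 - of_nat (2 * r)"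
    using p_6r by (simp add: field_simps)
  define N where "N = (\<Prod>i=1..3*r. of_nat (i + 2 * r) :: rat)"
  define PN where "PN = (\<Prod>i=1..3*r. of_nat i - 1 / 3 :: rat)"
  define D where "D = (\<Prod>i\<in>{..3*r} - {2*r}. of_int (int i - int (2*r)) :: rat)"
  define D' where "D' = (\<Prod>i\<in>{..3*r} - {2*r}. 1 / 3 + of_nat i :: rat)"
  \<comment> \<open>\<open>Y\<close> is the first-order coefficient of the denominator product and
    \<open>Y - X\<close> that of the numerator product, so \<open>- X\<close> belongs to the
    quotient.\<close>
  define Y where "Y = 1 / 3 * (harmonic r - harmonic (2 * r))"
  define X where "X = 1 / 3 * (harmonic (5 * r) + harmonic r - 2 * harmonic (2 * r))"
  have H: "harmonic r \<in> zp" "harmonic (2 * r) \<in> zp" "harmonic (3 * r) \<in> zp" "harmonic (5 * r) \<in> zp"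
    by (rule harmonic_zp, use p_6r in linarith)+
  have t3: "1 / 3 \<in> zp" using zp_divide[OF zp_1 zunit_3] .
  have XY: "X \<in> zp" "Y \<in> zp" unfolding X_def Y_def by (intro zp_mult zp_add zp_diff zp_numeral H t3)+

  have "N * fact (2 * r) = fact (5 * r)"
  proof -
    have "(\<Prod>i=1..k. of_nat (i + 2 * r) :: rat) * fact (2 * r) = fact (k + 2 * r)" for k
      by (induction k) (simp_all add: algebra_simps)
    from this[of "3 * r"] show ?thesis unfolding N_def by (simp add: algebra_simps)
  qed
  then have N: "N = fact (5 * r) / fact (2 * r)" by (simp add: field_simps)
  have D: "D = fact (2 * r) * fact r"
  proof -
    have "(\<Prod>e=1..k. of_int (- int e) :: rat) = (-1)^k * fact k" for k
      by (induction k) (simp_all add: algebra_simps)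
    moreover have "(\<Prod>e=1..k. of_int (int e) :: rat) = fact k" for k
      by (simp add: fact_prod)
    ultimately show ?thesis
      unfolding D_def reindex_around_2r(2)[of of_int] by simp
  qed
  have zN: "N \<in> zp" unfolding N_def by auto
  have zD: "zunit D" unfolding D using p_6r by (intro zunit_mult zunit_fact) auto
  have zD': "zunit D'"
    unfolding D'_def
  proof (intro zunit_prod)
    fix i assume "i \<in> {..3*r} - {2*r}"
    then have i: "i \<le> 3 * r" "i \<noteq> 2 * r" by auto
    have "\<not> p dvd 3 * i + 1"
      using dvd_3k_plus_1[of i] i p_6r m_3r by force
    then have "zunit (of_nat (3 * i + 1) / 3)" by (intro zunit_divide zunit_of_nat zunit_3)
    then show "zunit (1 / 3 + of_nat i)" by (simp add: add_divide_distrib)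
  qed

  have PN: "cg 2 PN (N * (1 + q * (Y - X)))"
  proof -
    have "PN = (\<Prod>i=1..3*r. of_nat (i + 2*r) + q * (- (1 / 3)))"
      unfolding PN_def
    proof (intro prod.cong refl)
      fix i
      show "of_nat i - 1 / 3 = of_nat (i + 2*r) + q * (- (1 / 3))"
        using third by simp
    qed
    moreover have "cg 2 (\<Prod>i=1..3*r. of_nat (i + 2*r) + q * (- (1 / 3)))
       (N * (1 + q * (\<Sum>i=1..3*r. - (1 / 3) / of_nat (i + 2*r))))"
      unfolding N_def using p_6r t3 by (intro cg_prod_perturb zunit_less zp_minus) auto
    moreover have "(\<Sum>i=1..3*r. - (1 / 3) / of_nat (i + 2*r)) = Y - X"
    proof -
      have "(\<Sum>i=1..k. 1 / of_nat (i + 2 * r)) = harmonic (k + 2 * r) - harmonic (2 * r)" for k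
        by (induction k) (simp_all add: algebra_simps)
      from this[of "3 * r"] have "(\<Sum>i=1..3*r. 1 / of_nat (i + 2 * r)) = harmonic (5 * r) - harmonic (2 * r)"
        by simp
      moreover have "(\<Sum>i=1..3*r. - (1 / 3) / of_nat (i + 2*r)) = - (1 / 3) * (\<Sum>i=1..3*r. 1 / (of_nat (i + 2*r) :: rat))"
        unfolding sum_distrib_left by simp
      ultimately show ?thesis by (simp add: X_def Y_def algebra_simps)
    qed
    ultimately show ?thesis by simp
  qed
  have D'D: "cg 2 D' (D * (1 + q * Y))"
  proof -
    have "D' = (\<Prod>i\<in>{..3*r} - {2*r}. of_int (int i - int (2*r)) + q * (1 / 3))"
      unfolding D'_def
    proof (intro prod.cong refl)
      fix i
      show "1 / 3 + of_nat i = of_int (int i - int (2*r)) + q * (1 / 3)"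
        using third by simp
    qed
    moreover have "cg 2 (\<Prod>i\<in>{..3*r} - {2*r}. of_int (int i - int (2*r)) + q * (1 / 3))
       (D * (1 + q * (\<Sum>i\<in>{..3*r} - {2*r}. (1 / 3) / of_int (int i - int (2*r)))))"
      unfolding D_def
    proof (intro cg_prod_perturb t3)
      fix i assume i: "i \<in> {..3*r} - {2*r}"
      show "zunit (of_int (int i - int (2*r)))"
      proof (intro zunit_of_int notI)
        assume "int p dvd int i - int (2*r)"
        moreover have "i \<le> 3 * r" "int i - int (2*r) \<noteq> 0"
          using i by auto
        ultimately have "\<bar>int p\<bar> \<le> \<bar>int i - int (2*r)\<bar>"
          by (intro dvd_imp_le_int)
        then show False using p_6r \<open>i \<le> 3 * r\<close> by linarith
      qed
    qed auto
    moreover have "(\<Sum>i\<in>{..3*r} - {2*r}. (1 / 3) / of_int (int i - int (2*r))) = Y"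
      unfolding reindex_around_2r(1)[of "\<lambda>x. (1 / 3) / of_int x"] Y_def
      by (simp add: sum_distrib_left sum_negf right_diff_distrib)
    ultimately show ?thesis by simp
  qed

  have "reduced_sum = PN / D'"
  proof -
    \<comment> \<open>Removing i = 2r exposes q/3, which cancels the prefactor of
      \<open>reduced_sum_eq\<close>.\<close>
    have "(\<Prod>i\<le>3*r. 1 / 3 + of_nat i) = (1 / 3 + of_nat (2 * r)) * D'"
      unfolding D'_def by (rule prod.remove) auto
    also have "1 / 3 + of_nat (2 * r) = q / 3" unfolding third by simp
    finally have e: "(\<Prod>i\<le>3*r. 1 / 3 + of_nat i) = q / 3 * D'" .
    show ?thesis
      unfolding reduced_sum_eq m_3r PN_def[symmetric] e using q0 by simp
  qed
  also have "cg 2 (PN / D') (N / D * (1 - q * X))"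
  proof (rule cg_divideI[OF zD'])
    have "cg 2 (D' * (N / D * (1 - q * X))) (D * (1 + q * Y) * (N / D * (1 - q * X)))"
      using XY zN zD D'D by (intro cg_mult_right zp_mult zp_divide) auto
    also have "D * (1 + q * Y) * (N / D * (1 - q * X)) = N * ((1 + q * Y) * (1 + q * (- X)))"
      using zunitD(3)[OF zD] by simp
    also have "cg 2 \<dots> (N * (1 + q * (Y + - X)))"
      using XY zN by (intro cg_mult_left cg_one_plus_mult) auto
    finally have "cg 2 (D' * (N / D * (1 - q * X))) (N * (1 + q * (Y - X)))" by simp
    then show "cg 2 PN (D' * (N / D * (1 - q * X)))"
      using PN cg_sym cg_trans by blast
  qed
  also have "N / D * (1 - q * X) = B\<^sup>2 * (fact (5 * r) * fact r / (fact (3 * r))\<^sup>2 * (1 - q * X))"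
  proof -
    have "B = fact (3 * r) / (fact r * fact (2 * r))"
      unfolding B_def using binomial_fact[of r "3 * r", where ?'a=rat] by simp
    then show ?thesis unfolding N D by (simp add: power2_eq_square)
  qed
  also have "cg 2 \<dots> (B\<^sup>2 * ((1 + q * (harmonic r - harmonic (3 * r))) * (1 + q * (- X))))"
  proof -
    \<comment> \<open>The surplus (5r)! r! / (3r)!^2 is C(6r,3r) / C(6r,r), a quotient of binomial
      coefficients with upper entry p - 1, which are known modulo p^2. The signs (-1)^(3r) and
      (-1)^r agree.\<close>
    define c3 where "c3 = (-1)^(3*r) * (of_nat (p - 1 choose (3*r)) :: rat)"
    define c1 where "c1 = (-1)^r * (of_nat (p - 1 choose r) :: rat)"
    have e: "p - 1 = 6 * r" "6 * r - 3 * r = 3 * r" "6 * r - r = 5 * r" using p_6r by auto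
    have c3: "c3 = (-1)^(3*r) * (fact (6*r) / (fact (3*r) * fact (3*r)))"
      unfolding c3_def e using binomial_fact[of "3*r" "6*r", where ?'a=rat] by (simp add: e)
    have c1: "c1 = (-1)^r * (fact (6*r) / (fact r * fact (5*r)))"
      unfolding c1_def e using binomial_fact[of r "6*r", where ?'a=rat] by (simp add: e)
    have s: "(-1)^(3*r) = ((-1)^r :: rat)" by (simp add: minus_one_power_iff)
    have c31: "fact (5 * r) * fact r / (fact (3 * r))\<^sup>2 = c3 / c1"
      unfolding c3 c1 s by (simp add: power2_eq_square)
    have rp: "r < p" using p_6r by simp
    have zc: "zunit c1"
      unfolding c1 using p_6r by (intro zunit_mult zunit_divide zunit_power zunit_minus zunit_1 zunit_fact) auto
    have "cg 2 (c3 / c1) (1 + q * (harmonic r - harmonic (3 * r)))"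
    proof (rule cg_divideI[OF zc])
      have "cg 2 (c1 * (1 + q * (harmonic r - harmonic (3 * r)))) ((1 + q * (- harmonic r)) * (1 + q * (harmonic r - harmonic (3 * r))))"
        unfolding c1_def using binomial_p_pred_2[of r, OF rp] H by (intro cg_mult_right) auto
      also have "cg 2 \<dots> (1 + q * (- harmonic r + (harmonic r - harmonic (3 * r))))"
        using H by (intro cg_one_plus_mult) auto
      also have "1 + q * (- harmonic r + (harmonic r - harmonic (3 * r))) = 1 - q * harmonic (3 * r)"
        by (simp add: algebra_simps)
      finally have "cg 2 (c1 * (1 + q * (harmonic r - harmonic (3 * r)))) (1 - q * harmonic (3 * r))" .
      moreover have "cg 2 c3 (1 - q * harmonic (3 * r))"
        unfolding c3_def using p_6r by (intro binomial_p_pred_2) auto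
      ultimately show "cg 2 c3 (c1 * (1 + q * (harmonic r - harmonic (3 * r))))"
        using cg_sym cg_trans by blast
    qed
    moreover have "1 - q * X = 1 + q * (- X)" by simp
    ultimately show ?thesis
      unfolding c31 using XY(1) by (simp only:) (intro cg_mult_left cg_mult_right; simp add: B_def)
  qed
  also have "cg 2 \<dots> (B\<^sup>2 * (1 + q * ((harmonic r - harmonic (3 * r)) + - X)))"
    using XY H by (intro cg_mult_left cg_one_plus_mult) (auto simp: B_def)
  also have "cg 2 \<dots> (B\<^sup>2 * (1 + q * (- h)))"
  proof -
    have "cg 1 (harmonic (p - 1 - r)) (harmonic r)"
      using p_6r by (intro harmonic_reflect) auto
    moreover have "p - 1 - r = 5 * r" using p_6r by simp
    ultimately have "cg 1 (harmonic (5 * r)) (harmonic r)" by simp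
    then have "cg 1 (harmonic r - harmonic (3 * r) - 1 / 3 * (harmonic (5 * r) + harmonic r - 2 * harmonic (2 * r)))
       (harmonic r - harmonic (3 * r) - 1 / 3 * (harmonic r + harmonic r - 2 * harmonic (2 * r)))"
      using t3 by (intro cg_diff cg_mult_left cg_add cg_refl)
    also have "harmonic r - harmonic (3 * r) - 1 / 3 * (harmonic r + harmonic r - 2 * harmonic (2 * r)) = - h"
      unfolding h_def by (simp add: algebra_simps)
    finally have "cg 1 ((harmonic r - harmonic (3 * r)) + - X) (- h)" by (simp add: X_def)
    then show ?thesis
      by (intro cg_mult_left cg_add cg_refl cg_p_mult) (auto simp: B_def)
  qed
  finally show ?thesis by simp
qed

end

section \<open>Sums over Teichmueller representatives\<close>

text \<open>In x^p - y^p the difference x - y is one multiple of p, and the cofactor is another,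
  being p y^(p-1) modulo p. So a^p modulo p^2 depends only on a modulo p: it is the Teichmueller
  representative to that precision.\<close>

lemma cong_power_prime:
  fixes x y :: int
  assumes "[x = y] (mod int p)"
  shows "[x ^ p = y ^ p] (mod (int p)\<^sup>2)"
proof (cases p)
  case (Suc k)
  have "(\<Sum>i<p. x ^ i * y ^ (k - i)) mod int p = (\<Sum>i<p. y ^ i * y ^ (k - i)) mod int p"
    using assms unfolding cong_def[symmetric] by (intro cong_sum cong_mult cong_pow cong_refl)
  also have "(\<Sum>i<p. y ^ i * y ^ (k - i)) = (\<Sum>i<p. y ^ k)"
    using Suc by (intro sum.cong) (auto simp: power_add[symmetric])
  finally have "int p dvd (\<Sum>i<p. x ^ i * y ^ (k - i))"
    by (simp add: mod_eq_0_iff_dvd)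
  moreover have "int p dvd x - y" using assms by (simp add: cong_iff_dvd_diff)
  ultimately have "int p * int p dvd (x - y) * (\<Sum>i<p. x ^ i * y ^ (k - i))"
    by (intro mult_dvd_mono)
  then show ?thesis
    using diff_power_eq_sum[of x k y] Suc by (simp add: cong_iff_dvd_diff power2_eq_square)
qed simp

text \<open>For a primitive root g the sum becomes geometric with ratio z = g^(pn), and z^(p-1) is 1
  modulo p^2.\<close>

lemma sum_teichmueller_powers:
  fixes n :: nat
  assumes p: "prime p"
  shows "[(\<Sum>a=1..p-1. (int a ^ p) ^ n) = (if (p - 1) dvd n then int p - 1 else 0)] (mod (int p)\<^sup>2)"
proof -
  have p1: "p > 1" using p prime_gt_1_nat by blast
  obtain g where g: "residue_primroot p g" using prime_primitive_root_exists[OF p1 p] by blast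
  then have gp: "coprime p g" "ord p g = p - 1"
    using p by (auto simp: residue_primroot_def totient_prime)
  have bij: "bij_betw (\<lambda>i. g ^ i mod p) {..<p-1} {1..p-1}"
  proof -
    have "totatives p = {1..p-1}" using p by (auto simp: totatives_prime)
    then show ?thesis
      using residue_primroot_is_generator[OF p1 g] p by (simp add: totient_prime)
  qed
  define z :: int where "z = (int g ^ p) ^ n"
  have "(\<Sum>a=1..p-1. (int a ^ p) ^ n) = (\<Sum>i<p-1. (int (g ^ i mod p) ^ p) ^ n)"
    by (rule sum.reindex_bij_betw[OF bij, symmetric])
  also have "[\<dots> = (\<Sum>i<p-1. z ^ i)] (mod (int p)\<^sup>2)"
  proof (intro cong_sum)
    fix i
    have "[int (g ^ i mod p) ^ p = (int g ^ i) ^ p] (mod (int p)\<^sup>2)"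
      by (intro cong_power_prime) (simp add: cong_def zmod_int)
    then have "[(int (g ^ i mod p) ^ p) ^ n = ((int g ^ i) ^ p) ^ n] (mod (int p)\<^sup>2)"
      by (rule cong_pow)
    also have "((int g ^ i) ^ p) ^ n = z ^ i"
      by (simp add: z_def power_mult[symmetric] mult_ac)
    finally show "[(int (g ^ i mod p) ^ p) ^ n = z ^ i] (mod (int p)\<^sup>2)" .
  qed
  finally have SZ: "[(\<Sum>a=1..p-1. (int a ^ p) ^ n) = (\<Sum>i<p-1. z ^ i)] (mod (int p)\<^sup>2)" .
  have fermat: "[int g ^ (p - 1) = 1] (mod int p)"
    using gp(1) p by (metis cong_int_iff coprime_commute fermat_theorem of_nat_1 of_nat_power
        coprime_iff_gcd_eq_1 prime_imp_coprime not_prime_unit coprime_common_divisor dvd_refl)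
  have gpp: "[(int g ^ (p - 1)) ^ p = 1] (mod (int p)\<^sup>2)"
    using cong_power_prime[OF fermat] by simp
  show ?thesis
  proof (cases "(p - 1) dvd n")
    case True
    then obtain j where "n = (p - 1) * j" by blast
    then have "z = ((int g ^ (p - 1)) ^ p) ^ j"
      by (simp add: z_def power_mult[symmetric] mult_ac)
    then have "[z = 1] (mod (int p)\<^sup>2)"
      using cong_pow[OF gpp, of j] by simp
    then have "[(\<Sum>i<p-1. z ^ i) = (\<Sum>i<p-1. 1 ^ i)] (mod (int p)\<^sup>2)"
      by (intro cong_sum cong_pow)
    then show ?thesis
      using SZ True p1 by (auto intro: cong_trans simp: of_nat_diff)
  next
    case False
    \<comment> \<open>Dividing by z - 1 modulo p^2 requires z - 1 to be prime to p. Modulo p the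
      ratio z is g^n, which differs from 1 there because p - 1 does not divide n.\<close>
    have "\<not> int p dvd z - 1"
    proof
      assume "int p dvd z - 1"
      then have "[z = 1] (mod int p)" by (simp add: cong_iff_dvd_diff)
      moreover have "[int g ^ p = int g] (mod int p)"
        using cong_mult[OF fermat cong_refl[of "int g"]] p1 by (simp add: power_eq_if[of _ p])
           (metis mult.commute)
      then have "[z = int g ^ n] (mod int p)" unfolding z_def by (rule cong_pow)
      ultimately have "[int g ^ n = 1] (mod int p)"
        using cong_sym cong_trans by blast
      then have "[g ^ n = 1] (mod p)" by (metis cong_int_iff of_nat_1 of_nat_power)
      then have "ord p g dvd n" by (simp only: ord_divides)
      then show False using gp(2) False by simp
    qed
    then have cop: "coprime ((int p)\<^sup>2) (z - 1)"
      using p by (simp add: prime_imp_coprime)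
    have "[z ^ (p - 1) = 1] (mod (int p)\<^sup>2)"
    proof -
      have "z ^ (p - 1) = ((int g ^ (p - 1)) ^ p) ^ n"
        by (simp add: z_def power_mult[symmetric] mult_ac)
      then show ?thesis using cong_pow[OF gpp, of n] by simp
    qed
    then have "(int p)\<^sup>2 dvd (z - 1) * (\<Sum>i<p-1. z ^ i)"
      by (simp add: cong_iff_dvd_diff power_diff_1_eq[symmetric])
    then have "(int p)\<^sup>2 dvd (\<Sum>i<p-1. z ^ i)"
      using cop coprime_dvd_mult_right_iff by blast
    then have "[(\<Sum>i<p-1. z ^ i) = 0] (mod (int p)\<^sup>2)" by (simp add: cong_iff_dvd_diff)
    then show ?thesis using SZ False by (auto intro: cong_trans)
  qed
qed

lemma power_linear_mod_square:
  fixes u v P :: int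
  shows "[(u + P * v) ^ Suc n = u ^ Suc n + int (Suc n) * P * v * u ^ n] (mod P\<^sup>2)"
proof (induction n)
  case (Suc n)
  have "[(u + P * v) * (u + P * v) ^ Suc n = (u + P * v) * (u ^ Suc n + int (Suc n) * P * v * u ^ n)] (mod P\<^sup>2)"
    by (rule cong_mult[OF cong_refl Suc])
  also have "(u + P * v) * (u ^ Suc n + int (Suc n) * P * v * u ^ n) =
      u ^ Suc (Suc n) + int (Suc (Suc n)) * P * v * u ^ Suc n + P\<^sup>2 * (int (Suc n) * v * v * u ^ n)"
    by (simp add: algebra_simps power2_eq_square)
  also have "[\<dots> = u ^ Suc (Suc n) + int (Suc (Suc n)) * P * v * u ^ Suc n] (mod P\<^sup>2)"
    by (simp add: cong_iff_dvd_diff)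
  finally show ?case by simp
qed simp

section \<open>Lifting the cubic character sum from modulo p to modulo p^2\<close>

context large_prime
begin

definition qbin :: "nat \<Rightarrow> int" where
  "qbin i = int ((p choose i) div p)"

lemma p_qbin: "0 < i \<Longrightarrow> i < p \<Longrightarrow> int p * qbin i = int (p choose i)"
  using prime_p by (simp add: qbin_def dvd_choose_prime flip: of_nat_mult)

text \<open>From i C(p,i) = p C(p-1,i-1), where C(p-1,i-1) is (-1)^(i-1) modulo p.\<close>

lemma qbin_cong:
  assumes "0 < i" "i < p"
  shows "cg 1 (of_int (qbin i)) (- ((-1) ^ i / of_nat i))"
proof -
  have "i * (p choose i) = p * (p - 1 choose (i - 1))"
    using assms times_binomial_minus1_eq[of i p] by simp
  then have "int i * (int p * qbin i) = int p * int (p - 1 choose (i - 1))"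
    using p_qbin[OF assms] by (simp flip: of_nat_mult)
  then have "int i * qbin i = int (p - 1 choose (i - 1))"
    using p_gt_3 by simp
  then have "of_nat i * of_int (qbin i) = (of_nat (p - 1 choose (i - 1)) :: rat)"
    by (metis of_int_mult of_int_of_nat_eq)
  moreover have "cg 1 (of_nat (p - 1 choose (i - 1))) (- ((-1) ^ i))"
  proof -
    have "cg 1 ((-1) ^ (i - 1) * ((-1) ^ (i - 1) * of_nat (p - 1 choose (i - 1)))) ((-1) ^ (i - 1) * 1)"
      using assms by (intro cg_mult_left binomial_p_pred) auto
    moreover have "(-1) ^ (i - 1) = (- ((-1) ^ i) :: rat)"
      using assms by (cases i) auto
    moreover have "(-1) ^ (i - 1) * ((-1) ^ (i - 1) * x) = x" for x :: rat
      by (simp add: mult.assoc[symmetric] flip: power_mult_distrib)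
    ultimately show ?thesis by simp
  qed
  moreover have u: "zunit (of_nat i)" using assms by (rule zunit_less)
  ultimately have "cg 1 (of_nat i * of_int (qbin i)) (of_nat i * (- ((-1) ^ i / of_nat i)))"
    using zunitD(3)[OF u] by simp
  then show ?thesis by (rule cg_cancel[OF u])
qed

text \<open>Measures how far the p-th power map is from being additive. It enters because adding 1
  to a Teichmueller representative leaves the set of representatives.\<close>

definition Qpoly :: "int \<Rightarrow> int" where
  "Qpoly y = (\<Sum>i=1..p-1. qbin i * y ^ i)"

lemma add_1_power_p: "(y + 1) ^ p = y ^ p + 1 + int p * Qpoly y"
proof -
  have "(y + 1) ^ p = (\<Sum>i\<le>p. int (p choose i) * y ^ i)"
    by (simp add: binomial_ring)
  also have "{..p} = insert 0 (insert p {1..p-1})"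
    using p_gt_3 by auto
  also have "(\<Sum>i\<in>\<dots>. int (p choose i) * y ^ i) = 1 + (y ^ p + (\<Sum>i=1..p-1. int (p choose i) * y ^ i))"
    using p_gt_3 by (subst sum.insert, simp, simp, subst sum.insert) auto
  also have "(\<Sum>i=1..p-1. int (p choose i) * y ^ i) = int p * Qpoly y"
    unfolding Qpoly_def sum_distrib_left
    using p_qbin by (intro sum.cong) (auto simp: mult.assoc[symmetric])
  finally show ?thesis by simp
qed

definition cubic_sum :: int where
  "cubic_sum = (\<Sum>a<p. Legendre (int a ^ 3 + 1) (int p))"

lemma Legendre_power_p: "Legendre n P ^ p = Legendre n P"
proof -
  have "odd p" using p_eq by presburger
  then show ?thesis using p_gt_3 by (auto simp: Legendre_def)
qed

text \<open>A Legendre symbol equals its own p-th power, so raising Euler's criterion to the power p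
  upgrades it to modulo p^2. With X = a^p, the p-th power of X^3 + 1 is X^3 + 1 + p Q(X^3), whose
  m-th power is then linearised in p.\<close>

lemma cubic_sum_teichmueller:
  "[cubic_sum = (\<Sum>a<p. ((int a ^ p) ^ 3 + 1) ^ m + int m * int p * (Qpoly ((int a ^ p) ^ 3) * ((int a ^ p) ^ 3 + 1) ^ (m - 1)))]
     (mod (int p)\<^sup>2)"
  unfolding cubic_sum_def
proof (intro cong_sum)
  fix a
  define X where "X = int a ^ p"
  have mm: "m = Suc (m - 1)" using p_eq p_gt_3 by linarith
  have Xa: "[X = int a] (mod int p)"
  proof (cases "p dvd a")
    case True
    then have "int p dvd int a" by simp
    moreover have "int a dvd int a ^ p" using p_gt_3 by (intro dvd_power) simp
    ultimately show ?thesis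
      unfolding X_def cong_iff_dvd_diff by (meson dvd_diff dvd_trans)
  next
    case False
    then have "[a ^ (p - 1) = 1] (mod p)" by (rule fermat_theorem[OF prime_p])
    then have "[a * a ^ (p - 1) = a * 1] (mod p)" by (intro cong_mult cong_refl)
    then have "[a ^ p = a] (mod p)" using p_gt_3 by (simp add: power_eq_if[of _ p])
    then show ?thesis unfolding X_def by (metis cong_int_iff of_nat_power)
  qed
  have "[X ^ p = X] (mod (int p)\<^sup>2)"
    using cong_power_prime[OF Xa] unfolding X_def[symmetric] .
  then have "[(X ^ p) ^ 3 = X ^ 3] (mod (int p)\<^sup>2)"
    by (rule cong_pow)
  moreover have "(X ^ p) ^ 3 = (X ^ 3) ^ p"
    by (simp add: power_mult[symmetric] mult.commute)
  ultimately have X3: "[(X ^ 3) ^ p = X ^ 3] (mod (int p)\<^sup>2)" by simp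
  have "[Legendre (int a ^ 3 + 1) (int p) = (int a ^ 3 + 1) ^ m] (mod int p)"
    using euler_criterion[OF prime_p, of "int a ^ 3 + 1"] p_gt_3 by (simp add: m_def)
  also have "[(int a ^ 3 + 1) ^ m = (X ^ 3 + 1) ^ m] (mod int p)"
    by (intro cong_pow cong_add cong_refl cong_sym[OF Xa])
  finally have "[Legendre (int a ^ 3 + 1) (int p) = ((X ^ 3 + 1) ^ m) ^ p] (mod (int p)\<^sup>2)"
    using cong_power_prime Legendre_power_p by metis
  also have "((X ^ 3 + 1) ^ m) ^ p = ((X ^ 3) ^ p + 1 + int p * Qpoly (X ^ 3)) ^ m"
    unfolding add_1_power_p[symmetric] by (simp add: power_mult[symmetric] mult.commute)
  also have "[\<dots> = (X ^ 3 + 1 + int p * Qpoly (X ^ 3)) ^ m] (mod (int p)\<^sup>2)"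
    by (intro cong_pow cong_add cong_refl X3)
  also have "[(X ^ 3 + 1 + int p * Qpoly (X ^ 3)) ^ m =
     (X ^ 3 + 1) ^ m + int m * int p * Qpoly (X ^ 3) * (X ^ 3 + 1) ^ (m - 1)] (mod (int p)\<^sup>2)"
    using power_linear_mod_square[of "X ^ 3 + 1" "int p" "Qpoly (X ^ 3)" "m - 1"] mm by simp
  finally show "[Legendre (int a ^ 3 + 1) (int p) =
     ((int a ^ p) ^ 3 + 1) ^ m + int m * int p * (Qpoly ((int a ^ p) ^ 3) * ((int a ^ p) ^ 3 + 1) ^ (m - 1))] (mod (int p)\<^sup>2)"
    unfolding X_def by (simp add: mult.assoc)
qed

end

context prime_1_mod_6
begin

text \<open>Since p - 1 = 6r, it divides 3n exactly if 2r divides n. The term a = 0 contributes only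
  to n = 0, whence p there and p - 1 otherwise.\<close>

lemma sum_teichmueller_cubes:
  "[(\<Sum>a<p. ((int a ^ p) ^ 3) ^ n) = (if n = 0 then int p else if 2 * r dvd n then int p - 1 else 0)] (mod (int p)\<^sup>2)"
proof (cases "n = 0")
  case False
  have "(\<Sum>a<p. ((int a ^ p) ^ 3) ^ n) = (\<Sum>a=1..p-1. (int a ^ p) ^ (3 * n))"
    using False p_gt_3 by (intro sum.mono_neutral_cong_right) (auto simp: power_mult zero_power)
  moreover have "(p - 1) dvd 3 * n \<longleftrightarrow> 2 * r dvd n"
  proof -
    have "p - 1 = 3 * (2 * r)" using p_6r by simp
    then show ?thesis by (simp only: nat_mult_dvd_cancel_disj) simp
  qed
  ultimately show ?thesis
    using sum_teichmueller_powers[OF prime_p, of "3 * n"] False by simp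
qed simp

text \<open>Modulo p, the negative of the sum over a < p of Q(X) (X+1)^(m-1) with X = a^(3p): after
  expansion only the exponents i + w divisible by 2r survive, each with power sum -1.\<close>

definition quotient_sum :: int where
  "quotient_sum = (\<Sum>w<3*r. int (3 * r - 1 choose w) * (\<Sum>i\<in>{i\<in>{1..p-1}. 2 * r dvd i + w}. qbin i))"

lemma cubic_sum_cong_int:
  "[cubic_sum = int p + (int p - 1) * int (3 * r choose r) - int (3 * r) * int p * quotient_sum] (mod (int p)\<^sup>2)"
proof -
  define X where "X a = (int a ^ p) ^ 3" for a :: nat
  have "[(\<Sum>a<p. (X a + 1) ^ m) = int p + (int p - 1) * int (3 * r choose r)] (mod (int p)\<^sup>2)"
  proof -
    have "(\<Sum>a<p. (X a + 1) ^ m) = (\<Sum>a<p. \<Sum>w\<le>3*r. int (3 * r choose w) * X a ^ w)"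
      unfolding m_3r by (simp add: binomial_ring)
    also have "\<dots> = (\<Sum>w\<le>3*r. int (3 * r choose w) * (\<Sum>a<p. X a ^ w))"
      unfolding sum_distrib_left by (rule sum.swap)
    also have "[\<dots> = (\<Sum>w\<le>3*r. int (3 * r choose w) * (if w = 0 then int p else if 2 * r dvd w then int p - 1 else 0))] (mod (int p)\<^sup>2)"
      unfolding X_def by (intro cong_sum cong_mult cong_refl sum_teichmueller_cubes)
    \<comment> \<open>Up to 3r the only multiples of 2r are 0 and 2r; the latter contributes the
      binomial coefficient C(3r,2r) = C(3r,r).\<close>
    also have "(\<Sum>w\<le>3*r. int (3 * r choose w) * (if w = 0 then int p else if 2 * r dvd w then int p - 1 else 0))
       = (\<Sum>w\<in>{0, 2*r}. int (3 * r choose w) * (if w = 0 then int p else if 2 * r dvd w then int p - 1 else 0))"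
    proof (intro sum.mono_neutral_right ballI)
      fix w assume w: "w \<in> {..3*r} - {0, 2*r}"
      have "\<not> 2 * r dvd w"
      proof
        assume "2 * r dvd w"
        then obtain c where c: "w = 2 * r * c" by blast
        then have "2 * r * c < 2 * r * 2" using w r_pos by auto
        then have "c < 2" by simp
        then show False using c w by (cases c) auto
      qed
      then show "int (3 * r choose w) * (if w = 0 then int p else if 2 * r dvd w then int p - 1 else 0) = 0"
        using w by auto
    qed auto
    also have "\<dots> = int p + (int p - 1) * int (3 * r choose r)"
      using r_pos binomial_symmetric[of r "3 * r"] by simp
    finally show ?thesis .
  qed
  moreover have "[int m * int p * (\<Sum>a<p. Qpoly (X a) * (X a + 1) ^ (m - 1)) = int m * int p * (- quotient_sum)] (mod (int p)\<^sup>2)"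
  proof -
    have "(\<Sum>a<p. Qpoly (X a) * (X a + 1) ^ (m - 1)) =
      (\<Sum>a<p. \<Sum>w<3*r. \<Sum>i=1..p-1. int (3 * r - 1 choose w) * qbin i * X a ^ (i + w))"
    proof (intro sum.cong refl)
      fix a
      have "{..m - 1} = {..<3*r}" using m_3r r_pos by auto
      then have "(X a + 1) ^ (m - 1) = (\<Sum>w<3*r. int (3 * r - 1 choose w) * X a ^ w)"
        unfolding binomial_ring[of "X a" 1] by (simp add: m_3r)
      then have "Qpoly (X a) * (X a + 1) ^ (m - 1) = (\<Sum>w<3*r. Qpoly (X a) * (int (3 * r - 1 choose w) * X a ^ w))"
        by (simp only: sum_distrib_left)
      also have "\<dots> = (\<Sum>w<3*r. \<Sum>i=1..p-1. int (3 * r - 1 choose w) * qbin i * X a ^ (i + w))"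
        unfolding Qpoly_def sum_distrib_right by (intro sum.cong refl) (simp add: power_add)
      finally show "Qpoly (X a) * (X a + 1) ^ (m - 1) = (\<Sum>w<3*r. \<Sum>i=1..p-1. int (3 * r - 1 choose w) * qbin i * X a ^ (i + w))" .
    qed
    also have "\<dots> = (\<Sum>w<3*r. \<Sum>a<p. \<Sum>i=1..p-1. int (3 * r - 1 choose w) * qbin i * X a ^ (i + w))"
      by (rule sum.swap)
    also have "\<dots> = (\<Sum>w<3*r. \<Sum>i=1..p-1. int (3 * r - 1 choose w) * qbin i * (\<Sum>a<p. X a ^ (i + w)))"
      unfolding sum_distrib_left by (intro sum.cong refl sum.swap)
    finally have e1: "(\<Sum>a<p. Qpoly (X a) * (X a + 1) ^ (m - 1)) =
      (\<Sum>w<3*r. \<Sum>i=1..p-1. int (3 * r - 1 choose w) * qbin i * (\<Sum>a<p. X a ^ (i + w)))" .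
    \<comment> \<open>This double sum is multiplied by p, so its value modulo p suffices and p - 1
      may be replaced by -1.\<close>
    have central_part: "[(\<Sum>w<3*r. \<Sum>i=1..p-1. int (3 * r - 1 choose w) * qbin i * (\<Sum>a<p. X a ^ (i + w))) =
      (\<Sum>w<3*r. \<Sum>i=1..p-1. int (3 * r - 1 choose w) * qbin i * (if 2 * r dvd i + w then -1 else 0))] (mod int p)"
    proof (intro cong_sum cong_mult cong_refl)
      fix i w assume i: "i \<in> {1..p-1}"
      have "i + w \<noteq> 0" using i by simp
      then have "[(\<Sum>a<p. X a ^ (i + w)) = (if 2 * r dvd i + w then int p - 1 else 0)] (mod (int p)\<^sup>2)"
        using sum_teichmueller_cubes[of "i + w"] unfolding X_def by (simp only: if_False)
      then have 1: "[(\<Sum>a<p. X a ^ (i + w)) = (if 2 * r dvd i + w then int p - 1 else 0)] (mod int p)"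
        by (rule cong_dvd_modulus) simp
      have 2: "[(if 2 * r dvd i + w then int p - 1 else 0) = (if 2 * r dvd i + w then -1 else 0)] (mod int p)"
        by (simp add: cong_iff_dvd_diff)
      show "[(\<Sum>a<p. X a ^ (i + w)) = (if 2 * r dvd i + w then -1 else 0)] (mod int p)"
        by (rule cong_trans[OF 1 2])
    qed
    have e3: "(\<Sum>w<3*r. \<Sum>i=1..p-1. int (3 * r - 1 choose w) * qbin i * (if 2 * r dvd i + w then -1 else 0)) = - quotient_sum"
      unfolding quotient_sum_def sum_negf[symmetric] sum_distrib_left
      by (rule sum.cong[OF refl], simp only: sum.inter_filter finite_atLeastAtMost, rule sum.cong[OF refl], simp)
    have "[(\<Sum>a<p. Qpoly (X a) * (X a + 1) ^ (m - 1)) = - quotient_sum] (mod int p)"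
      using central_part unfolding e1 e3 .
    then have "int p * int p dvd int p * ((\<Sum>a<p. Qpoly (X a) * (X a + 1) ^ (m - 1)) - - quotient_sum)"
      unfolding cong_iff_dvd_diff by (intro mult_dvd_mono) auto
    then have "int p * int p dvd int m * (int p * ((\<Sum>a<p. Qpoly (X a) * (X a + 1) ^ (m - 1)) - - quotient_sum))"
      by (rule dvd_mult)
    then show ?thesis
      unfolding cong_iff_dvd_diff by (simp add: power2_eq_square algebra_simps)
  qed
  ultimately have "[(\<Sum>a<p. (X a + 1) ^ m) + int m * int p * (\<Sum>a<p. Qpoly (X a) * (X a + 1) ^ (m - 1)) =
     int p + (int p - 1) * int (3 * r choose r) + int m * int p * (- quotient_sum)] (mod (int p)\<^sup>2)"
    by (rule cong_add)
  then show ?thesis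
    using cubic_sum_teichmueller unfolding X_def[symmetric] sum.distrib sum_distrib_left[symmetric]
    by (auto intro: cong_trans simp: m_3r)
qed

end

text \<open>Coefficient of x^(n+1) in x/(1+x) times (1+x)^(N+1), which is x (1+x)^N.\<close>

lemma alternating_binomial_partial_sum:
  "(\<Sum>e=1..Suc n. (-1)^(e+1) * of_nat (Suc N choose (Suc n - e))) = (of_nat (N choose n) :: rat)"
proof (induction n)
  case (Suc n)
  have "(\<Sum>e=1..Suc (Suc n). (-1)^(e+1) * of_nat (Suc N choose (Suc (Suc n) - e)) :: rat) =
    of_nat (Suc N choose Suc n) + (\<Sum>e=Suc 1..Suc (Suc n). (-1)^(e+1) * of_nat (Suc N choose (Suc (Suc n) - e)))"
    by (subst sum.atLeast_Suc_atMost) (simp_all del: binomial_Suc_Suc)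
  also have "(\<Sum>e=Suc 1..Suc (Suc n). (-1)^(e+1) * of_nat (Suc N choose (Suc (Suc n) - e)) :: rat) =
    - (\<Sum>e=1..Suc n. (-1)^(e+1) * of_nat (Suc N choose (Suc n - e)))"
    unfolding sum.shift_bounds_cl_Suc_ivl sum_negf[symmetric]
    by (intro sum.cong) (auto simp del: binomial_Suc_Suc)
  also note Suc.IH
  finally show ?case by simp
qed simp

section \<open>Closed form of the quotient sum modulo p\<close>

context prime_1_mod_6
begin

text \<open>The contribution of the positions i = 4r - w to \<open>quotient_sum\<close>, after
  \<open>qbin_cong\<close>. It is the quantity called e in the overview.\<close>

definition central_part :: rat where
  "central_part = (\<Sum>w<3*r. of_nat (3 * r - 1 choose w) * (- ((-1) ^ w * (1 / of_nat (4 * r - w)))))"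

text \<open>As i + w is positive and below 10r, only the multiples 2r, 4r, 6r, 8r can occur. The
  first needs w < 2r to keep i positive, the last needs w \<ge> 2r to keep i \<le> 6r.\<close>

lemma residue_positions:
  assumes "w < 3 * r"
  shows "{i\<in>{1..p-1}. 2 * r dvd i + w} = (if w < 2 * r then {2*r-w, 4*r-w, 6*r-w} else {8*r-w, 4*r-w, 6*r-w})"
proof (intro equalityI subsetI)
  fix i assume "i \<in> {i\<in>{1..p-1}. 2 * r dvd i + w}"
  then obtain c where c: "i + w = 2 * r * c" and i: "1 \<le> i" "i \<le> 6 * r" using p_6r by auto
  have "2 * r * c < 2 * r * 5" using c i assms by linarith
  then have "c < 5" by simp
  moreover have "c \<noteq> 0" using c i by (intro notI) simp
  ultimately have "c = 1 \<or> c = 2 \<or> c = 3 \<or> c = 4" by linarith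
  then show "i \<in> (if w < 2 * r then {2*r-w, 4*r-w, 6*r-w} else {8*r-w, 4*r-w, 6*r-w})"
    using c i assms by (elim disjE) auto
next
  fix i assume i: "i \<in> (if w < 2 * r then {2*r-w, 4*r-w, 6*r-w} else {8*r-w, 4*r-w, 6*r-w})"
  then have "i + w = 2 * r * 1 \<or> i + w = 2 * r * 2 \<or> i + w = 2 * r * 3 \<or> i + w = 2 * r * 4"
    using assms by (auto split: if_splits)
  then have "2 * r dvd i + w" by (elim disjE) (simp_all only: dvd_triv_left)
  moreover have "i \<ge> 1" "i \<le> 6 * r" using i assms by (auto split: if_splits)
  ultimately show "i \<in> {i\<in>{1..p-1}. 2 * r dvd i + w}" using p_6r by simp
qed

lemma qbin_cong_parity:
  assumes "0 < i" "i < p" "even (i + w)"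
  shows "cg 1 (of_int (qbin i)) (- ((-1) ^ w * (1 / of_nat i)))"
proof -
  have "(-1) ^ i = ((-1) ^ w :: rat)" using assms(3) by (auto simp: minus_one_power_iff)
  then show ?thesis using qbin_cong[OF assms(1,2)] by simp
qed

text \<open>The positions 6r - w and 8r - w are p - (w+1) and p - (w+1-2r). Reflection turns their
  reciprocals into -1/(w+1) and -1/(w+1-2r), for which the sums over w have closed forms.\<close>

lemma inner_sum_cong:
  assumes w: "w < 3 * r"
  shows "cg 1 (of_int (\<Sum>i\<in>{i\<in>{1..p-1}. 2 * r dvd i + w}. qbin i))
    (- ((-1) ^ w * (1 / of_nat (4 * r - w))) + ((-1) ^ w * (1 / of_nat (w + 1))) +
     (if w < 2 * r then - ((-1) ^ w * (1 / of_nat (2 * r - w))) else (-1) ^ w * (1 / of_nat (w + 1 - 2 * r))))"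
proof -
  have q4: "cg 1 (of_int (qbin (4 * r - w))) (- ((-1) ^ w * (1 / of_nat (4 * r - w))))"
    using w p_6r by (intro qbin_cong_parity) auto
  have q6: "cg 1 (of_int (qbin (6 * r - w))) ((-1) ^ w * (1 / of_nat (w + 1)))"
  proof -
    have a: "cg 1 (of_int (qbin (6 * r - w))) (- ((-1) ^ w * (1 / of_nat (6 * r - w))))"
      using w p_6r by (intro qbin_cong_parity) auto
    have b: "cg 1 (- ((-1) ^ w * (1 / of_nat (p - (w + 1))))) (- ((-1) ^ w * (- (1 / of_nat (w + 1)))))"
      by (intro cg_minus cg_mult_left inverse_reflect zp_power zp_minus zp_1; use w p_6r in linarith)
    have e: "p - (w + 1) = 6 * r - w" using p_6r by simp
    show ?thesis using cg_trans[OF a b[unfolded e]] by simp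
  qed
  show ?thesis
  proof (cases "w < 2 * r")
    case True
    have a: "cg 1 (of_int (qbin (2 * r - w))) (- ((-1) ^ w * (1 / of_nat (2 * r - w))))"
      using w True p_6r by (intro qbin_cong_parity) auto
    have s: "(\<Sum>i\<in>{i\<in>{1..p-1}. 2 * r dvd i + w}. qbin i) = qbin (4*r-w) + qbin (6*r-w) + qbin (2*r-w)"
    proof -
      have "2*r-w \<noteq> 4*r-w" "2*r-w \<noteq> 6*r-w" "4*r-w \<noteq> 6*r-w"
        using True r_pos by linarith+
      then show ?thesis
        unfolding residue_positions[OF w] using True by simp
    qed
    show ?thesis
      using cg_add[OF cg_add[OF q4 q6] a] True unfolding s by simp
  next
    case False
    have a: "cg 1 (of_int (qbin (8 * r - w))) (- ((-1) ^ w * (1 / of_nat (8 * r - w))))"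
      using w False p_6r by (intro qbin_cong_parity) auto
    have b: "cg 1 (- ((-1) ^ w * (1 / of_nat (p - (w + 1 - 2 * r))))) (- ((-1) ^ w * (- (1 / of_nat (w + 1 - 2 * r)))))"
      by (intro cg_minus cg_mult_left inverse_reflect zp_power zp_minus zp_1; use w False p_6r in linarith)
    have e: "p - (w + 1 - 2 * r) = 8 * r - w" using p_6r False by simp
    have a': "cg 1 (of_int (qbin (8 * r - w))) ((-1) ^ w * (1 / of_nat (w + 1 - 2 * r)))"
      using cg_trans[OF a b[unfolded e]] by simp
    have s: "(\<Sum>i\<in>{i\<in>{1..p-1}. 2 * r dvd i + w}. qbin i) = qbin (4*r-w) + qbin (6*r-w) + qbin (8*r-w)"
    proof -
      have "8*r-w \<noteq> 4*r-w" "8*r-w \<noteq> 6*r-w" "4*r-w \<noteq> 6*r-w"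
        using w r_pos by linarith+
      then show ?thesis
        unfolding residue_positions[OF w] using False by simp
    qed
    show ?thesis
      using cg_add[OF cg_add[OF q4 q6] a'] False unfolding s by simp
  qed
qed

text \<open>With w = 2r - e, absorption gives C(3r-1,w) = (r+e)/(3r) C(3r,w). Division by e splits
  this into a part with 1/e and weight 1/3, summed by \<open>alternating_binomial_harmonic\<close>,
  and a part without denominators e.\<close>

lemma quotient_sum_low:
  "(\<Sum>w<2*r. of_nat (3 * r - 1 choose w) * (- ((-1) ^ w * (1 / of_nat (2 * r - w))))) =
   1 / 3 * (B * (harmonic (3 * r) - harmonic r)) + 1 / of_nat (3 * r) * of_nat (3 * r - 1 choose (2 * r - 1))"
proof -
  have r0: "of_nat r \<noteq> (0 :: rat)" using r_pos by simp
  have b1: "bij_betw (\<lambda>e. 2*r - e) {1..2*r} {..<2*r}"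
    by (rule bij_betwI[of _ _ _ "\<lambda>i. 2*r - i"]) auto
  have "(\<Sum>w<2*r. of_nat (3 * r - 1 choose w) * (- ((-1) ^ w * (1 / of_nat (2 * r - w))))) =
     (\<Sum>e=1..2*r. 1 / 3 * ((-1)^(e+1) * of_nat (3 * r choose (2 * r - e)) / of_nat e) +
        1 / of_nat (3 * r) * ((-1)^(e+1) * of_nat (3 * r choose (2 * r - e))) :: rat)"
    unfolding sum.reindex_bij_betw[OF b1, symmetric]
  proof (intro sum.cong refl)
    fix e assume e: "e \<in> {1..2*r}"
    then have "3 * r - (2 * r - e) = r + e" by auto
    then have "(r + e) * (3 * r choose (2 * r - e)) = 3 * r * (3 * r - 1 choose (2 * r - e))"
      using binomial_absorb_comp[of "3 * r" "2 * r - e"] by simp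
    then have "of_nat (r + e) * of_nat (3 * r choose (2 * r - e)) = of_nat (3 * r) * (of_nat (3 * r - 1 choose (2 * r - e)) :: rat)"
      by (simp only: of_nat_mult[symmetric])
    then have c: "of_nat (3 * r - 1 choose (2 * r - e)) = (of_nat r + of_nat e) * of_nat (3 * r choose (2 * r - e)) / (3 * of_nat r :: rat)"
      using r0 by (simp add: field_simps)
    have s: "(-1) ^ (2 * r - e) = ((-1) ^ e :: rat)" using e by (auto simp: minus_one_power_iff)
    have e0: "of_nat e \<noteq> (0 :: rat)" "2 * r - (2 * r - e) = e" using e by auto
    show "of_nat (3 * r - 1 choose (2 * r - e)) * (- ((-1) ^ (2 * r - e) * (1 / of_nat (2 * r - (2 * r - e))))) =
      1 / 3 * ((-1)^(e+1) * of_nat (3 * r choose (2 * r - e)) / of_nat e) +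
        1 / of_nat (3 * r) * ((-1)^(e+1) * of_nat (3 * r choose (2 * r - e)) :: rat)"
      unfolding s c e0(2) using r0 e0(1) by (simp add: field_simps)
  qed
  also have "\<dots> = 1 / 3 * (\<Sum>e=1..2*r. (-1)^(e+1) * of_nat (3 * r choose (2 * r - e)) / of_nat e) +
      1 / of_nat (3 * r) * (\<Sum>e=1..2*r. (-1)^(e+1) * of_nat (3 * r choose (2 * r - e)))"
    by (simp only: sum.distrib sum_distrib_left)
  also have "(\<Sum>e=1..2*r. (-1)^(e+1) * of_nat (3 * r choose (2 * r - e)) / of_nat e) =
      of_nat (3 * r choose (2 * r)) * (harmonic (3 * r) - harmonic (3 * r - 2 * r))"
    by (rule alternating_binomial_harmonic) simp
  also have "of_nat (3 * r choose (2 * r)) = B"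
    using binomial_symmetric[of r "3 * r"] by (simp add: B_def)
  also have "3 * r - 2 * r = r" by simp
  also have "(\<Sum>e=1..2*r. (-1)^(e+1) * of_nat (3 * r choose (2 * r - e))) = (of_nat (3 * r - 1 choose (2 * r - 1)) :: rat)"
    using alternating_binomial_partial_sum[where n = "2 * r - 1" and N = "3 * r - 1"] r_pos by simp
  finally show ?thesis .
qed

text \<open>With w = 2r + e - 1, absorption gives C(3r-1,w) = (2r+e)/(3r) C(3r,r-e), so the harmonic
  part now has weight 2/3.\<close>

lemma quotient_sum_high:
  "(\<Sum>w\<in>{2*r..<3*r}. of_nat (3 * r - 1 choose w) * ((-1) ^ w * (1 / of_nat (w + 1 - 2 * r)))) =
   2 / 3 * (B * (harmonic (3 * r) - harmonic (2 * r))) + 1 / of_nat (3 * r) * of_nat (3 * r - 1 choose (r - 1))"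
proof -
  have r0: "of_nat r \<noteq> (0 :: rat)" using r_pos by simp
  have b1: "bij_betw (\<lambda>e. 2*r + e - 1) {1..r} {2*r..<3*r}"
    by (rule bij_betwI[of _ _ _ "\<lambda>i. i + 1 - 2*r"]) auto
  have "(\<Sum>w\<in>{2*r..<3*r}. of_nat (3 * r - 1 choose w) * ((-1) ^ w * (1 / of_nat (w + 1 - 2 * r)))) =
     (\<Sum>e=1..r. 2 / 3 * ((-1)^(e+1) * of_nat (3 * r choose (r - e)) / of_nat e) +
        1 / of_nat (3 * r) * ((-1)^(e+1) * of_nat (3 * r choose (r - e))) :: rat)"
    unfolding sum.reindex_bij_betw[OF b1, symmetric]
  proof (intro sum.cong refl)
    fix e assume e: "e \<in> {1..r}"
    then obtain d where d: "e = Suc d" by (cases e) auto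
    have "(2 * r + e) * (3 * r choose (2 * r + e)) = 3 * r * (3 * r - 1 choose (2 * r + e - 1))"
      using binomial_absorption[of "2 * r + d" "3 * r"] d by simp
    moreover have "3 * r choose (2 * r + e) = 3 * r choose (r - e)"
      using binomial_symmetric[of "2 * r + e" "3 * r"] e by simp
    ultimately have "of_nat (2 * r + e) * of_nat (3 * r choose (r - e)) = of_nat (3 * r) * (of_nat (3 * r - 1 choose (2 * r + e - 1)) :: rat)"
      by (simp only: of_nat_mult[symmetric])
    then have c: "of_nat (3 * r - 1 choose (2 * r + e - 1)) = (2 * of_nat r + of_nat e) * of_nat (3 * r choose (r - e)) / (3 * of_nat r :: rat)"
      using r0 by (simp add: field_simps)
    have s: "(-1) ^ (2 * r + e - 1) = ((-1) ^ (e + 1) :: rat)" using e by (auto simp: minus_one_power_iff)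
    have e0: "of_nat e \<noteq> (0 :: rat)" "2 * r + e - 1 + 1 - 2 * r = e" using e by auto
    show "of_nat (3 * r - 1 choose (2 * r + e - 1)) * ((-1) ^ (2 * r + e - 1) * (1 / of_nat (2 * r + e - 1 + 1 - 2 * r))) =
      2 / 3 * ((-1)^(e+1) * of_nat (3 * r choose (r - e)) / of_nat e) +
        1 / of_nat (3 * r) * ((-1)^(e+1) * of_nat (3 * r choose (r - e)) :: rat)"
      unfolding s c e0(2) using r0 e0(1) by (simp add: field_simps)
  qed
  also have "\<dots> = 2 / 3 * (\<Sum>e=1..r. (-1)^(e+1) * of_nat (3 * r choose (r - e)) / of_nat e) +
      1 / of_nat (3 * r) * (\<Sum>e=1..r. (-1)^(e+1) * of_nat (3 * r choose (r - e)))"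
    by (simp only: sum.distrib sum_distrib_left)
  also have "(\<Sum>e=1..r. (-1)^(e+1) * of_nat (3 * r choose (r - e)) / of_nat e) =
      of_nat (3 * r choose r) * (harmonic (3 * r) - harmonic (3 * r - r))"
    by (rule alternating_binomial_harmonic) simp
  also have "of_nat (3 * r choose r) = B"
    by (simp add: B_def)
  also have "3 * r - r = 2 * r" by simp
  also have "(\<Sum>e=1..r. (-1)^(e+1) * of_nat (3 * r choose (r - e))) = (of_nat (3 * r - 1 choose (r - 1)) :: rat)"
    using alternating_binomial_partial_sum[where n = "r - 1" and N = "3 * r - 1"] r_pos by simp
  finally show ?thesis .
qed

lemma quotient_sum_middle:
  "(\<Sum>w<3*r. of_nat (3 * r - 1 choose w) * ((-1) ^ w * (1 / of_nat (w + 1)))) = (1 / of_nat (3 * r) :: rat)"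
proof -
  have "{..<3*r} = {..3*r-1}" using r_pos by auto
  then have "(\<Sum>w<3*r. of_nat (3 * r - 1 choose w) * ((-1) ^ w * (1 / of_nat (w + 1)))) =
    (\<Sum>w\<le>3*r-1. (-1)^w * of_nat (3 * r - 1 choose w) / (1 + of_nat w) :: rat)"
    by (intro sum.cong) (auto simp: mult_ac add_ac)
  also have "\<dots> = fact (3 * r - 1) / (\<Prod>w\<le>3*r-1. 1 + of_nat w)"
    by (rule alternating_binomial_partial_fraction) (metis of_nat_Suc of_nat_neq_0)
  also have "(\<Prod>w\<le>3*r-1. 1 + of_nat w :: rat) = fact (Suc (3 * r - 1))"
  proof -
    have "(\<Prod>w\<le>k. 1 + of_nat w :: rat) = fact (Suc k)" for k
      by (induction k) (simp_all add: algebra_simps)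
    then show ?thesis .
  qed
  also have "fact (3 * r - 1) / fact (Suc (3 * r - 1)) = (1 / of_nat (3 * r) :: rat)"
  proof -
    have "Suc (3 * r - 1) = 3 * r" using r_pos by simp
    then show ?thesis unfolding fact_Suc by simp
  qed
  finally show ?thesis .
qed

text \<open>The partial fraction identity at x = -4r; since w stays below 3r, no denominator
  vanishes.\<close>

lemma central_part_eq: "central_part = (-1) ^ r * (fact (3 * r - 1) * fact r / fact (4 * r))"
proof -
  have "{..<3*r} = {..3*r-1}" using r_pos by auto
  then have "central_part = (\<Sum>w\<le>3*r-1. (-1)^w * of_nat (3 * r - 1 choose w) / (- of_nat (4 * r) + of_nat w))"
    unfolding central_part_def
  proof (intro sum.cong)
    fix w assume "w \<in> {..3*r-1}"
    then have e: "(- of_nat (4 * r) + of_nat w :: rat) = - of_nat (4 * r - w)"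
      by (simp add: of_nat_diff)
    show "of_nat (3 * r - 1 choose w) * (- ((-1) ^ w * (1 / of_nat (4 * r - w)))) =
      (-1)^w * of_nat (3 * r - 1 choose w) / (- of_nat (4 * r) + of_nat w :: rat)"
      unfolding e by simp
  qed
  also have "\<dots> = fact (3 * r - 1) / (\<Prod>w\<le>3*r-1. - of_nat (4 * r) + of_nat w)"
  proof (rule alternating_binomial_partial_fraction)
    fix i assume "i \<le> 3 * r - 1"
    then have "(- of_nat (4 * r) + of_nat i :: rat) = - of_nat (4 * r - i)" "4 * r - i \<noteq> 0"
      using r_pos by (simp_all add: of_nat_diff)
    then show "(- of_nat (4 * r) + of_nat i :: rat) \<noteq> 0"
      by (simp only: neg_equal_0_iff_equal of_nat_eq_0_iff not_False_eq_True)
  qed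
  also have "(\<Prod>w\<le>3*r-1. - of_nat (4 * r) + of_nat w :: rat) = (-1) ^ (3 * r) * (fact (4 * r) / fact r)"
  proof -
    have "(\<Prod>w<k. - of_nat (4 * r) + of_nat w) * fact (4 * r - k) = (-1) ^ k * (fact (4 * r) :: rat)" if "k \<le> 4 * r" for k
      using that
    proof (induction k)
      case (Suc k)
      then have k: "4 * r - k = Suc (4 * r - Suc k)" by auto
      have "fact (4 * r - k) = of_nat (4 * r - k) * (fact (4 * r - Suc k) :: rat)"
        unfolding k fact_Suc by simp
      moreover have "of_nat (4 * r - k) = (of_nat (4 * r) - of_nat k :: rat)"
        using Suc.prems by (simp add: of_nat_diff)
      ultimately have f: "fact (4 * r - k) = (of_nat (4 * r) - of_nat k) * (fact (4 * r - Suc k) :: rat)"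
        by simp
      have "(\<Prod>w<Suc k. - of_nat (4 * r) + of_nat w) * fact (4 * r - Suc k) =
        - ((\<Prod>w<k. - of_nat (4 * r) + of_nat w) * (fact (4 * r - k) :: rat))"
        unfolding f by (simp add: algebra_simps)
      also have "\<dots> = - ((-1) ^ k * fact (4 * r))"
        using Suc by simp
      finally show ?case by simp
    qed simp
    from this[of "3 * r"] show ?thesis
      unfolding \<open>{..<3*r} = {..3*r-1}\<close>[symmetric] by (simp add: field_simps)
  qed
  also have "(-1) ^ (3 * r) = ((-1) ^ r :: rat)" by (simp add: minus_one_power_iff)
  finally show ?thesis
    by (cases "even r") auto
qed

lemma zunit_3r: "zunit (of_nat (3 * r))"
  using r_pos p_6r by (intro zunit_less) auto

text \<open>Because 2 * 3r = p - 1, the number 3r is -1/2 modulo p.\<close>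

lemma inverse_3r: "cg 1 (1 / of_nat (3 * r)) (- 2)"
proof (rule cg_divideI[OF zunit_3r])
  have "cg 1 (of_nat (3 * r) * - 2 + q * 1) (of_nat (3 * r) * - 2 + 0)"
    by (intro cg_add cg_refl cg_p_0 zp_1)
  moreover have "of_nat (3 * r) * - 2 + q * 1 = 1" unfolding p_6r by simp
  ultimately show "cg 1 1 (of_nat (3 * r) * - 2)" by simp
qed

lemma central_part_zp: "central_part \<in> zp"
  unfolding central_part_eq using p_6r r_pos by (intro zp_mult zp_power zp_minus zp_1 zp_divide zunit_fact zunitD(1)) auto

text \<open>In factorials the product is 1/(3r) times (-1)^r C(6r,2r) / C(6r,3r). With signs both
  binomial coefficients are 1 modulo p, since 6r = p - 1, which leaves 1/(3r).\<close>

lemma B_central_part: "cg 1 (B * central_part) (- 2)"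
proof -
  define c2 where "c2 = (-1)^(2*r) * (of_nat (p - 1 choose (2*r)) :: rat)"
  define c3 where "c3 = (-1)^(3*r) * (of_nat (p - 1 choose (3*r)) :: rat)"
  have e: "p - 1 = 6 * r" "6 * r - 3 * r = 3 * r" "6 * r - 2 * r = 4 * r" using p_6r by auto
  have c3: "c3 = (-1)^r * (fact (6*r) / (fact (3*r) * fact (3*r)))"
    unfolding c3_def e using binomial_fact[of "3*r" "6*r", where ?'a=rat] by (simp add: e minus_one_power_iff)
  have c2: "c2 = fact (6*r) / (fact (2*r) * fact (4*r))"
    unfolding c2_def e using binomial_fact[of "2*r" "6*r", where ?'a=rat] by (simp add: e)
  have z3: "zunit c3"
    unfolding c3 using p_6r by (intro zunit_mult zunit_divide zunit_power zunit_minus zunit_1 zunit_fact) auto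
  have "cg 1 c2 1" "cg 1 c3 1"
    unfolding c2_def c3_def using p_6r by (intro binomial_p_pred; simp)+
  then have "cg 1 (c2 / c3) 1"
    using z3 by (intro cg_divideI) (auto intro: cg_trans cg_sym)
  then have "cg 1 (1 / of_nat (3 * r) * (c2 / c3)) (- 2 * 1)"
    using inverse_3r by (intro cg_mult_zp) auto
  moreover have "B * central_part = 1 / of_nat (3 * r) * (c2 / c3)"
  proof -
    have B: "B = fact (3 * r) / (fact r * fact (2 * r))"
      unfolding B_def using binomial_fact[of r "3 * r", where ?'a=rat] by simp
    have f: "fact (3 * r) = of_nat (3 * r) * (fact (3 * r - 1) :: rat)"
      using fact_reduce[of "3 * r", where ?'a=rat] r_pos by simp
    have nz: "of_nat (3 * r) \<noteq> (0 :: rat)" using r_pos by simp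
    show ?thesis
      unfolding B central_part_eq c2 c3 f using nz by (cases "even r") (simp_all del: of_nat_mult)
  qed
  ultimately show ?thesis by simp
qed

lemma quotient_sum_cong: "cg 1 (of_int quotient_sum) (central_part + 1 / of_nat (3 * r) + (B * h + 1 / of_nat (3 * r) * B))"
proof -
  define f :: "nat \<Rightarrow> rat" where "f w =
     (if w < 2 * r then - ((-1) ^ w * (1 / of_nat (2 * r - w))) else (-1) ^ w * (1 / of_nat (w + 1 - 2 * r)))" for w
  have "cg 1 (of_int quotient_sum) (\<Sum>w<3*r. of_nat (3 * r - 1 choose w) *
    (- ((-1) ^ w * (1 / of_nat (4 * r - w))) + ((-1) ^ w * (1 / of_nat (w + 1))) + f w))"
    unfolding quotient_sum_def of_int_sum of_int_mult of_int_of_nat_eq f_def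
    unfolding of_int_sum[symmetric]
    by (intro cg_sum cg_mult_left zp_of_nat inner_sum_cong) simp
  also have "(\<Sum>w<3*r. of_nat (3 * r - 1 choose w) *
    (- ((-1) ^ w * (1 / of_nat (4 * r - w))) + ((-1) ^ w * (1 / of_nat (w + 1))) + f w)) =
     central_part + 1 / of_nat (3 * r) + (\<Sum>w<3*r. of_nat (3 * r - 1 choose w) * f w)"
    unfolding central_part_def quotient_sum_middle[symmetric] by (simp only: distrib_left sum.distrib)
  also have "(\<Sum>w<3*r. of_nat (3 * r - 1 choose w) * f w) = B * h + 1 / of_nat (3 * r) * B"
  proof -
    have s: "{..<3*r} = {..<2*r} \<union> {2*r..<3*r}" "{..<2*r} \<inter> {2*r..<3*r} = {}" by auto
    have "(\<Sum>w<3*r. of_nat (3 * r - 1 choose w) * f w) =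
      (\<Sum>w<2*r. of_nat (3 * r - 1 choose w) * f w) + (\<Sum>w\<in>{2*r..<3*r}. of_nat (3 * r - 1 choose w) * f w)"
      unfolding s(1) by (rule sum.union_disjoint) (use s(2) in auto)
    also have "(\<Sum>w<2*r. of_nat (3 * r - 1 choose w) * f w) =
       1 / 3 * (B * (harmonic (3 * r) - harmonic r)) + 1 / of_nat (3 * r) * of_nat (3 * r - 1 choose (2 * r - 1))"
      unfolding quotient_sum_low[symmetric] by (intro sum.cong) (auto simp: f_def)
    also have "(\<Sum>w\<in>{2*r..<3*r}. of_nat (3 * r - 1 choose w) * f w) =
       2 / 3 * (B * (harmonic (3 * r) - harmonic (2 * r))) + 1 / of_nat (3 * r) * of_nat (3 * r - 1 choose (r - 1))"
      unfolding quotient_sum_high[symmetric] by (intro sum.cong) (auto simp: f_def)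
    \<comment> \<open>The remainders of the low and the high sum are C(3r-1,r) and C(3r-1,r-1),
      which add up to B by Pascal's rule.\<close>
    also have "of_nat (3 * r - 1 choose (2 * r - 1)) = B - of_nat (3 * r - 1 choose (r - 1))"
    proof -
      have "3 * r - 1 - (2 * r - 1) = r" using r_pos by simp
      then have "3 * r - 1 choose (2 * r - 1) = 3 * r - 1 choose r"
        using binomial_symmetric[of "2 * r - 1" "3 * r - 1"] r_pos by simp
      moreover have "3 * r choose r = (3 * r - 1 choose (r - 1)) + (3 * r - 1 choose r)"
        using r_pos by (intro choose_reduce_nat) auto
      ultimately show ?thesis by (simp add: B_def)
    qed
    finally show ?thesis by (simp add: h_def algebra_simps)
  qed
  finally show ?thesis .
qed

lemma B_h_zp: "B \<in> zp" "h \<in> zp"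
proof -
  have "harmonic r \<in> zp" "harmonic (2 * r) \<in> zp" "harmonic (3 * r) \<in> zp"
    by (rule harmonic_zp, use p_6r in linarith)+
  then show "h \<in> zp" unfolding h_def by (intro zp_diff zp_divide zunit_3 zp_mult zp_numeral)
qed (simp add: B_def)

lemma cubic_sum_cong_rat: "cg 2 (of_int cubic_sum) (- B + q * ((B * h + central_part) / 2))"
proof -
  have "cg 2 (of_int cubic_sum) (of_int (int p + (int p - 1) * int (3 * r choose r) - int (3 * r) * int p * quotient_sum))"
    using cubic_sum_cong_int by (intro cg_of_int) 
  also have "of_int (int p + (int p - 1) * int (3 * r choose r) - int (3 * r) * int p * quotient_sum) =
     - B + q * (1 + B - of_nat (3 * r) * of_int quotient_sum)"
    by (simp add: B_def algebra_simps)
  also have "cg 2 \<dots> (- B + q * ((B * h + central_part) / 2))"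
  proof (intro cg_add cg_refl cg_p_mult)
    have nz: "of_nat (3 * r) \<noteq> (0 :: rat)" using r_pos by simp
    have "cg 1 (1 + B - of_nat (3 * r) * of_int quotient_sum)
      (1 + B - of_nat (3 * r) * (central_part + 1 / of_nat (3 * r) + (B * h + 1 / of_nat (3 * r) * B)))"
      by (intro cg_diff cg_refl cg_mult_left quotient_sum_cong zp_of_nat)
    \<comment> \<open>The two terms with 1/(3r) cancel the summands 1 and B, and then -3r is 1/2
      modulo p.\<close>
    also have "1 + B - of_nat (3 * r) * (central_part + 1 / of_nat (3 * r) + (B * h + 1 / of_nat (3 * r) * B)) =
       - of_nat (3 * r) * (B * h + central_part)"
      using nz by (simp add: distrib_left del: of_nat_mult)
    also have "cg 1 \<dots> (1 / 2 * (B * h + central_part))"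
    proof (intro cg_mult_right)
      show "cg 1 (- of_nat (3 * r)) (1 / 2)"
      proof (rule cg_sym, rule cg_divideI[OF zunit_2])
        have "cg 1 (2 * - of_nat (3 * r) + q * 1) (2 * - of_nat (3 * r) + 0)"
          by (intro cg_add cg_refl cg_p_0 zp_1)
        moreover have "2 * - of_nat (3 * r) + q * 1 = 1" unfolding p_6r by simp
        ultimately show "cg 1 1 (2 * - of_nat (3 * r))" by simp
      qed
      show "B * h + central_part \<in> zp" using B_h_zp central_part_zp by auto
    qed
    finally show "cg 1 (1 + B - of_nat (3 * r) * of_int quotient_sum) ((B * h + central_part) / 2)" by simp
  qed
  finally show ?thesis .
qed

lemma reduced_sum_cong_cubic_sum: "cg 2 reduced_sum (of_int cubic_sum ^ 2 - 2 * q)"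
proof -
  define Z where "Z = (B * h + central_part) / 2"
  have Z: "Z \<in> zp" unfolding Z_def using B_h_zp central_part_zp by (intro zp_divide zunit_2) auto
  have "cg 2 (of_int cubic_sum ^ 2) ((- B + q * Z) ^ 2)"
    using cubic_sum_cong_rat B_h_zp Z unfolding Z_def[symmetric] by (intro cg_power) auto
  also have "(- B + q * Z) ^ 2 = B\<^sup>2 + q * (- (B * B * h) - B * central_part) + q * q * (Z * Z)"
    by (simp add: Z_def power2_eq_square field_simps)
  also have "cg 2 \<dots> (B\<^sup>2 + q * (- (B * B * h) - (- 2)) + 0)"
    by (intro cg_add cg_refl cg_p_mult cg_diff B_central_part cg_p2_0 zp_mult Z)
  also have "B\<^sup>2 + q * (- (B * B * h) - (- 2)) + 0 = B\<^sup>2 * (1 - q * h) + 2 * q"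
    by (simp add: power2_eq_square algebra_simps)
  finally have "cg 2 (of_int cubic_sum ^ 2 - 2 * q) (B\<^sup>2 * (1 - q * h) + 2 * q - 2 * q)"
    by (intro cg_diff cg_refl)
  then have "cg 2 (of_int cubic_sum ^ 2 - 2 * q) (B\<^sup>2 * (1 - q * h))" by simp
  then show ?thesis
    by (intro cg_trans[OF reduced_sum_cong cg_sym])
qed

end

section \<open>The cubic character sum\<close>

context large_prime
begin

definition chi :: "int \<Rightarrow> int" where
  "chi n = Legendre n (int p)"

lemma chi_cases: "chi n = -1 \<or> chi n = 0 \<or> chi n = 1"
  by (auto simp: chi_def Legendre_def)

lemma chi_eq_0_iff: "chi n = 0 \<longleftrightarrow> int p dvd n"
  by (simp add: chi_def Legendre_def cong_0_iff)

lemma chi_euler: "[chi n = n ^ m] (mod int p)"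
  using euler_criterion[OF prime_p, of n] p_gt_3 by (simp add: chi_def m_def)

text \<open>With values in {-1, 0, 1} and p > 3, congruence is equality. Periodicity and
  multiplicativity of \<open>chi\<close> thus descend from Euler's criterion.\<close>

lemma small_cong_eq:
  assumes "[a = b] (mod int p)" "\<bar>a\<bar> \<le> 1" "\<bar>b\<bar> \<le> 1"
  shows "a = b"
proof (rule ccontr)
  assume "a \<noteq> b"
  then have "\<bar>int p\<bar> \<le> \<bar>a - b\<bar>"
    using assms(1) by (intro dvd_imp_le_int) (auto simp: cong_iff_dvd_diff)
  then show False using assms p_gt_3 by linarith
qed

lemma chi_abs: "\<bar>chi n\<bar> \<le> 1"
  using chi_cases[of n] by auto

lemma chi_cong: "[a = b] (mod int p) \<Longrightarrow> chi a = chi b"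
  by (rule small_cong_eq[OF _ chi_abs chi_abs])
    (meson chi_euler cong_pow cong_sym cong_trans)

lemma chi_mult: "chi (a * b) = chi a * chi b"
proof (rule small_cong_eq[OF _ chi_abs])
  have "[chi a * chi b = a ^ m * b ^ m] (mod int p)"
    by (intro cong_mult chi_euler)
  then show "[chi (a * b) = chi a * chi b] (mod int p)"
    using chi_euler[of "a * b"] by (metis cong_sym cong_trans power_mult_distrib)
  show "\<bar>chi a * chi b\<bar> \<le> 1"
    using chi_cases[of a] chi_cases[of b] by auto
qed

lemma chi_square: "\<not> int p dvd a \<Longrightarrow> chi a * chi a = 1"
  using chi_cases[of a] chi_eq_0_iff[of a] by auto

lemma chi_cube: "chi (a ^ 3) = chi a"
  using chi_cases[of a] by (auto simp: power3_eq_cube chi_mult)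

definition periodic :: "(int \<Rightarrow> int) \<Rightarrow> bool" where
  "periodic f \<longleftrightarrow> (\<forall>x y. [x = y] (mod int p) \<longrightarrow> f x = f y)"

lemma periodicD: "periodic f \<Longrightarrow> [x = y] (mod int p) \<Longrightarrow> f x = f y"
  by (simp add: periodic_def)

text \<open>A map injective on residue classes permutes them, since there are only finitely
  many.\<close>

lemma sum_periodic_reindex:
  assumes f: "periodic f" and g: "\<And>x y. [g x = g y] (mod int p) \<Longrightarrow> [x = y] (mod int p)"
  shows "(\<Sum>a<p. f (g (int a))) = (\<Sum>a<p. f (int a))"
proof -
  define G where "G a = nat (g (int a) mod int p)" for a
  have p0: "int p > 0" using p_gt_3 by simp
  have intG: "int (G a) = g (int a) mod int p" for a
    using p0 by (simp add: G_def)
  have inj: "inj_on G {..<p}"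
  proof (rule inj_onI)
    fix a b assume ab: "a \<in> {..<p}" "b \<in> {..<p}" "G a = G b"
    then have "g (int a) mod int p = g (int b) mod int p" using intG by metis
    then have "[g (int a) = g (int b)] (mod int p)" by (simp add: cong_def)
    then have "[int a = int b] (mod int p)" by (rule g)
    then show "a = b" using ab by (simp add: cong_def)
  qed
  moreover have "G ` {..<p} \<subseteq> {..<p}"
    using p0 by (auto simp: G_def nat_less_iff)
  ultimately have "G ` {..<p} = {..<p}"
    by (intro endo_inj_surj) auto
  then have "bij_betw G {..<p} {..<p}" using inj by (simp add: bij_betw_def)
  then have "(\<Sum>a<p. f (int a)) = (\<Sum>a<p. f (int (G a)))"
    by (rule sum.reindex_bij_betw[symmetric])
  also have "\<dots> = (\<Sum>a<p. f (g (int a)))"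
    by (intro sum.cong refl periodicD[OF f]) (simp add: intG cong_def)
  finally show ?thesis by simp
qed

lemma sum_periodic_shift: "periodic f \<Longrightarrow> (\<Sum>a<p. f (int a + c)) = (\<Sum>a<p. f (int a))"
  by (rule sum_periodic_reindex) (auto simp: cong_iff_dvd_diff)

lemma sum_periodic_scale:
  assumes "periodic f" "\<not> int p dvd c"
  shows "(\<Sum>a<p. f (c * int a)) = (\<Sum>a<p. f (int a))"
proof (rule sum_periodic_reindex[OF assms(1)])
  fix x y assume "[c * x = c * y] (mod int p)"
  then have "int p dvd c * (x - y)" by (simp add: cong_iff_dvd_diff right_diff_distrib)
  then show "[x = y] (mod int p)"
    using assms(2) prime_int_p by (simp add: prime_dvd_mult_iff cong_iff_dvd_diff)
qed

definition delta :: "int \<Rightarrow> int" where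
  "delta x = (if int p dvd x then 1 else 0)"

lemma dvd_cong_iff: "[x = y] (mod int p) \<Longrightarrow> int p dvd x \<longleftrightarrow> int p dvd y"
  by (meson cong_dvd_iff cong_0_iff cong_sym cong_trans)

lemma periodic_delta: "periodic delta"
  by (auto simp: periodic_def delta_def dvd_cong_iff)

lemma sum_delta: "(\<Sum>a<p. delta (int a - t)) = 1"
proof -
  have "(\<Sum>a<p. delta (int a - t)) = (\<Sum>a<p. delta (int a))"
    using sum_periodic_shift[OF periodic_delta, of "- t"] by simp
  also have "\<dots> = (\<Sum>a\<in>{0}. delta (int a))"
    using p_gt_3 by (intro sum.mono_neutral_right) (auto simp: delta_def dest: dvd_imp_le)
  finally show ?thesis by (simp add: delta_def)
qed

lemma generator:
  obtains g :: int where "[g ^ (p - 1) = 1] (mod int p)" "\<And>n. [g ^ n = 1] (mod int p) \<Longrightarrow> (p - 1) dvd n"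
    "\<And>f. periodic f \<Longrightarrow> (\<Sum>a<p. f (int a)) = f 0 + (\<Sum>i<p-1. f (g ^ i))" "\<not> int p dvd g"
proof -
  have p1: "p > 1" using p_gt_3 by simp
  obtain g where g: "residue_primroot p g" using prime_primitive_root_exists[OF p1 prime_p] by blast
  then have gp: "coprime p g" "ord p g = p - 1"
    using prime_p by (auto simp: residue_primroot_def totient_prime)
  have bij: "bij_betw (\<lambda>i. g ^ i mod p) {..<p-1} {1..p-1}"
  proof -
    have "totatives p = {1..p-1}" using prime_p by (auto simp: totatives_prime)
    then show ?thesis
      using residue_primroot_is_generator[OF p1 g] prime_p by (simp add: totient_prime)
  qed
  have ord: "[int g ^ n = 1] (mod int p) \<longleftrightarrow> (p - 1) dvd n" for n
  proof -
    have "[int g ^ n = 1] (mod int p) \<longleftrightarrow> [g ^ n = 1] (mod p)"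
      by (metis cong_int_iff of_nat_1 of_nat_power)
    then show ?thesis using gp(2) by (simp only: ord_divides)
  qed
  show ?thesis
  proof
    show "[int g ^ (p - 1) = 1] (mod int p)" by (simp only: ord dvd_refl)
    show "(p - 1) dvd n" if "[int g ^ n = 1] (mod int p)" for n using that ord by simp
    show "\<not> int p dvd int g"
      using gp(1) prime_p by (metis coprime_absorb_left int_dvd_int_iff not_prime_unit)
    show "(\<Sum>a<p. f (int a)) = f 0 + (\<Sum>i<p-1. f (int g ^ i))" if f: "periodic f" for f
    proof -
      have "(\<Sum>i<p-1. f (int g ^ i)) = (\<Sum>i<p-1. f (int (g ^ i mod p)))"
        by (intro sum.cong refl periodicD[OF f]) (simp add: cong_def zmod_int)
      also have "\<dots> = (\<Sum>a=1..p-1. f (int a))"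
        by (rule sum.reindex_bij_betw[OF bij])
      finally have 1: "(\<Sum>i<p-1. f (int g ^ i)) = (\<Sum>a=1..p-1. f (int a))" .
      have "{..<p} = insert 0 {1..p-1}" using p_gt_3 by auto
      then show ?thesis unfolding 1 by simp
    qed
  qed
qed

lemma periodic_chi: "periodic chi"
  by (simp add: periodic_def chi_cong)

text \<open>A primitive root g is a nonresidue, as its order does not divide m; scaling by g
  therefore negates the sum while permuting its terms.\<close>

lemma sum_chi: "(\<Sum>a<p. chi (int a)) = 0"
proof -
  obtain g :: int where g: "\<And>n. [g ^ n = 1] (mod int p) \<Longrightarrow> (p - 1) dvd n" "\<not> int p dvd g"
    using generator by metis
  have "chi g \<noteq> 1"
  proof
    assume "chi g = 1"
    then have "[g ^ m = 1] (mod int p)" using chi_euler[of g] by (simp add: cong_sym)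
    then have "p - 1 dvd m" by (rule g)
    then show False using p_eq p_gt_3 by (auto dest: dvd_imp_le)
  qed
  then have "chi g = -1" using chi_cases[of g] chi_eq_0_iff[of g] g(2) by auto
  then have "(\<Sum>a<p. chi (g * int a)) = - (\<Sum>a<p. chi (int a))"
    by (simp add: chi_mult sum_negf)
  then show ?thesis
    using sum_periodic_scale[OF periodic_chi g(2)] by simp
qed

lemma sum_chi_shift: "(\<Sum>a<p. chi (int a + c)) = 0"
  using sum_periodic_shift[OF periodic_chi] sum_chi by simp

lemma periodic_chi_shift: "periodic (\<lambda>c. chi (c + a) * chi (c + b))"
  unfolding periodic_def by (metis chi_cong cong_add_rcancel)

text \<open>For b prime to p, replacing c by b c removes b, so the correlation takes one value on
  all such b. Since the correlations over all b add up to 0, the value p - 1 at b = 0 forces that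
  common value to be -1.\<close>

lemma sum_chi_chi: "(\<Sum>c<p. chi (int c) * chi (int c + b)) = int p * delta b - 1"
proof -
  define J where "J b = (\<Sum>c<p. chi (int c) * chi (int c + b))" for b
  have J0: "J b = int p - 1" if "int p dvd b" for b
  proof -
    have "J b = (\<Sum>c<p. 1 - delta (int c))"
      unfolding J_def
    proof (intro sum.cong refl)
      fix c
      have "chi (int c + b) = chi (int c)" using that by (intro chi_cong) (simp add: cong_iff_dvd_diff)
      then show "chi (int c) * chi (int c + b) = 1 - delta (int c)"
        using chi_square[of "int c"] chi_eq_0_iff[of "int c"] by (auto simp: delta_def)
    qed
    also have "\<dots> = int p - 1" using sum_delta[of 0] by (simp add: sum_subtractf)
    finally show ?thesis .
  qed
  have J1: "J b = J 1" if "\<not> int p dvd b" for b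
  proof -
    have "J b = (\<Sum>c<p. chi (b * int c) * chi (b * int c + b))"
      unfolding J_def
      using sum_periodic_scale[OF periodic_chi_shift[of 0 b] that] by simp
    also have "\<dots> = (\<Sum>c<p. chi (int c) * chi (int c + 1))"
    proof (intro sum.cong refl)
      fix c
      have "b * int c + b = b * (int c + 1)" by (simp add: algebra_simps)
      then have "chi (b * int c) * chi (b * int c + b) = (chi b * chi b) * (chi (int c) * chi (int c + 1))"
        by (simp only: chi_mult) (simp add: mult_ac)
      then show "chi (b * int c) * chi (b * int c + b) = chi (int c) * chi (int c + 1)"
        using chi_square[OF that] by simp
    qed
    finally show ?thesis by (simp add: J_def)
  qed
  have "(\<Sum>b<p. J (int b)) = (\<Sum>c<p. chi (int c) * (\<Sum>b<p. chi (int b + int c)))"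
    unfolding J_def sum_distrib_left by (subst sum.swap) (simp add: add.commute)
  also have "\<dots> = 0" by (simp add: sum_chi_shift)
  also have "(\<Sum>b<p. J (int b)) = (\<Sum>b<p. J 1 + (int p - 1 - J 1) * delta (int b))"
    using J0 J1 by (intro sum.cong refl) (auto simp: delta_def)
  also have "\<dots> = int p * J 1 + (int p - 1 - J 1)"
    using sum_delta[of 0] by (simp add: sum.distrib sum_distrib_left[symmetric])
  finally have "(int p - 1) * (J 1 + 1) = 0" by (simp add: algebra_simps)
  then have "J 1 = -1" using p_gt_3 by simp
  then show ?thesis using J0[of b] J1[of b] unfolding J_def delta_def by auto
qed

text \<open>For c prime to p this is minus the trace of Frobenius of the curve y^2 = x^3 + c over
  the field with p elements.\<close>

definition twisted_sum :: "int \<Rightarrow> int" where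
  "twisted_sum c = (\<Sum>a<p. chi (int a ^ 3 + c))"

lemma twisted_sum_1: "twisted_sum 1 = cubic_sum"
  by (simp add: twisted_sum_def cubic_sum_def chi_def)

lemma periodic_twisted_sum: "periodic twisted_sum"
  unfolding periodic_def twisted_sum_def by (auto intro!: sum.cong chi_cong cong_add cong_refl)

lemma twisted_sum_0: "twisted_sum 0 = 0"
  by (simp add: twisted_sum_def chi_cube sum_chi)

lemma twisted_sum_scale:
  assumes "\<not> int p dvd d"
  shows "twisted_sum (c * d ^ 3) = chi d * twisted_sum c"
proof -
  have "periodic (\<lambda>a. chi (a ^ 3 + c * d ^ 3))"
    unfolding periodic_def by (auto intro!: chi_cong cong_add cong_pow cong_refl)
  from sum_periodic_scale[OF this assms]
  have "twisted_sum (c * d ^ 3) = (\<Sum>a<p. chi (d ^ 3 * (int a ^ 3 + c)))"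
    unfolding twisted_sum_def by (simp add: algebra_simps power_mult_distrib)
  then show ?thesis
    by (simp add: chi_mult chi_cube twisted_sum_def sum_distrib_left)
qed

lemma sum_chi_twisted_sum: "(\<Sum>c<p. chi (int c) * twisted_sum (int c)) = 0"
proof -
  have "(\<Sum>c<p. chi (int c) * twisted_sum (int c)) = (\<Sum>a<p. \<Sum>c<p. chi (int c) * chi (int c + int a ^ 3))"
    unfolding twisted_sum_def sum_distrib_left by (subst sum.swap) (simp add: add.commute)
  also have "\<dots> = (\<Sum>a<p. int p * delta (int a) - 1)"
    unfolding sum_chi_chi using prime_int_p by (simp add: delta_def prime_dvd_power_iff)
  also have "\<dots> = 0" using sum_delta[of 0] by (simp add: sum_subtractf sum_distrib_left[symmetric])
  finally show ?thesis .
qed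

text \<open>Expanding the square and summing over c first leaves correlations of \<open>chi\<close>
  with shift b^3 - a^3, so the second moment counts pairs with equal cubes.\<close>

lemma sum_twisted_sum_square: "(\<Sum>c<p. twisted_sum (int c) ^ 2) = int p * (\<Sum>a<p. \<Sum>b<p. delta (int b ^ 3 - int a ^ 3)) - int p ^ 2"
proof -
  have "(\<Sum>c<p. twisted_sum (int c) ^ 2) = (\<Sum>c<p. \<Sum>a<p. \<Sum>b<p. chi (int c + int a ^ 3) * chi (int c + int b ^ 3))"
    unfolding twisted_sum_def power2_eq_square sum_product by (simp add: add.commute)
  also have "\<dots> = (\<Sum>a<p. \<Sum>c<p. \<Sum>b<p. chi (int c + int a ^ 3) * chi (int c + int b ^ 3))"
    by (rule sum.swap)
  also have "\<dots> = (\<Sum>a<p. \<Sum>b<p. \<Sum>c<p. chi (int c + int a ^ 3) * chi (int c + int b ^ 3))"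
    by (intro sum.cong refl sum.swap)
  also have "\<dots> = (\<Sum>a<p. \<Sum>b<p. int p * delta (int b ^ 3 - int a ^ 3) - 1)"
  proof (intro sum.cong refl)
    fix a b :: nat
    have "(\<Sum>c<p. chi (int c + int a ^ 3) * chi (int c + int b ^ 3)) =
      (\<Sum>c<p. chi (int c + - (int a ^ 3) + int a ^ 3) * chi (int c + - (int a ^ 3) + int b ^ 3))"
      by (rule sum_periodic_shift[OF periodic_chi_shift, symmetric])
    then show "(\<Sum>c<p. chi (int c + int a ^ 3) * chi (int c + int b ^ 3)) = int p * delta (int b ^ 3 - int a ^ 3) - 1"
      using sum_chi_chi[of "int b ^ 3 - int a ^ 3"] by (simp add: algebra_simps)
  qed
  also have "\<dots> = int p * (\<Sum>a<p. \<Sum>b<p. delta (int b ^ 3 - int a ^ 3)) - int p ^ 2"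
    by (simp add: sum_subtractf sum_distrib_left power2_eq_square)
  finally show ?thesis .
qed

end

section \<open>Cubic classes and representations by x^2 + 3y^2\<close>

context prime_1_mod_6
begin

lemma count_cube_roots:
  assumes "\<not> int p dvd a"
  shows "(\<Sum>b<p. delta (int b ^ 3 - a ^ 3)) = 3"
proof -
  obtain g :: int where g: "[g ^ (p - 1) = 1] (mod int p)" "\<And>n. [g ^ n = 1] (mod int p) \<Longrightarrow> (p - 1) dvd n"
    using generator by metis
  define w where "w = g ^ (2 * r)"
  have w3: "int p dvd w ^ 3 - 1"
    using g(1) p_6r by (simp add: w_def power_mult[symmetric] cong_iff_dvd_diff mult.commute)
  have w1: "\<not> int p dvd w - 1"
  proof
    assume "int p dvd w - 1"
    then have "p - 1 dvd 2 * r" unfolding w_def cong_iff_dvd_diff[symmetric] by (rule g(2))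
    then show False using p_6r r_pos by (auto dest: dvd_imp_le)
  qed
  have "w ^ 3 - 1 = (w - 1) * (1 + w + w ^ 2)" by (simp add: algebra_simps power2_eq_square power3_eq_cube)
  then have s: "int p dvd 1 + w + w ^ 2"
    using w3 w1 prime_int_p by (metis prime_dvd_mult_iff)
  have w2: "\<not> int p dvd w + 1"
  proof
    assume "int p dvd w + 1"
    then have "int p dvd w * (w + 1)" by simp
    then have "int p dvd (1 + w + w ^ 2) - w * (w + 1)" using s by (rule dvd_diff[rotated])
    then have "int p dvd 1" by (simp add: algebra_simps power2_eq_square)
    then show False using prime_int_p not_prime_unit by blast
  qed
  have w0: "\<not> int p dvd w"
  proof
    assume "int p dvd w"
    then have "int p dvd w ^ 3" by (simp add: power3_eq_cube)
    then have "int p dvd w ^ 3 - (w ^ 3 - 1)" using w3 by (rule dvd_diff)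
    then show False using prime_int_p not_prime_unit by simp
  qed
  have "delta (b ^ 3 - a ^ 3) = delta (b - a) + delta (b - w * a) + delta (b - w ^ 2 * a)" for b
  proof -
    \<comment> \<open>The factorisation over a cube root of unity fails over the integers by a
      combination of 1 + w + w^2 and w^3 - 1, both divisible by p.\<close>
    have "(b - a) * ((b - w * a) * (b - w ^ 2 * a)) - (b ^ 3 - a ^ 3) =
      (1 + w + w ^ 2) * (- (a * b ^ 2) + w * a ^ 2 * b) - (w ^ 3 - 1) * a ^ 3"
      by (simp add: algebra_simps power2_eq_square power3_eq_cube)
    moreover have "int p dvd (1 + w + w ^ 2) * (- (a * b ^ 2) + w * a ^ 2 * b) - (w ^ 3 - 1) * a ^ 3"
      by (rule dvd_diff[OF dvd_mult2[OF s] dvd_mult2[OF w3]])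
    ultimately have "[(b - a) * ((b - w * a) * (b - w ^ 2 * a)) = b ^ 3 - a ^ 3] (mod int p)"
      by (simp add: cong_iff_dvd_diff)
    then have "int p dvd b ^ 3 - a ^ 3 \<longleftrightarrow> int p dvd (b - a) * ((b - w * a) * (b - w ^ 2 * a))"
      by (simp add: dvd_cong_iff)
    also have "\<dots> \<longleftrightarrow> int p dvd b - a \<or> int p dvd b - w * a \<or> int p dvd b - w ^ 2 * a"
      using prime_int_p by (simp add: prime_dvd_mult_iff)
    finally have iff: "int p dvd b ^ 3 - a ^ 3 \<longleftrightarrow> int p dvd b - a \<or> int p dvd b - w * a \<or> int p dvd b - w ^ 2 * a" .
    have d1: "\<not> (int p dvd b - a \<and> int p dvd b - w * a)"
    proof
      assume "int p dvd b - a \<and> int p dvd b - w * a"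
      then have "int p dvd (b - a) - (b - w * a)" by (elim conjE) (rule dvd_diff)
      then have "int p dvd (w - 1) * a" by (simp add: algebra_simps)
      then show False using w1 assms prime_int_p by (simp add: prime_dvd_mult_iff)
    qed
    have d2: "\<not> (int p dvd b - a \<and> int p dvd b - w ^ 2 * a)"
    proof
      assume "int p dvd b - a \<and> int p dvd b - w ^ 2 * a"
      then have "int p dvd (b - a) - (b - w ^ 2 * a)" by (elim conjE) (rule dvd_diff)
      then have "int p dvd (w - 1) * ((w + 1) * a)" by (simp add: algebra_simps power2_eq_square)
      then show False using w1 w2 assms prime_int_p by (simp add: prime_dvd_mult_iff)
    qed
    have d3: "\<not> (int p dvd b - w * a \<and> int p dvd b - w ^ 2 * a)"
    proof
      assume "int p dvd b - w * a \<and> int p dvd b - w ^ 2 * a"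
      then have "int p dvd (b - w * a) - (b - w ^ 2 * a)" by (elim conjE) (rule dvd_diff)
      then have "int p dvd w * ((w - 1) * a)" by (simp add: algebra_simps power2_eq_square)
      then show False using w1 w0 assms prime_int_p by (simp add: prime_dvd_mult_iff)
    qed
    show ?thesis unfolding delta_def iff using d1 d2 d3 by auto
  qed
  then show ?thesis by (simp add: sum.distrib sum_delta)
qed

lemma sum_count_cubes: "(\<Sum>a<p. \<Sum>b<p. delta (int b ^ 3 - int a ^ 3)) = 3 * int p - 2"
proof -
  have "(\<Sum>b<p. delta (int b ^ 3 - int a ^ 3)) = 3 - 2 * delta (int a)" if "a < p" for a
  proof (cases "a = 0")
    case True
    have "delta (int b ^ 3 - int a ^ 3) = delta (int b - 0)" for b
      using True prime_int_p by (simp add: delta_def prime_dvd_power_iff)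
    then show ?thesis using sum_delta[of 0] True by (simp add: delta_def)
  next
    case False
    then have "\<not> int p dvd int a" using that by (auto dest: dvd_imp_le)
    then show ?thesis using count_cube_roots by (simp add: delta_def)
  qed
  then have "(\<Sum>a<p. \<Sum>b<p. delta (int b ^ 3 - int a ^ 3)) = (\<Sum>a<p. 3 - 2 * delta (int a))"
    by (intro sum.cong) auto
  then show ?thesis
    using sum_delta[of 0] by (simp add: sum_subtractf sum_distrib_left[symmetric])
qed

text \<open>Modulo 2 each \<open>chi\<close> value is 1 except at zeros of a^3 + 1, and there are
  three of these because -1 = (-1)^3. So the sum has the parity of p - 3.\<close>

lemma even_cubic_sum: "even cubic_sum"
proof -
  have "even (chi x - 1 + delta x)" for x
    using chi_cases[of x] chi_eq_0_iff[of x] by (auto simp: delta_def)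
  then have "even (\<Sum>a<p. chi (int a ^ 3 + 1) - 1 + delta (int a ^ 3 + 1))"
    by (intro dvd_sum)
  also have "(\<Sum>a<p. chi (int a ^ 3 + 1) - 1 + delta (int a ^ 3 + 1)) =
      cubic_sum - int p + (\<Sum>a<p. delta (int a ^ 3 - (-1) ^ 3))"
    by (simp add: cubic_sum_def chi_def sum.distrib sum_subtractf)
  also have "(\<Sum>a<p. delta (int a ^ 3 - (-1) ^ 3)) = 3"
    using prime_int_p not_prime_unit by (intro count_cube_roots) auto
  finally have "even (cubic_sum - int p + 3)" .
  moreover have "odd (int p)" using p_6r by simp
  ultimately show ?thesis by presburger
qed

lemma cubic_sum_norm_form: "\<exists>d. cubic_sum ^ 2 + 3 * d ^ 2 = 4 * int p"
proof -
  obtain g :: int where sum_g: "\<And>f. periodic f \<Longrightarrow> (\<Sum>a<p. f (int a)) = f 0 + (\<Sum>i<p-1. f (g ^ i))"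
    and gp: "\<not> int p dvd g"
    using generator by metis
  \<comment> \<open>Multiplying c by d^3 changes both factors by \<open>chi d\<close>, and these
    signs cancel; hence \<open>U\<close> depends only on the cubic class of c.\<close>
  define U where "U c = chi c * twisted_sum c" for c
  have chi1: "chi 1 = 1"
    using chi_mult[of 1 1] chi_eq_0_iff[of 1] prime_int_p not_prime_unit by auto
  have gi: "\<not> int p dvd g ^ i" for i
    using gp prime_int_p by (meson prime_dvd_power)
  have per: "U (g ^ (i + 3)) = U (g ^ i)" for i
  proof -
    have "chi (g ^ (i + 3)) = chi (g ^ i) * chi g"
      unfolding power_add chi_mult chi_cube ..
    moreover have "twisted_sum (g ^ (i + 3)) = chi g * twisted_sum (g ^ i)"
      unfolding power_add by (rule twisted_sum_scale[OF gp])
    ultimately have "U (g ^ (i + 3)) = (chi g * chi g) * U (g ^ i)"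
      by (simp add: U_def mult_ac)
    then show ?thesis using chi_square[OF gp] by simp
  qed
  have per3: "U (g ^ (3 * k + j)) = U (g ^ j)" for k j
    using per[of "3 * k + j" for k] by (induction k) (simp_all add: algebra_simps)
  define A where "A = U (g ^ 0)"
  define A1 where "A1 = U (g ^ 1)"
  define A2 where "A2 = U (g ^ 2)"
  have grp: "(\<Sum>i<3*k. F (U (g ^ i))) = int k * (F A + F A1 + F A2)" for F :: "int \<Rightarrow> int" and k
  proof (induction k)
    case (Suc k)
    have "{..<3 * Suc k} = insert (3*k+2) (insert (3*k+1) (insert (3*k+0) {..<3*k}))" by auto
    then have "(\<Sum>i<3*Suc k. F (U (g ^ i))) =
      F (U (g ^ (3*k+2))) + (F (U (g ^ (3*k+1))) + (F (U (g ^ (3*k+0))) + (\<Sum>i<3*k. F (U (g ^ i)))))"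
      by simp
    then show ?case
      unfolding per3 Suc A_def A1_def A2_def by (simp add: algebra_simps)
  qed simp
  have p1: "p - 1 = 3 * (2 * r)" using p_6r by simp
  have "periodic U"
    using periodic_chi periodic_twisted_sum unfolding periodic_def U_def by metis
  then have "0 = (\<Sum>i<p-1. U (g ^ i))"
    using sum_g[of U] sum_chi_twisted_sum by (simp add: U_def twisted_sum_0)
  also have "\<dots> = int (2 * r) * (A + A1 + A2)"
    unfolding p1 using grp[of "\<lambda>x. x" "2 * r"] by simp
  finally have e1: "A + A1 + A2 = 0" using r_pos by simp
  have "periodic (\<lambda>c. twisted_sum c ^ 2)"
    using periodic_twisted_sum unfolding periodic_def by metis
  then have "(\<Sum>c<p. twisted_sum (int c) ^ 2) = (\<Sum>i<p-1. twisted_sum (g ^ i) ^ 2)"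
    using sum_g[of "\<lambda>c. twisted_sum c ^ 2"] by (simp add: twisted_sum_0)
  also have "\<dots> = (\<Sum>i<p-1. U (g ^ i) ^ 2)"
    using chi_square[OF gi] by (intro sum.cong refl) (simp add: U_def power_mult_distrib power2_eq_square)
  also have "\<dots> = int (2 * r) * (A ^ 2 + A1 ^ 2 + A2 ^ 2)"
    unfolding p1 using grp[of "\<lambda>x. x ^ 2" "2 * r"] by simp
  finally have "int (2 * r) * (A ^ 2 + A1 ^ 2 + A2 ^ 2) = int p * (3 * int p - 2) - int p ^ 2"
    using sum_twisted_sum_square sum_count_cubes by simp
  also have "\<dots> = int (2 * r) * (6 * int p)"
    unfolding p_6r by (simp add: algebra_simps power2_eq_square)
  finally have esq: "A ^ 2 + A1 ^ 2 + A2 ^ 2 = 6 * int p" using r_pos by simp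
  have A2: "A2 = - A - A1" using e1 by simp
  \<comment> \<open>Eliminating \<open>A2\<close> and completing the square. As 3 then divides 2 *
    A1 + A, one factor 3 can be divided out.\<close>
  have e3: "(2 * A1 + A) ^ 2 + 3 * A ^ 2 = 12 * int p"
    using esq unfolding A2 by (simp add: algebra_simps power2_eq_square)
  then have "(2 * A1 + A) ^ 2 = 3 * (4 * int p - A ^ 2)" by simp
  then have "3 dvd (2 * A1 + A) ^ 2" by (rule dvdI)
  then have "3 dvd 2 * A1 + A"
    using prime_dvd_power[of "3 :: int"] by (simp add: prime_int_numeral_eq)
  then obtain d where d: "2 * A1 + A = 3 * d" by blast
  have "A = cubic_sum" by (simp add: A_def U_def chi1 twisted_sum_1)
  have "(3 * d) ^ 2 + 3 * A ^ 2 = 12 * int p" using e3 unfolding d .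
  then have "cubic_sum ^ 2 + 3 * d ^ 2 = 4 * int p"
    unfolding \<open>A = cubic_sum\<close> by (simp add: power_mult_distrib)
  then show ?thesis by blast
qed

text \<open>With the sum equal to 2X and d = 2Y, the norm form reads p = X^2 + 3Y^2, so the claim is
  the uniqueness up to signs of such a representation.\<close>

lemma cubic_sum_square:
  fixes x y :: int
  assumes xy: "int p = x\<^sup>2 + 3 * y\<^sup>2"
  shows "cubic_sum\<^sup>2 = 4 * x\<^sup>2"
proof -
  obtain d where d: "cubic_sum ^ 2 + 3 * d ^ 2 = 4 * int p" using cubic_sum_norm_form by blast
  obtain X where X: "cubic_sum = 2 * X" using even_cubic_sum by blast
  have "3 * d ^ 2 = 2 * (2 * int p - 2 * X ^ 2)" using d unfolding X by (simp add: power_mult_distrib)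
  then have "even (3 * d ^ 2)" by (rule dvdI)
  then have "even d" by simp
  then obtain Y where Y: "d = 2 * Y" by blast
  have XY: "int p = X\<^sup>2 + 3 * Y\<^sup>2" using d unfolding X Y by (simp add: power_mult_distrib)
  have p0: "int p > 0" using p_gt_3 by simp
  have "(x * Y - X * y) * (x * Y + X * y) = int p * (Y\<^sup>2 - y\<^sup>2)"
  proof -
    have "(x * Y - X * y) * (x * Y + X * y) = x\<^sup>2 * Y\<^sup>2 - X\<^sup>2 * y\<^sup>2"
      by (simp add: algebra_simps power2_eq_square)
    also have "x\<^sup>2 = int p - 3 * y\<^sup>2" using xy by simp
    also have "X\<^sup>2 = int p - 3 * Y\<^sup>2" using XY by simp
    finally show ?thesis by (simp add: algebra_simps)
  qed
  then have "int p dvd (x * Y - X * y) * (x * Y + X * y)" by simp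
  then have "int p dvd x * Y - X * y \<or> int p dvd x * Y + X * y"
    using prime_int_p by (simp add: prime_dvd_mult_iff)
  \<comment> \<open>\<open>Z\<close> stands for Y or -Y. Brahmagupta's identity gives p^2 = (xX +
    3yZ)^2 + 3(xZ - Xy)^2, and a nonzero multiple of p in the last square would exceed the left
    side.\<close>
  moreover have vanish: "x * Z = X * y" if "int p dvd x * Z - X * y" "Z\<^sup>2 = Y\<^sup>2" for Z
  proof (rule ccontr)
    assume "x * Z \<noteq> X * y"
    then have "\<bar>int p\<bar> \<le> \<bar>x * Z - X * y\<bar>" using that(1) by (intro dvd_imp_le_int) auto
    then have "(int p)\<^sup>2 \<le> (x * Z - X * y)\<^sup>2" by (rule abs_le_square_iff[THEN iffD1])
    moreover have "(int p)\<^sup>2 = (x * X + 3 * y * Z)\<^sup>2 + 3 * (x * Z - X * y)\<^sup>2"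
    proof -
      have "(int p)\<^sup>2 = (x\<^sup>2 + 3 * y\<^sup>2) * (X\<^sup>2 + 3 * Z\<^sup>2)"
        using xy XY that(2) by (simp add: power2_eq_square)
      then show ?thesis by (simp add: algebra_simps power2_eq_square)
    qed
    moreover have "(x * X + 3 * y * Z)\<^sup>2 \<ge> 0" by simp
    moreover have "(int p)\<^sup>2 > 0" using p0 by simp
    ultimately show False by linarith
  qed
  ultimately have "x * Y = X * y \<or> x * (- Y) = X * y"
    using vanish[of Y] vanish[of "- Y"] by (auto simp: dvd_minus_iff[of _ "x * Y + X * y", symmetric])
  then have "x\<^sup>2 * Y\<^sup>2 = X\<^sup>2 * y\<^sup>2"
    by (metis mult_minus_right power2_minus power_mult_distrib)
  then have "x\<^sup>2 * (3 * Y\<^sup>2) = X\<^sup>2 * (3 * y\<^sup>2)" by simp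
  moreover have "3 * Y\<^sup>2 = int p - X\<^sup>2" "3 * y\<^sup>2 = int p - x\<^sup>2" using xy XY by simp_all
  ultimately have "x\<^sup>2 * (int p - X\<^sup>2) = X\<^sup>2 * (int p - x\<^sup>2)" by simp
  then have "int p * x\<^sup>2 = int p * X\<^sup>2" by (simp add: algebra_simps)
  then have "x\<^sup>2 = X\<^sup>2" using p0 by simp
  then show ?thesis unfolding X by (simp add: power_mult_distrib)
qed

end

section \<open>Return to congruences in the localized ring\<close>

context large_prime
begin

lemma p_congI: "cg k a b \<Longrightarrow> b \<in> zp \<Longrightarrow> p_cong p k a b"
  using cg_zp by (auto simp: p_cong_def cg_def)

lemma sum_domb_4_zp: "(\<Sum>n=0..p-1. of_nat (domb n) / 4 ^ n) \<in> zp"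
  by (intro zp_sum zp_divide zp_of_nat zunit_power zunit_4)

lemma sum_domb_16_4: "cg 2 (\<Sum>n=0..p-1. of_nat (domb n) / 16 ^ n) (\<Sum>n=0..p-1. of_nat (domb n) / 4 ^ n)"
  by (rule cg_trans[OF sum_domb_16_cong cg_sym[OF sum_domb_4_cong]])

end

theorem theorem5p1:
  fixes p :: nat
  assumes "prime p" and "p > 3"
  shows "p_cong p 2 (\<Sum>n=0..p-1. of_nat (domb n) / 16 ^ n) (\<Sum>n=0..p-1. of_nat (domb n) / 4 ^ n)
    \<and> ([p = 1] (mod 3) \<longrightarrow>
         (\<forall>x y :: int. int p = x\<^sup>2 + 3 * y\<^sup>2 \<longrightarrow>
            p_cong p 2 (\<Sum>n=0..p-1. of_nat (domb n) / 4 ^ n) (4 * of_int x ^ 2 - 2 * of_nat p)))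
    \<and> ([p = 2] (mod 3) \<longrightarrow>
         p_cong p 2 (\<Sum>n=0..p-1. of_nat (domb n) / 4 ^ n) 0)"
proof (intro conjI impI allI)
  interpret large_prime p
    using assms by unfold_locales
  show "p_cong p 2 (\<Sum>n=0..p-1. of_nat (domb n) / 16 ^ n) (\<Sum>n=0..p-1. of_nat (domb n) / 4 ^ n)"
    by (rule p_congI[OF sum_domb_16_4 sum_domb_4_zp])
  show "p_cong p 2 (\<Sum>n=0..p-1. of_nat (domb n) / 4 ^ n) 0" if "[p = 2] (mod 3)"
    by (rule p_congI[OF cg_trans[OF sum_domb_4_cong reduced_sum_cong_0[OF that]] zp_0])
  show "p_cong p 2 (\<Sum>n=0..p-1. of_nat (domb n) / 4 ^ n) (4 * of_int x ^ 2 - 2 * of_nat p)"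
    if p3: "[p = 1] (mod 3)" and xy: "int p = x\<^sup>2 + 3 * y\<^sup>2" for x y :: int
  proof -
    have "p mod 3 = 1" "odd p"
      using p3 p_eq by (simp add: cong_def, presburger)
    then have "p = 6 * ((p - 1) div 6) + 1" by presburger
    then interpret prime_1_mod_6 p "(p - 1) div 6"
      by unfold_locales
    have "of_int (cubic_sum\<^sup>2) = (of_int (4 * x\<^sup>2) :: rat)"
      using cubic_sum_square[OF xy] by simp
    then have "cg 2 reduced_sum (4 * of_int x ^ 2 - 2 * of_nat p)"
      using reduced_sum_cong_cubic_sum by simp
    then show ?thesis
      by (intro p_congI cg_trans[OF sum_domb_4_cong]) auto
  qed
qed

end
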